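(* Let $L\subset S^3$ be an oriented link, let $\mathrm{Kh}'(L)$ be its odd Khovanov homology and $\mathrm{Kh}(L)$ its ordinary (Khovanov $sl(2)$) homology, both bigraded by homological grading $m$ and $q$-grading $s$. Then the mod two reductions of the two theories agree, i.e. for all $m,s\in\mathbb Z$, $$\operatorname{Tor}(\mathrm{Kh}_{m+1,s}(L),\mathbb Z/2\mathbb Z)\oplus\big(\mathrm{Kh}_{m,s}(L)\otimes\mathbb Z/2\mathbb Z\big)\;\cong\;\operatorname{Tor}(\mathrm{Kh}'_{m+1,s}(L),\mathbb Z/2\mathbb Z)\oplus\big(\mathrm{Kh}'_{m,s}(L)\otimes\mathbb Z/2\mathbb Z\big).$$
   Context: Resolutions and arrows. Let $\mathcal D$ be a planar diagram of $L$ with set of crossings $\mathcal X$, with $n_+$ positive and $n_-$ negative crossings. Near a crossing, drawn so that the over-strand runs from upper left to lower right, the $0$-resolution joins the two upper ends by an arc and the two lower ends by an arc, and the $1$-resolution joins the two left ends and the two right ends. At each crossing $x$ let $\gamma_x$ be a short arc at $x$ joining the two strands of the $0$-resolution; surgery along $\gamma_x$ turns the $0$-resolution into the $1$-resolution. Choose an orientation (arrow) on each $\gamma_x$. Rotating the arrow $90^\circ$ counterclockwise gives an oriented arc $\gamma_x^*$ joining the two strands of the $1$-resolution at $x$. Hypercube. Vertices are maps $I:\mathcal X\to\{0,1\}$; $\mathcal D(I)$ is the collection of disjoint planar circles obtained by resolving each $x$ according to $I(x)$. There is an edge $e$ from $I_0$ to $I_1$ if they agree except at one crossing $x$, where $I_0(x)=0$,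 $I_1(x)=1$. $V(\mathcal D(I))$ is the free abelian group on the circles of $\mathcal D(I)$. The map $F_e:\Lambda^*V(\mathcal D(I_0))\to\Lambda^*V(\mathcal D(I_1))$ is: (merge) if circles $a_1,a_2$ of $\mathcal D(I_0)$ are joined, $F_e$ is induced by $V(\mathcal D(I_0))\to V(\mathcal D(I_0))/(a_1-a_2)\cong V(\mathcal D(I_1))$; (split) if a circle divides into $a_1,a_2$, with $\gamma_x^*$ pointing from $a_1$ to $a_2$, then $F_e(v)=(a_1-a_2)\wedge\tilde v$, where $\tilde v$ is any lift of $v$ under $\Lambda^*V(\mathcal D(I_1))\to\Lambda^*(V(\mathcal D(I_1))/(a_1-a_2))\cong\Lambda^*V(\mathcal D(I_0))$. Types of squares. A square face is given by a vertex $I_{00}$ and crossings $x_1,x_2$ with $I_{00}(x_1)=I_{00}(x_2)=0$. If the two composites of edge maps around the square are nonzero, they agree up to sign; the square is of type $C$ if they are equal, type $A$ if they are negatives. They are both zero exactly when $\gamma_{x_1},\gamma_{x_2}$ have all endpoints on one circle of $\mathcal D(I_{00})$ and these interleave; then one arc lies inside the circle and the other outside. Traverse the circle counterclockwise from the tail of the inside arc: the square is of type $X$ if the next endpoint met is the tail of the outside arc, type $Y$ if it is the head. Edge assignments. Maps $\epsilon:\{\text{edges}\}\to\{\pm1\}$; a square is even (odd) if it has an even (odd) number of edges with $\epsilon=-1$. Type $X$: squares of types $A,X$ are even and of types $C,Y$ odd. Type $Y$: squares of types $A,Y$ are even and of types $C,X$ odd. Odd Khovanov homology. $C(\mathcal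 D)=\bigoplus_I\Lambda^*V(\mathcal D(I))$, $\partial_\epsilon(v)=\sum_e\epsilon(e)F_e(v)$ over edges $e$ starting at $I$, for $v\in\Lambda^*V(\mathcal D(I))$, with $\epsilon$ of type $X$ or $Y$. On $\Lambda^rV(\mathcal D(I))$ put $M_0=\sum_xI(x)$, $Q_0=\operatorname{rank}V(\mathcal D(I))-2r$, homological grading $m=M_0-n_-$, $q$-grading $s=Q_0+M_0+n_+-2n_-$; the differential preserves $s$ and raises $m$ by one. $\mathrm{Kh}'_{m,s}(L)$ is the bigraded homology of $(C(\mathcal D),\partial_\epsilon)$; up to isomorphism it depends only on $L$. Ordinary Khovanov homology. $\mathrm{Kh}_{m,s}(L)$ is defined from the same cube, assigning to $\mathcal D(I)$ with $k$ circles the group $A^{\otimes k}$, $A=\mathbb Z[x]/(x^2)$, with merges given by multiplication, splits by $\Delta(1)=1\otimes x+x\otimes1$, $\Delta(x)=x\otimes x$, and edge signs making every square anticommute. Here $Q_0$ is the tensor grading with $1$ in degree $+1$ and $x$ in degree $-1$, and $m,s$ are given by the same formulas. *)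

theory Defs
  imports
    "HOL-Algebra.Free_Abelian_Groups"
    "HOL-Algebra.Elementary_Groups"
    "HOL-Combinatorics.Orbits"
begin

section \<open>Oriented link diagrams\<close>

text \<open>
  A link is given by a planar diagram, encoded combinatorially in the manner of PD codes.
  Every crossing is drawn so that the over-strand runs between the upper left and the lower right
  corner, and its four corners are listed counterclockwise. Every arc of the diagram joins two
  crossing corners, except that an arc meeting no corner is a component without crossings.
  \<open>incoming D x c\<close> says that the arc at corner \<open>c\<close> is oriented towards the crossing \<open>x\<close>.
  The orientation of a crossingless component is not recorded: it affects neither the crossing
  signs nor the oriented isotopy class of the link.
\<close>

datatype corner = UL | LL | LR | UR

primrec ccw :: "corner \<Rightarrow> corner" where
  "ccw UL = LL" | "ccw LL = LR" | "ccw LR = UR" | "ccw UR = UL"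

record ('x, 'a) diagram =
  crossings :: "'x set"
  arcs :: "'a set"
  arc_at :: "'x \<Rightarrow> corner \<Rightarrow> 'a"
  incoming :: "'x \<Rightarrow> corner \<Rightarrow> bool"

definition ends :: "('x, 'a) diagram \<Rightarrow> ('x \<times> corner) set" where
  "ends D = crossings D \<times> UNIV"

definition ends_of :: "('x, 'a) diagram \<Rightarrow> 'a \<Rightarrow> ('x \<times> corner) set" where
  "ends_of D a = {(x, c) \<in> ends D. arc_at D x c = a}"

definition other_end :: "('x, 'a) diagram \<Rightarrow> 'x \<times> corner \<Rightarrow> 'x \<times> corner" where
  "other_end D p = (THE q. q \<in> ends_of D (arc_at D (fst p) (snd p)) \<and> q \<noteq> p)"

definition oriented_diagram :: "('x, 'a) diagram \<Rightarrow> bool" where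
  "oriented_diagram D \<longleftrightarrow>
     finite (crossings D) \<and> finite (arcs D) \<and>
     (\<forall>x\<in>crossings D. \<forall>c. arc_at D x c \<in> arcs D) \<and>
     (\<forall>a\<in>arcs D. ends_of D a = {} \<or>
        (\<exists>x c y d. ends_of D a = {(x, c), (y, d)} \<and> incoming D x c \<and> \<not> incoming D y d)) \<and>
     (\<forall>x\<in>crossings D. incoming D x UL \<noteq> incoming D x LR \<and> incoming D x UR \<noteq> incoming D x LL)"

text \<open>
  Planarity of the underlying four-valent graph is Euler's formula \<open>V - E + F = 2 c\<close>, where \<open>c\<close> is
  the number of connected components. A component of genus \<open>g\<close> contributes \<open>2 - 2 g\<close>
  to the left-hand side, so the equation holds iff every component has genus zero. Faces are the
  orbits of: follow the arc, then leave along the next corner counterclockwise.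
\<close>

definition face_step :: "('x, 'a) diagram \<Rightarrow> 'x \<times> corner \<Rightarrow> 'x \<times> corner" where
  "face_step D p = (case other_end D p of (y, d) \<Rightarrow> (y, ccw d))"

definition faces :: "('x, 'a) diagram \<Rightarrow> ('x \<times> corner) set set" where
  "faces D = orbit (face_step D) ` ends D"

definition adjacent :: "('x, 'a) diagram \<Rightarrow> ('x \<times> 'x) set" where
  "adjacent D = {(x, y). x \<in> crossings D \<and> y \<in> crossings D \<and> (\<exists>c d. arc_at D x c = arc_at D y d)}"

definition graph_components :: "('x, 'a) diagram \<Rightarrow> 'x set set" where
  "graph_components D = (\<lambda>x. (adjacent D)\<^sup>* `` {x}) ` crossings D"

definition planar :: "('x, 'a) diagram \<Rightarrow> bool" where
  "planar D \<longleftrightarrow>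
     int (card (crossings D)) - int (card {a \<in> arcs D. ends_of D a \<noteq> {}}) + int (card (faces D))
     = 2 * int (card (graph_components D))"

definition link_diagram :: "('x, 'a) diagram \<Rightarrow> bool" where
  "link_diagram D \<longleftrightarrow> oriented_diagram D \<and> planar D"

text \<open>
  A crossing is positive iff the direction of the under-strand is obtained from that of the
  over-strand by a counterclockwise turn, i.e. iff the two incoming ends are both on the left
  or both on the right.
\<close>

definition n_pos :: "('x, 'a) diagram \<Rightarrow> int" where
  "n_pos D = int (card {x \<in> crossings D. incoming D x UL = incoming D x LL})"

definition n_neg :: "('x, 'a) diagram \<Rightarrow> int" where
  "n_neg D = int (card {x \<in> crossings D. incoming D x UL \<noteq> incoming D x LL})"


section \<open>The cube of resolutions\<close>

text \<open>
  A vertex \<open>I : crossings \<rightarrow> {0, 1}\<close> is represented by the set of crossings it sends to 1, and the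
  edge from \<open>I\<close> to \<open>insert x I\<close> by the pair \<open>(I, x)\<close>. A circle of a resolution is represented by
  the set of arcs of the diagram that it runs through; so circles away from \<open>x\<close> are
  literally the same in \<open>I\<close> and in \<open>insert x I\<close>.
\<close>

definition vertices :: "('x, 'a) diagram \<Rightarrow> 'x set set" where
  "vertices D = Pow (crossings D)"

definition edges :: "('x, 'a) diagram \<Rightarrow> ('x set \<times> 'x) set" where
  "edges D = {(I, x). I \<in> vertices D \<and> x \<in> crossings D \<and> x \<notin> I}"

definition squares :: "('x, 'a) diagram \<Rightarrow> ('x set \<times> 'x \<times> 'x) set" where
  "squares D = {(I, x, y). I \<in> vertices D \<and> x \<in> crossings D \<and> y \<in> crossings D \<and>
     x \<notin> I \<and> y \<notin> I \<and> x \<noteq> y}"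

fun resolve :: "bool \<Rightarrow> corner \<Rightarrow> corner" where
  "resolve False UL = UR" | "resolve False UR = UL" | "resolve False LL = LR" | "resolve False LR = LL"
| "resolve True UL = LL" | "resolve True LL = UL" | "resolve True UR = LR" | "resolve True LR = UR"

definition joined :: "('x, 'a) diagram \<Rightarrow> 'x set \<Rightarrow> ('a \<times> 'a) set" where
  "joined D I = {(arc_at D x c, arc_at D x (resolve (x \<in> I) c)) | x c. x \<in> crossings D}"

definition circle_of :: "('x, 'a) diagram \<Rightarrow> 'x set \<Rightarrow> 'a \<Rightarrow> 'a set" where
  "circle_of D I a = (joined D I)\<^sup>* `` {a}"

definition circles :: "('x, 'a) diagram \<Rightarrow> 'x set \<Rightarrow> 'a set set" where
  "circles D I = circle_of D I ` arcs D"

definition is_merge :: "('x, 'a) diagram \<Rightarrow> 'x set \<Rightarrow> 'x \<Rightarrow> bool" where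
  "is_merge D I x \<longleftrightarrow> circle_of D I (arc_at D x UL) \<noteq> circle_of D I (arc_at D x LL)"


section \<open>Exterior algebra of the free abelian group on circles\<close>

text \<open>
  \<open>\<Lambda>\<^sup>* V\<close> is the free abelian group on the finite sets \<open>S\<close> of circles, where \<open>S\<close> stands for the
  wedge product of its elements in increasing order of their least arcs.
\<close>

definition exterior_algebra :: "'a set set \<Rightarrow> ('a set set \<Rightarrow>\<^sub>0 int) monoid" where
  "exterior_algebra Z = free_Abelian_group (Pow Z)"

definition circle_wedge :: "'a::linorder set \<Rightarrow> 'a set set \<Rightarrow> ('a set set \<Rightarrow>\<^sub>0 int)" where
  "circle_wedge c S =
     (if c \<in> S then 0 else frag_cmul ((-1) ^ card {d \<in> S. Min d < Min c}) (frag_of (insert c S)))"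

definition wedge :: "('a::linorder set \<Rightarrow>\<^sub>0 int) \<Rightarrow> ('a set set \<Rightarrow>\<^sub>0 int) \<Rightarrow> ('a set set \<Rightarrow>\<^sub>0 int)" where
  "wedge v w = frag_extend (\<lambda>c. frag_extend (circle_wedge c) w) v"

text \<open>The map of exterior algebras induced by a map \<open>f\<close> of circles.\<close>

definition exterior_map ::
    "('a::linorder set \<Rightarrow> 'a set) \<Rightarrow> ('a set set \<Rightarrow>\<^sub>0 int) \<Rightarrow> ('a set set \<Rightarrow>\<^sub>0 int)" where
  "exterior_map f = frag_extend
     (\<lambda>S. foldr (\<lambda>c. wedge (frag_of (f c))) (sorted_key_list_of_set Min S) (frag_of {}))"

definition identify :: "'a set \<Rightarrow> 'a set \<Rightarrow> 'a set \<Rightarrow> 'a set \<Rightarrow> 'a set" where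
  "identify a1 a2 b = (\<lambda>c. if c = a1 \<or> c = a2 then b else c)"


section \<open>The odd cube\<close>

text \<open>
  \<open>up x\<close> says that the arrow on the arc at \<open>x\<close> in the 0-resolution points from the lower to the upper
  strand; the rotated arrow in the 1-resolution then points from the right to the left strand.
  Otherwise both arrows are reversed. In the split case \<open>a1\<close> and \<open>a2\<close> are the circles containing
  the tail and the head of the rotated arrow.
\<close>

definition odd_split_circles ::
    "('x, 'a) diagram \<Rightarrow> ('x \<Rightarrow> bool) \<Rightarrow> 'x set \<Rightarrow> 'x \<Rightarrow> 'a set \<times> 'a set" where
  "odd_split_circles D up I x =
     (let l = circle_of D (insert x I) (arc_at D x UL);
          r = circle_of D (insert x I) (arc_at D x UR)
      in if up x then (r, l) else (l, r))"

definition odd_edge_map ::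
    "('x, 'a::linorder) diagram \<Rightarrow> ('x \<Rightarrow> bool) \<Rightarrow> 'x set \<Rightarrow> 'x
      \<Rightarrow> ('a set set \<Rightarrow>\<^sub>0 int) \<Rightarrow> ('a set set \<Rightarrow>\<^sub>0 int)" where
  "odd_edge_map D up I x v =
     (if is_merge D I x then
        exterior_map (identify (circle_of D I (arc_at D x UL)) (circle_of D I (arc_at D x LL))
          (circle_of D (insert x I) (arc_at D x UL))) v
      else
        (case odd_split_circles D up I x of (a1, a2) \<Rightarrow>
          wedge (frag_of a1 - frag_of a2)
            (SOME w. w \<in> carrier (exterior_algebra (circles D (insert x I))) \<and>
               exterior_map (identify a1 a2 (circle_of D I (arc_at D x UL))) w = v)))"

definition type_C :: "('x, 'a::linorder) diagram \<Rightarrow> ('x \<Rightarrow> bool) \<Rightarrow> 'x set \<Rightarrow> 'x \<Rightarrow> 'x \<Rightarrow> bool" where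
  "type_C D up I x y \<longleftrightarrow>
     (let \<Lambda> = carrier (exterior_algebra (circles D I));
          f = (\<lambda>v. odd_edge_map D up (insert x I) y (odd_edge_map D up I x v));
          g = (\<lambda>v. odd_edge_map D up (insert y I) x (odd_edge_map D up I y v))
      in (\<exists>v\<in>\<Lambda>. f v \<noteq> 0) \<and> (\<exists>v\<in>\<Lambda>. g v \<noteq> 0) \<and> (\<forall>v\<in>\<Lambda>. f v = g v))"

definition type_A :: "('x, 'a::linorder) diagram \<Rightarrow> ('x \<Rightarrow> bool) \<Rightarrow> 'x set \<Rightarrow> 'x \<Rightarrow> 'x \<Rightarrow> bool" where
  "type_A D up I x y \<longleftrightarrow>
     (let \<Lambda> = carrier (exterior_algebra (circles D I));
          f = (\<lambda>v. odd_edge_map D up (insert x I) y (odd_edge_map D up I x v));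
          g = (\<lambda>v. odd_edge_map D up (insert y I) x (odd_edge_map D up I y v))
      in (\<exists>v\<in>\<Lambda>. f v \<noteq> 0) \<and> (\<exists>v\<in>\<Lambda>. g v \<noteq> 0) \<and> (\<forall>v\<in>\<Lambda>. f v = - g v))"

text \<open>
  An end \<open>(x, c)\<close> also stands for the strand of the resolution at \<open>x\<close> entered through corner \<open>c\<close>;
  \<open>walk\<close> passes along that strand and the following arc to the next strand, so its orbits are
  the circles together with a direction.
\<close>

definition walk :: "('x, 'a) diagram \<Rightarrow> 'x set \<Rightarrow> 'x \<times> corner \<Rightarrow> 'x \<times> corner" where
  "walk D I p = other_end D (fst p, resolve (fst p \<in> I) (snd p))"

definition cyclically_ordered :: "('p \<Rightarrow> 'p) \<Rightarrow> 'p \<Rightarrow> 'p \<Rightarrow> 'p \<Rightarrow> 'p \<Rightarrow> bool" where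
  "cyclically_ordered f p q r s \<longleftrightarrow>
     (\<exists>i j k. 0 < i \<and> i < j \<and> j < k \<and> (f ^^ i) p = q \<and> (f ^^ j) p = r \<and> (f ^^ k) p = s \<and>
        (\<forall>n. 0 < n \<and> n \<le> k \<longrightarrow> (f ^^ n) p \<noteq> p))"

text \<open>
  The strand of the 0-resolution at \<open>x\<close> carrying the tail or head of the arrow, traversed so that the
  arrow lies on the left or on the right of the direction of travel.
\<close>

definition left_tail :: "('x \<Rightarrow> bool) \<Rightarrow> 'x \<Rightarrow> 'x \<times> corner" where
  "left_tail up x = (x, if up x then LL else UR)"
definition left_head :: "('x \<Rightarrow> bool) \<Rightarrow> 'x \<Rightarrow> 'x \<times> corner" where
  "left_head up x = (x, if up x then UR else LL)"
definition right_tail :: "('x \<Rightarrow> bool) \<Rightarrow> 'x \<Rightarrow> 'x \<times> corner" where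
  "right_tail up x = (x, if up x then LR else UL)"
definition right_head :: "('x \<Rightarrow> bool) \<Rightarrow> 'x \<Rightarrow> 'x \<times> corner" where
  "right_head up x = (x, if up x then UL else LR)"

text \<open>
  Traversing a planar circle counterclockwise keeps its inside on the left, so in the following \<open>x\<close>
  plays the part of the inside arc and \<open>y\<close> that of the outside arc. Which side of the circle
  is the inside depends on the position of the unbounded face, but the type does not: reversing the
  direction of travel exchanges left and right, and turns the cyclic order tail of \<open>x\<close>, tail of \<open>y\<close>,
  head of \<open>x\<close>, head of \<open>y\<close> into tail of \<open>y\<close>, tail of \<open>x\<close>, head of \<open>y\<close>, head of \<open>x\<close>. In particular
  both predicates are symmetric in \<open>x\<close> and \<open>y\<close>, and no unbounded face has to be chosen.
\<close>

definition type_X :: "('x, 'a) diagram \<Rightarrow> ('x \<Rightarrow> bool) \<Rightarrow> 'x set \<Rightarrow> 'x \<Rightarrow> 'x \<Rightarrow> bool" where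
  "type_X D up I x y \<longleftrightarrow> cyclically_ordered (walk D I)
     (left_tail up x) (right_tail up y) (left_head up x) (right_head up y)"

definition type_Y :: "('x, 'a) diagram \<Rightarrow> ('x \<Rightarrow> bool) \<Rightarrow> 'x set \<Rightarrow> 'x \<Rightarrow> 'x \<Rightarrow> bool" where
  "type_Y D up I x y \<longleftrightarrow> cyclically_ordered (walk D I)
     (left_tail up x) (right_head up y) (left_head up x) (right_tail up y)"

definition square_edges :: "'x set \<Rightarrow> 'x \<Rightarrow> 'x \<Rightarrow> ('x set \<times> 'x) set" where
  "square_edges I x y = {(I, x), (I, y), (insert x I, y), (insert y I, x)}"

definition even_square :: "('x set \<times> 'x \<Rightarrow> int) \<Rightarrow> 'x set \<Rightarrow> 'x \<Rightarrow> 'x \<Rightarrow> bool" where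
  "even_square \<epsilon> I x y \<longleftrightarrow> even (card {e \<in> square_edges I x y. \<epsilon> e = -1})"

definition odd_assignment_X ::
    "('x, 'a::linorder) diagram \<Rightarrow> ('x \<Rightarrow> bool) \<Rightarrow> ('x set \<times> 'x \<Rightarrow> int) \<Rightarrow> bool" where
  "odd_assignment_X D up \<epsilon> \<longleftrightarrow> \<epsilon> ` edges D \<subseteq> {1, -1} \<and>
     (\<forall>(I, x, y) \<in> squares D.
        (type_A D up I x y \<or> type_X D up I x y \<longrightarrow> even_square \<epsilon> I x y) \<and>
        (type_C D up I x y \<or> type_Y D up I x y \<longrightarrow> \<not> even_square \<epsilon> I x y))"

definition odd_assignment_Y ::
    "('x, 'a::linorder) diagram \<Rightarrow> ('x \<Rightarrow> bool) \<Rightarrow> ('x set \<times> 'x \<Rightarrow> int) \<Rightarrow> bool" where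
  "odd_assignment_Y D up \<epsilon> \<longleftrightarrow> \<epsilon> ` edges D \<subseteq> {1, -1} \<and>
     (\<forall>(I, x, y) \<in> squares D.
        (type_A D up I x y \<or> type_Y D up I x y \<longrightarrow> even_square \<epsilon> I x y) \<and>
        (type_C D up I x y \<or> type_X D up I x y \<longrightarrow> \<not> even_square \<epsilon> I x y))"


section \<open>The even cube\<close>

text \<open>
  \<open>G1\<close>, \<open>Gx\<close> are the basis elements \<open>1\<close>, \<open>x\<close> of \<open>A = \<int>[x]/(x\<^sup>2)\<close>. The tensor power of \<open>A\<close> over a set
  of circles is the free abelian group on the labellings of the circles by \<open>G1\<close> and \<open>Gx\<close>.
\<close>

datatype gen = G1 | Gx

fun A_mult :: "gen \<Rightarrow> gen \<Rightarrow> (gen \<Rightarrow>\<^sub>0 int)" where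
  "A_mult G1 g = frag_of g"
| "A_mult Gx G1 = frag_of Gx"
| "A_mult Gx Gx = 0"

fun A_comult :: "gen \<Rightarrow> (gen \<times> gen \<Rightarrow>\<^sub>0 int)" where
  "A_comult G1 = frag_of (G1, Gx) + frag_of (Gx, G1)"
| "A_comult Gx = frag_of (Gx, Gx)"

definition labellings :: "'a set set \<Rightarrow> ('a set \<Rightarrow> gen) set" where
  "labellings Z = Z \<rightarrow>\<^sub>E UNIV"

definition tensor_power_A :: "'a set set \<Rightarrow> (('a set \<Rightarrow> gen) \<Rightarrow>\<^sub>0 int) monoid" where
  "tensor_power_A Z = free_Abelian_group (labellings Z)"

definition even_edge_map ::
    "('x, 'a) diagram \<Rightarrow> 'x set \<Rightarrow> 'x
      \<Rightarrow> (('a set \<Rightarrow> gen) \<Rightarrow>\<^sub>0 int) \<Rightarrow> (('a set \<Rightarrow> gen) \<Rightarrow>\<^sub>0 int)" where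
  "even_edge_map D I x =
     (let Z' = circles D (insert x I);
          a1 = circle_of D I (arc_at D x UL); a2 = circle_of D I (arc_at D x LL);
          b1 = circle_of D (insert x I) (arc_at D x UL); b2 = circle_of D (insert x I) (arc_at D x UR)
      in frag_extend (\<lambda>\<sigma>.
           if is_merge D I x then
             frag_extend (\<lambda>g. frag_of (restrict (\<sigma>(b1 := g)) Z')) (A_mult (\<sigma> a1) (\<sigma> a2))
           else
             frag_extend (\<lambda>(g, h). frag_of (restrict (\<sigma>(b1 := g, b2 := h)) Z')) (A_comult (\<sigma> a1))))"

definition even_assignment :: "('x, 'a) diagram \<Rightarrow> ('x set \<times> 'x \<Rightarrow> int) \<Rightarrow> bool" where
  "even_assignment D \<delta> \<longleftrightarrow> \<delta> ` edges D \<subseteq> {1, -1} \<and>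
     (\<forall>(I, x, y) \<in> squares D. \<forall>v \<in> carrier (tensor_power_A (circles D I)).
        frag_cmul (\<delta> (insert x I, y) * \<delta> (I, x))
          (even_edge_map D (insert x I) y (even_edge_map D I x v))
        = - frag_cmul (\<delta> (insert y I, x) * \<delta> (I, y))
          (even_edge_map D (insert y I) x (even_edge_map D I y v)))"


section \<open>Chain complexes and homology\<close>

text \<open>
  Both complexes are free abelian groups on pairs consisting of a vertex \<open>I\<close> and a basis element
  \<open>b\<close> over \<open>I\<close>. The differential is the signed sum of the edge maps \<open>F I x\<close>.
\<close>

definition at_vertex :: "'x set \<Rightarrow> ('b \<Rightarrow>\<^sub>0 int) \<Rightarrow> ('x set \<times> 'b \<Rightarrow>\<^sub>0 int)" where
  "at_vertex I = frag_extend (\<lambda>b. frag_of (I, b))"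

definition cube_differential ::
    "('x, 'a) diagram \<Rightarrow> ('x set \<times> 'x \<Rightarrow> int) \<Rightarrow> ('x set \<Rightarrow> 'x \<Rightarrow> ('b \<Rightarrow>\<^sub>0 int) \<Rightarrow> ('b \<Rightarrow>\<^sub>0 int))
      \<Rightarrow> ('x set \<times> 'b \<Rightarrow>\<^sub>0 int) \<Rightarrow> ('x set \<times> 'b \<Rightarrow>\<^sub>0 int)" where
  "cube_differential D \<epsilon> F = frag_extend (\<lambda>(I, b).
     \<Sum>x \<in> crossings D - I. frag_cmul (\<epsilon> (I, x)) (at_vertex (insert x I) (F I x (frag_of b))))"

definition homological_grading :: "('x, 'a) diagram \<Rightarrow> 'x set \<Rightarrow> int" where
  "homological_grading D I = int (card I) - n_neg D"

definition q_grading :: "('x, 'a) diagram \<Rightarrow> 'x set \<Rightarrow> int \<Rightarrow> int" where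
  "q_grading D I Q0 = Q0 + int (card I) + n_pos D - 2 * n_neg D"

definition odd_chain_group ::
    "('x, 'a) diagram \<Rightarrow> int \<Rightarrow> int \<Rightarrow> ('x set \<times> 'a set set \<Rightarrow>\<^sub>0 int) monoid" where
  "odd_chain_group D m s = free_Abelian_group
     {(I, S). I \<in> vertices D \<and> S \<subseteq> circles D I \<and> homological_grading D I = m \<and>
        q_grading D I (int (card (circles D I)) - 2 * int (card S)) = s}"

definition even_chain_group ::
    "('x, 'a) diagram \<Rightarrow> int \<Rightarrow> int \<Rightarrow> ('x set \<times> ('a set \<Rightarrow> gen) \<Rightarrow>\<^sub>0 int) monoid" where
  "even_chain_group D m s = free_Abelian_group
     {(I, \<sigma>). I \<in> vertices D \<and> \<sigma> \<in> labellings (circles D I) \<and> homological_grading D I = m \<and>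
        q_grading D I (int (card {c \<in> circles D I. \<sigma> c = G1})
          - int (card {c \<in> circles D I. \<sigma> c = Gx})) = s}"

text \<open>Homology at the middle term of \<open>P \<rightarrow> G \<rightarrow> N\<close>, both maps being restrictions of \<open>d\<close>.\<close>

definition homology_at :: "'g monoid \<Rightarrow> 'g monoid \<Rightarrow> 'g monoid \<Rightarrow> ('g \<Rightarrow> 'g) \<Rightarrow> 'g set monoid" where
  "homology_at P G N d = subgroup_generated G (kernel G N d) Mod (d ` carrier P)"

definition odd_Kh ::
    "('x, 'a::linorder) diagram \<Rightarrow> ('x \<Rightarrow> bool) \<Rightarrow> ('x set \<times> 'x \<Rightarrow> int) \<Rightarrow> int \<Rightarrow> int
      \<Rightarrow> ('x set \<times> 'a set set \<Rightarrow>\<^sub>0 int) set monoid" where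
  "odd_Kh D up \<epsilon> m s =
     homology_at (odd_chain_group D (m - 1) s) (odd_chain_group D m s) (odd_chain_group D (m + 1) s)
       (cube_differential D \<epsilon> (odd_edge_map D up))"

definition even_Kh ::
    "('x, 'a) diagram \<Rightarrow> ('x set \<times> 'x \<Rightarrow> int) \<Rightarrow> int \<Rightarrow> int
      \<Rightarrow> ('x set \<times> ('a set \<Rightarrow> gen) \<Rightarrow>\<^sub>0 int) set monoid" where
  "even_Kh D \<delta> m s =
     homology_at (even_chain_group D (m - 1) s) (even_chain_group D m s) (even_chain_group D (m + 1) s)
       (cube_differential D \<delta> (even_edge_map D))"


section \<open>Tensor and torsion products of abelian groups\<close>

definition tensor_relations ::
    "('g, 'm) monoid_scheme \<Rightarrow> ('h, 'n) monoid_scheme \<Rightarrow> ('g \<times> 'h \<Rightarrow>\<^sub>0 int) set" where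
  "tensor_relations G H = generate (free_Abelian_group (carrier G \<times> carrier H))
     ({frag_of (g \<otimes>\<^bsub>G\<^esub> g', h) - frag_of (g, h) - frag_of (g', h) | g g' h.
         g \<in> carrier G \<and> g' \<in> carrier G \<and> h \<in> carrier H} \<union>
      {frag_of (g, h \<otimes>\<^bsub>H\<^esub> h') - frag_of (g, h) - frag_of (g, h') | g h h'.
         g \<in> carrier G \<and> h \<in> carrier H \<and> h' \<in> carrier H})"

definition tensor_product ::
    "('g, 'm) monoid_scheme \<Rightarrow> ('h, 'n) monoid_scheme \<Rightarrow> ('g \<times> 'h \<Rightarrow>\<^sub>0 int) set monoid" where
  "tensor_product G H = free_Abelian_group (carrier G \<times> carrier H) Mod tensor_relations G H"

text \<open>
  \<open>Tor G H\<close> is the kernel of \<open>R \<otimes> H \<rightarrow> F \<otimes> H\<close> for the free resolution \<open>0 \<rightarrow> R \<rightarrow> F \<rightarrow> G \<rightarrow> 0\<close> in which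
  \<open>F\<close> is the free abelian group on the underlying set of \<open>G\<close>. The map sends a coset of the relations
  of \<open>R \<otimes> H\<close> to the coset of the relations of \<open>F \<otimes> H\<close> containing it.
\<close>

definition resolution_eval :: "('g, 'm) monoid_scheme \<Rightarrow> ('g \<Rightarrow>\<^sub>0 int) \<Rightarrow> 'g" where
  "resolution_eval G c =
     finprod G (\<lambda>g. g [^]\<^bsub>G\<^esub> Poly_Mapping.lookup c g) (Poly_Mapping.keys c)"

definition resolution_kernel :: "('g, 'm) monoid_scheme \<Rightarrow> ('g \<Rightarrow>\<^sub>0 int) monoid" where
  "resolution_kernel G = subgroup_generated (free_Abelian_group (carrier G))
     (kernel (free_Abelian_group (carrier G)) G (resolution_eval G))"

definition Tor ::
    "('g, 'm) monoid_scheme \<Rightarrow> ('h, 'n) monoid_scheme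
      \<Rightarrow> (('g \<Rightarrow>\<^sub>0 int) \<times> 'h \<Rightarrow>\<^sub>0 int) set monoid" where
  "Tor G H =
     (let F = free_Abelian_group (carrier G);
          R = resolution_kernel G;
          \<iota> = (\<lambda>X. tensor_relations F H <#>\<^bsub>free_Abelian_group (carrier F \<times> carrier H)\<^esub> X)
      in subgroup_generated (tensor_product R H)
           (kernel (tensor_product R H) (tensor_product F H) \<iota>))"

end

theory Submission
  imports Defs
begin

text \<open>
  Send a set \<open>S\<close> of circles to the labelling of the circles by \<open>x\<close> on \<open>S\<close> and \<open>1\<close> off \<open>S\<close>. Modulo two this
  bijection of bases, which preserves both gradings, carries the merge and split maps of the odd cube
  to those of the even cube, and signs no longer matter. So the two complexes become isomorphic after reduction modulo
  two. By universal coefficients both sides of the claim have the order of the homology of that common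
  reduction, and both are finite elementary abelian 2-groups, hence they are isomorphic.

  That the odd differential squares to zero has to be proved: the given signs only control squares of
  the four types, so every square must commute up to sign or vanish along both composites.
  This rests on the fact that a surgery always merges or splits. A planar diagram has an orientation of its
  arcs that alternates around every crossing. All resolutions respect it, so their circles are the cycles of permutations
  of the arcs, and a surgery composes the permutation with a transposition.
\<close>

section \<open>Cycles of a permutation and Euler's inequality\<close>

text \<open>For a diagram on a torus a surgery can carry one circle to one circle, and then neither
  case of the edge map describes it. Planarity is given only as an Euler characteristic, so this has
  to be excluded by counting instead of a Jordan curve argument. The obstruction to an orientation
  that alternates around every crossing is a double cover whose sheets are exchanged by a quarter
  turn at a crossing and by passage along an arc. A crossing has four corners and a step along a
  face makes two exchanges, so crossings and faces lift to two each, and so do arcs. From V - E + F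
  = 2 c in the plane and V' + F' \<le> E' + 2 c' in the cover follows c' \<ge> 2 c. Every component
  thus lifts to two components, and choosing one of the two is the orientation. Universal
  coefficients enter through orders only. With C, Z, B the integral chains, cycles and boundaries,
  the tower B + 2 C, Z + 2 C, d^-1(2 C) has the orders of the tensor and of the Tor term as its
  successive indices.\<close>

definition cycle_rel :: "('p \<Rightarrow> 'p) \<Rightarrow> 'p set \<Rightarrow> ('p \<times> 'p) set" where
  "cycle_rel f S = {(p, f p) | p. p \<in> S}"

definition components :: "('p \<times> 'p) set \<Rightarrow> 'p set \<Rightarrow> 'p set set" where
  "components r S = (\<lambda>p. r\<^sup>* `` {p}) ` S"

text \<open>A permutation of a finite set, with no condition outside \<open>S\<close>: the maps of
  ends and arcs to which this applies are meaningful only on the diagram.\<close>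

definition self_bij :: "('p \<Rightarrow> 'p) \<Rightarrow> 'p set \<Rightarrow> bool" where
  "self_bij f S \<longleftrightarrow> finite S \<and> inj_on f S \<and> f ` S \<subseteq> S"

lemma cycle_rel_cong: "(\<And>p. p \<in> S \<Longrightarrow> f p = g p) \<Longrightarrow> cycle_rel f S = cycle_rel g S"
  unfolding cycle_rel_def by force

lemma funpow_in: "f ` S \<subseteq> S \<Longrightarrow> p \<in> S \<Longrightarrow> (f ^^ n) p \<in> S"
  by (induction n) auto

lemma cycle_rel_rtrancl:
  assumes "f ` S \<subseteq> S" "p \<in> S"
  shows "(p, q) \<in> (cycle_rel f S)\<^sup>* \<longleftrightarrow> (\<exists>n. q = (f ^^ n) p)"
proof
  assume "(p, q) \<in> (cycle_rel f S)\<^sup>*"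
  then show "\<exists>n. q = (f ^^ n) p"
  proof induction
    case base
    show ?case by (rule exI[of _ 0]) simp
  next
    case (step y z)
    then obtain n where "y = (f ^^ n) p" by blast
    with step(2) have "z = (f ^^ Suc n) p" by (auto simp: cycle_rel_def)
    then show ?case by blast
  qed
next
  have "(p, (f ^^ n) p) \<in> (cycle_rel f S)\<^sup>*" for n
  proof (induction n)
    case (Suc n)
    have "((f ^^ n) p, (f ^^ Suc n) p) \<in> cycle_rel f S"
      using funpow_in[OF assms] by (auto simp: cycle_rel_def)
    with Suc show ?case by (rule rtrancl_into_rtrancl)
  qed simp
  then show "\<exists>n. q = (f ^^ n) p \<Longrightarrow> (p, q) \<in> (cycle_rel f S)\<^sup>*" by blast
qed

lemma self_bij_returns:
  assumes "self_bij f S" "p \<in> S"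
  shows "\<exists>n>0. (f ^^ n) p = p"
proof -
  \<comment> \<open>Extending \<open>f\<close> by the identity gives a map that
    \<open>permutes\<close> the set, for which orbits return; on \<open>S\<close> the powers
    agree.\<close>
  define g where "g = (\<lambda>x. if x \<in> S then f x else x)"
  have "bij_betw f S S"
    using assms(1) unfolding self_bij_def bij_betw_def by (simp add: endo_inj_surj)
  then have "bij_betw g S S" by (subst bij_betw_cong[of S g f S]) (auto simp: g_def)
  then have "g permutes S" by (rule bij_imp_permutes) (simp add: g_def)
  then have "permutation g"
    using assms(1) permutation_permutes self_bij_def by blast
  then have "p \<in> orbit g p" by (rule permutation_self_in_orbit)
  then obtain n where n: "0 < n" "(g ^^ n) p = p" by (auto simp: orbit_altdef)
  have "(g ^^ k) p = (f ^^ k) p" for k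
  proof (induction k)
    case (Suc k)
    then show ?case
      using funpow_in[of f S p k] assms by (simp add: g_def self_bij_def)
  qed simp
  with n show ?thesis by metis
qed

text \<open>On a finite set a step of a permutation is undone by further forward steps, so
  reachability along cycles is an equivalence relation.\<close>

lemma cycle_rel_sym:
  assumes "self_bij f S"
  shows "sym ((cycle_rel f S)\<^sup>*)"
proof -
  have "(cycle_rel f S)\<inverse> \<subseteq> (cycle_rel f S)\<^sup>*"
  proof clarify
    fix a b assume "(b, a) \<in> cycle_rel f S"
    then have b: "b \<in> S" "a = f b" by (auto simp: cycle_rel_def)
    obtain n where "n > 0" "(f ^^ n) b = b" using self_bij_returns[OF assms b(1)] by blast
    then obtain k where "(f ^^ k) (f b) = b"
      by (metis Suc_pred comp_apply funpow_Suc_right)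
    moreover have "f ` S \<subseteq> S" "f b \<in> S" using assms b by (auto simp: self_bij_def)
    ultimately show "(a, b) \<in> (cycle_rel f S)\<^sup>*"
      using b by (metis cycle_rel_rtrancl)
  qed
  then have "((cycle_rel f S)\<inverse>)\<^sup>* \<subseteq> (cycle_rel f S)\<^sup>*"
    by (metis rtrancl_subset_rtrancl)
  then show ?thesis
    by (metis converse_converse rtrancl_converse sym_conv_converse_eq sym_def converseI converseD subsetD)
qed

text \<open>After the swap the walk from \<open>q\<close> starts along the old cycle of
  \<open>p\<close>, and the walk from \<open>p\<close> along that of \<open>q\<close>. Two distinct
  cycles are thereby spliced into one, and a common cycle is cut in two.\<close>

lemma transpose_toggles_connected:
  assumes S: "self_bij f S" and pq: "p \<in> S" "q \<in> S" "p \<noteq> q"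
  shows "(p, q) \<in> (cycle_rel (f \<circ> transpose p q) S)\<^sup>* \<longleftrightarrow> (p, q) \<notin> (cycle_rel f S)\<^sup>*"
proof -
  define g where "g = f \<circ> transpose p q"
  have fS: "f ` S \<subseteq> S" using S by (simp add: self_bij_def)
  have tS: "transpose p q ` S = S" using pq by (simp add: transpose_image_eq)
  have gS: "g ` S \<subseteq> S" using fS tS unfolding g_def by (metis image_comp)
  have g_bij: "self_bij g S"
    using S gS tS unfolding self_bij_def g_def
    by (metis comp_inj_on inj_on_transpose)
  have g: "g p = f q" "g q = f p" "\<And>x. x \<noteq> p \<Longrightarrow> x \<noteq> q \<Longrightarrow> g x = f x"
    by (auto simp: g_def)
  show ?thesis
  proof (cases "(p, q) \<in> (cycle_rel f S)\<^sup>*")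
    case False
    then have nq: "(f ^^ n) p \<noteq> q" for n by (metis cycle_rel_rtrancl fS pq(1))
    \<comment> \<open>\<open>N\<close> is the period of \<open>p\<close>. From \<open>q\<close> the
      new walk copies the old one from \<open>p\<close>, meets neither point on the way, and reaches
      \<open>p\<close> after \<open>N\<close> steps.\<close>
    define N where "N = (LEAST n. n > 0 \<and> (f ^^ n) p = p)"
    have N: "N > 0" "(f ^^ N) p = p"
      using LeastI_ex[OF self_bij_returns[OF S pq(1)]] unfolding N_def by auto
    have least: "(f ^^ k) p \<noteq> p" if "0 < k" "k < N" for k
      using not_less_Least[of k "\<lambda>n. n > 0 \<and> (f ^^ n) p = p"] that unfolding N_def by auto
    have "(g ^^ Suc k) q = (f ^^ Suc k) p" if "Suc k \<le> N" for k
      using that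
    proof (induction k)
      case (Suc k)
      then have IH: "(g ^^ Suc k) q = (f ^^ Suc k) p" by simp
      have "(g ^^ Suc (Suc k)) q = g ((f ^^ Suc k) p)"
        using IH by (metis funpow.simps(2) comp_apply)
      also have "\<dots> = f ((f ^^ Suc k) p)"
        by (rule g(3)) (use nq[of "Suc k"] least[of "Suc k"] Suc.prems in auto)
      finally show ?case by simp
    qed (simp add: g)
    from this[of "N - 1"] N have "(g ^^ N) q = p" by simp
    then have "(q, p) \<in> (cycle_rel g S)\<^sup>*" by (metis cycle_rel_rtrancl gS pq(2))
    then have "(p, q) \<in> (cycle_rel g S)\<^sup>*" using cycle_rel_sym[OF g_bij] by (meson symD)
    with False show ?thesis by (simp add: g_def)
  next
    case True
    then have "(q, p) \<in> (cycle_rel f S)\<^sup>*" using cycle_rel_sym[OF S] by (meson symD)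
    then obtain n0 where n0: "(f ^^ n0) q = p" by (metis cycle_rel_rtrancl fS pq(2))
    \<comment> \<open>Here \<open>N\<close> is the distance from \<open>q\<close> to
      \<open>p\<close> along the old cycle. The new walk from \<open>p\<close> copies the old one
      from \<open>q\<close> and closes after \<open>N\<close> steps without having met
      \<open>q\<close>.\<close>
    define N where "N = (LEAST n. (f ^^ n) q = p)"
    have N: "(f ^^ N) q = p" unfolding N_def using n0 by (rule LeastI)
    have least: "(f ^^ k) q \<noteq> p" if "k < N" for k
      using not_less_Least[of k "\<lambda>n. (f ^^ n) q = p"] that unfolding N_def by auto
    have N0: "N > 0" using N pq(3) by (cases N) auto
    have neq: "(f ^^ k) q \<noteq> q" if "0 < k" "k < N" for k
    proof
      assume "(f ^^ k) q = q"
      then have "(f ^^ (N - k)) q = (f ^^ (N - k)) ((f ^^ k) q)" by simp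
      also have "\<dots> = (f ^^ N) q" using that by (simp flip: funpow_add comp_apply[of "f ^^ (N-k)"])
      finally have "(f ^^ (N - k)) q = p" using N by simp
      with least[of "N - k"] that show False by simp
    qed
    have eq: "(g ^^ Suc k) p = (f ^^ Suc k) q" if "Suc k \<le> N" for k
      using that
    proof (induction k)
      case (Suc k)
      then have IH: "(g ^^ Suc k) p = (f ^^ Suc k) q" by simp
      have "(g ^^ Suc (Suc k)) p = g ((f ^^ Suc k) q)"
        using IH by (metis funpow.simps(2) comp_apply)
      also have "\<dots> = f ((f ^^ Suc k) q)"
        by (rule g(3)) (use neq[of "Suc k"] least[of "Suc k"] Suc.prems in auto)
      finally show ?case by simp
    qed (simp add: g)
    from eq[of "N - 1"] N N0 have per: "(g ^^ N) p = p" by simp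
    have "(g ^^ m) p \<noteq> q" for m
    proof -
      have m: "(g ^^ m) p = (g ^^ (m mod N)) p" using funpow_mod_eq[OF per] by simp
      have "m mod N < N" using N0 by simp
      moreover have "(g ^^ k) p \<noteq> q" if "k < N" for k
      proof (cases k)
        case 0
        then show ?thesis using pq by simp
      next
        case (Suc j)
        then show ?thesis using eq[of j] neq[of k] that by simp
      qed
      ultimately show ?thesis using m by metis
    qed
    then have "(p, q) \<notin> (cycle_rel g S)\<^sup>*" by (metis cycle_rel_rtrancl gS pq(1))
    with True show ?thesis by (simp add: g_def)
  qed
qed

lemma self_bij_transpose:
  assumes "self_bij f S" "p \<in> S" "q \<in> S"
  shows "self_bij (f \<circ> transpose p q) S"
proof -
  have tS: "transpose p q ` S = S" using assms by (simp add: transpose_image_eq)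
  then have "(f \<circ> transpose p q) ` S \<subseteq> S" using assms(1) unfolding self_bij_def by (metis image_comp)
  then show ?thesis
    using assms tS unfolding self_bij_def by (metis comp_inj_on inj_on_transpose)
qed

section \<open>Equivalence classes joined by one new link\<close>

lemma rtrancl_join_iff:
  assumes "sym (r\<^sup>*)"
  shows "(a, b) \<in> (r \<union> {(p, q), (q, p)})\<^sup>* \<longleftrightarrow>
    (a, b) \<in> r\<^sup>* \<or> (a \<in> r\<^sup>* `` {p, q} \<and> b \<in> r\<^sup>* `` {p, q})"
proof
  assume "(a, b) \<in> (r \<union> {(p, q), (q, p)})\<^sup>*"
  then show "(a, b) \<in> r\<^sup>* \<or> (a \<in> r\<^sup>* `` {p, q} \<and> b \<in> r\<^sup>* `` {p, q})"
  proof induction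
    case (step y z)
    have s: "(v, u) \<in> r\<^sup>*" if "(u, v) \<in> r\<^sup>*" for u v using assms that by (meson symD)
    from step(2) consider "(y, z) \<in> r" | "y = p \<and> z = q \<or> y = q \<and> z = p" by auto
    then show ?case
    proof cases
      case 1
      with step.IH show ?thesis by (auto intro: rtrancl_into_rtrancl)
    next
      case 2
      with step.IH s show ?thesis by blast
    qed
  qed simp
next
  let ?J = "r \<union> {(p, q), (q, p)}"
  have J: "(u, v) \<in> ?J\<^sup>*" if "(u, v) \<in> r\<^sup>*" for u v
    using that by (meson rtrancl_mono sup_ge1 subsetD)
  have pq: "(p, q) \<in> ?J\<^sup>*" "(q, p) \<in> ?J\<^sup>*" by auto
  have s: "(v, u) \<in> r\<^sup>*" if "(u, v) \<in> r\<^sup>*" for u v using assms that by (meson symD)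
  assume "(a, b) \<in> r\<^sup>* \<or> (a \<in> r\<^sup>* `` {p, q} \<and> b \<in> r\<^sup>* `` {p, q})"
  then show "(a, b) \<in> ?J\<^sup>*"
  proof
    assume "a \<in> r\<^sup>* `` {p, q} \<and> b \<in> r\<^sup>* `` {p, q}"
    then obtain u v where "u \<in> {p, q}" "v \<in> {p, q}" "(a, u) \<in> r\<^sup>*" "(v, b) \<in> r\<^sup>*"
      using s by blast
    moreover from this have "(u, v) \<in> ?J\<^sup>*" using pq by auto
    ultimately show ?thesis using J by (meson rtrancl_trans)
  qed (rule J)
qed

lemma class_eq_iff:
  assumes "sym (r\<^sup>*)"
  shows "r\<^sup>* `` {a} = r\<^sup>* `` {b} \<longleftrightarrow> (a, b) \<in> r\<^sup>*"
  using assms by (auto dest: symD intro: rtrancl_trans)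

lemma components_join:
  assumes r: "sym (r\<^sup>*)" and pq: "p \<in> S" "q \<in> S"
  shows "components (r \<union> {(p, q), (q, p)}) S
    = insert (r\<^sup>* `` {p} \<union> r\<^sup>* `` {q}) (components r S - {r\<^sup>* `` {p}, r\<^sup>* `` {q}})"
proof -
  let ?J = "r \<union> {(p, q), (q, p)}" and ?U = "r\<^sup>* `` {p} \<union> r\<^sup>* `` {q}"
  have U: "?U = r\<^sup>* `` {p, q}" by blast
  have s: "(v, u) \<in> r\<^sup>*" if "(u, v) \<in> r\<^sup>*" for u v using r that by (meson symD)
  have 1: "?J\<^sup>* `` {a} = ?U" if "a \<in> ?U" for a
  proof (rule Set.set_eqI)
    fix b
    have "(a, b) \<in> r\<^sup>* \<Longrightarrow> b \<in> ?U" using that by (auto intro: rtrancl_trans)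
    then show "b \<in> ?J\<^sup>* `` {a} \<longleftrightarrow> b \<in> ?U"
      using that unfolding Image_singleton_iff rtrancl_join_iff[OF r] U by blast
  qed
  have 2: "?J\<^sup>* `` {a} = r\<^sup>* `` {a}" if "a \<notin> ?U" for a
    using that unfolding U set_eq_iff Image_singleton_iff rtrancl_join_iff[OF r] by blast
  have 3: "r\<^sup>* `` {a} \<in> {r\<^sup>* `` {p}, r\<^sup>* `` {q}} \<longleftrightarrow> a \<in> ?U" for a
    by (auto simp: class_eq_iff[OF r] dest: s)
  show ?thesis
  proof (intro Set.set_eqI iffI)
    fix X assume "X \<in> components ?J S"
    then obtain a where a: "a \<in> S" "X = ?J\<^sup>* `` {a}" by (auto simp: components_def)
    show "X \<in> insert ?U (components r S - {r\<^sup>* `` {p}, r\<^sup>* `` {q}})"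
    proof (cases "a \<in> ?U")
      case False
      then have "X = r\<^sup>* `` {a}" using a 2 by blast
      moreover have "r\<^sup>* `` {a} \<in> components r S" using a by (auto simp: components_def)
      ultimately show ?thesis using 3[of a] False by blast
    qed (use a 1 in blast)
  next
    fix X assume "X \<in> insert ?U (components r S - {r\<^sup>* `` {p}, r\<^sup>* `` {q}})"
    then show "X \<in> components ?J S"
    proof
      assume "X = ?U"
      then show ?thesis using 1[of p] pq by (auto simp: components_def)
    next
      assume "X \<in> components r S - {r\<^sup>* `` {p}, r\<^sup>* `` {q}}"
      then obtain a where a: "a \<in> S" "X = r\<^sup>* `` {a}" "a \<notin> ?U" using 3 by (auto simp: components_def)
      then show ?thesis using 2[of a] by (auto simp: components_def)
    qed
  qed
qed

lemma card_components_join: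
  assumes r: "sym (r\<^sup>*)" and pq: "p \<in> S" "q \<in> S" "(p, q) \<notin> r\<^sup>*" and S: "finite S"
  shows "card (components r S) = Suc (card (components (r \<union> {(p, q), (q, p)}) S))"
proof -
  let ?P = "r\<^sup>* `` {p}" and ?Q = "r\<^sup>* `` {q}"
  have fin: "finite (components r S)" using S by (simp add: components_def)
  have PQ: "?P \<in> components r S" "?Q \<in> components r S" "?P \<noteq> ?Q"
    using pq class_eq_iff[OF r] by (auto simp: components_def)
  have "?P \<union> ?Q \<notin> components r S - {?P, ?Q}"
  proof
    assume "?P \<union> ?Q \<in> components r S - {?P, ?Q}"
    then obtain a where a: "?P \<union> ?Q = r\<^sup>* `` {a}" "r\<^sup>* `` {a} \<noteq> ?P" by (auto simp: components_def)
    then have "(a, p) \<in> r\<^sup>*" by blast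
    with a class_eq_iff[OF r] show False by metis
  qed
  then have "card (components (r \<union> {(p, q), (q, p)}) S) = Suc (card (components r S - {?P, ?Q}))"
    unfolding components_join[OF r pq(1,2)] using fin by simp
  also have "card (components r S - {?P, ?Q}) = card (components r S) - 2"
    using PQ fin by (subst card_Diff_subset) auto
  finally show ?thesis
    using card_mono[OF fin, of "{?P, ?Q}"] PQ by (simp add: card_insert_if split: if_splits)
qed

lemma components_cong: "r\<^sup>* = s\<^sup>* \<Longrightarrow> components r S = components s S"
  by (simp add: components_def)

lemma rtrancl_eqI: "r \<subseteq> s\<^sup>* \<Longrightarrow> s \<subseteq> r\<^sup>* \<Longrightarrow> r\<^sup>* = s\<^sup>*"
  by (metis rtrancl_subset_rtrancl subset_antisym)

lemma transpose_join_le: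
  assumes pq: "p \<in> S" "q \<in> S"
  shows "cycle_rel (f \<circ> transpose p q) S \<subseteq> (cycle_rel f S \<union> {(p, q), (q, p)})\<^sup>*"
proof
  let ?J = "cycle_rel f S \<union> {(p, q), (q, p)}"
  fix z assume "z \<in> cycle_rel (f \<circ> transpose p q) S"
  then obtain x where x: "x \<in> S" "z = (x, f (transpose p q x))" by (auto simp: cycle_rel_def)
  have "(x, transpose p q x) \<in> ?J\<^sup>*" by (auto simp: transpose_def)
  moreover have "(transpose p q x, f (transpose p q x)) \<in> ?J"
    using x pq by (auto simp: cycle_rel_def transpose_def)
  ultimately show "z \<in> ?J\<^sup>*" using x(2) by (metis rtrancl_into_rtrancl)
qed

text \<open>With \<open>p\<close> and \<open>q\<close> linked, a step through the transposition can
  be replaced by the link followed by an ordinary step. The joined relation is the common reference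
  against which the cycles of \<open>f\<close> and of \<open>f \<circ> transpose p q\<close> are
  counted.\<close>

lemma transpose_join:
  assumes pq: "p \<in> S" "q \<in> S"
  shows "(cycle_rel (f \<circ> transpose p q) S \<union> {(p, q), (q, p)})\<^sup>*
       = (cycle_rel f S \<union> {(p, q), (q, p)})\<^sup>*"
proof (rule rtrancl_eqI)
  have "cycle_rel f S = cycle_rel ((f \<circ> transpose p q) \<circ> transpose p q) S"
    by (rule cycle_rel_cong) simp
  also have "\<dots> \<subseteq> (cycle_rel (f \<circ> transpose p q) S \<union> {(p, q), (q, p)})\<^sup>*"
    by (rule transpose_join_le[OF pq])
  finally show "cycle_rel f S \<union> {(p, q), (q, p)} \<subseteq> (cycle_rel (f \<circ> transpose p q) S \<union> {(p, q), (q, p)})\<^sup>*"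
    by auto
qed (use transpose_join_le[OF pq] in auto)

text \<open>Exactly one of the two permutations already connects \<open>p\<close> and
  \<open>q\<close>, and the link leaves its classes unchanged. The other one loses a class by the
  link, and both end at the same joined relation.\<close>

lemma card_cycles_transpose:
  assumes S: "self_bij f S" and pq: "p \<in> S" "q \<in> S" "p \<noteq> q"
  defines "g \<equiv> f \<circ> transpose p q"
  shows "if (p, q) \<in> (cycle_rel f S)\<^sup>*
    then card (components (cycle_rel g S) S) = Suc (card (components (cycle_rel f S) S))
    else card (components (cycle_rel f S) S) = Suc (card (components (cycle_rel g S) S))"
proof -
  have fin: "finite S" using S by (simp add: self_bij_def)
  note g = self_bij_transpose[OF S pq(1,2), folded g_def]
  note symf = cycle_rel_sym[OF S] and symg = cycle_rel_sym[OF g]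
  note tog = transpose_toggles_connected[OF S pq, folded g_def]
  note join = transpose_join[OF pq(1,2), of f, folded g_def]
  have absorb: "(cycle_rel h S \<union> {(p, q), (q, p)})\<^sup>* = (cycle_rel h S)\<^sup>*"
    if "(p, q) \<in> (cycle_rel h S)\<^sup>*" "sym ((cycle_rel h S)\<^sup>*)" for h
    by (rule rtrancl_eqI) (use that in \<open>auto dest: symD\<close>)
  show ?thesis
  proof (cases "(p, q) \<in> (cycle_rel f S)\<^sup>*")
    case True
    then have "(p, q) \<notin> (cycle_rel g S)\<^sup>*" using tog by simp
    from card_components_join[OF symg pq(1,2) this fin]
    show ?thesis using components_cong[OF join] components_cong[OF absorb[OF True symf]] True by metis
  next
    case False
    then have "(p, q) \<in> (cycle_rel g S)\<^sup>*" using tog by simp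
    with card_components_join[OF symf pq(1,2) False fin]
    show ?thesis using components_cong[OF join] components_cong[OF absorb[OF _ symg]] False by metis
  qed
qed

lemma sym_rtrancl_Un:
  assumes "sym (r\<^sup>*)" "sym (s\<^sup>*)"
  shows "sym ((r \<union> s)\<^sup>*)"
proof -
  have "(r \<union> s)\<^sup>* = (r\<^sup>* \<union> s\<^sup>*)\<^sup>*" by (simp add: rtrancl_Un_rtrancl)
  then show ?thesis using assms by (metis sym_Un sym_rtrancl)
qed

text \<open>The data are a rotation system for a graph on a closed surface: \<open>\<sigma>\<close>
  turns around vertices, \<open>\<alpha>\<close> exchanges the ends of an edge,
  \<open>\<sigma> \<circ> \<alpha>\<close> runs along faces and \<open>e\<close> names edges. The
  bound says that the genus is nonnegative. Edges are inserted one by one. An edge inside a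
  component adds at most one face; an edge between two components fuses two faces and two
  components, so V + F and E + 2 c both drop by one.\<close>

proposition euler_inequality:
  fixes e :: "'p \<Rightarrow> 'e"
  assumes \<sigma>: "self_bij \<sigma> S"
    and \<alpha>: "\<And>p. p \<in> S \<Longrightarrow> \<alpha> p \<in> S \<and> \<alpha> (\<alpha> p) = p \<and> \<alpha> p \<noteq> p"
    and e: "\<And>p q. p \<in> S \<Longrightarrow> q \<in> S \<Longrightarrow> e p = e q \<longleftrightarrow> q = p \<or> q = \<alpha> p"
  shows "card (components (cycle_rel \<sigma> S) S) + card (components (cycle_rel (\<sigma> \<circ> \<alpha>) S) S)
    \<le> card (e ` S) + 2 * card (components (cycle_rel \<sigma> S \<union> cycle_rel \<alpha> S) S)"
proof -
  have S: "finite S" using \<sigma> by (simp add: self_bij_def)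
  \<comment> \<open>\<open>a B\<close> exchanges ends only along the edges in \<open>B\<close>. With
    \<open>B\<close> empty the faces are the vertices, which are also the components, and equality
    holds.\<close>
  define a where "a = (\<lambda>B p. if e p \<in> B then \<alpha> p else p)"
  define K where "K = (\<lambda>B. cycle_rel \<sigma> S \<union> cycle_rel (a B) S)"
  have a_invol: "a B p \<in> S \<and> a B (a B p) = p" if "p \<in> S" for p B
    using \<alpha>[OF that] e[OF that, of "\<alpha> p"] that by (auto simp: a_def)
  have a_bij: "self_bij (a B) S" for B
    unfolding self_bij_def using S a_invol by (auto intro: inj_on_inverseI[of _ "a B"])
  have phi_bij: "self_bij (\<sigma> \<circ> a B) S" for B
    using a_bij[of B] \<sigma> unfolding self_bij_def
    by (auto intro!: comp_inj_on elim: inj_on_subset)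
  have K_sym: "sym ((K B)\<^sup>*)" for B
    unfolding K_def by (intro sym_rtrancl_Un cycle_rel_sym \<sigma> a_bij)
  have phi_K: "(cycle_rel (\<sigma> \<circ> a B) S)\<^sup>* \<subseteq> (K B)\<^sup>*" for B
  proof -
    have "(p, \<sigma> (a B p)) \<in> (K B)\<^sup>*" if "p \<in> S" for p
    proof -
      have "(p, a B p) \<in> K B" "(a B p, \<sigma> (a B p)) \<in> K B"
        using that a_invol[OF that, of B] by (auto simp: K_def cycle_rel_def)
      then show ?thesis by (meson r_into_rtrancl rtrancl_into_rtrancl)
    qed
    then show ?thesis
      by (intro rtrancl_subset_rtrancl) (auto simp: cycle_rel_def)
  qed
  have "finite B \<Longrightarrow> B \<subseteq> e ` S \<Longrightarrow>
    card (components (cycle_rel \<sigma> S) S) + card (components (cycle_rel (\<sigma> \<circ> a B) S) S)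
    \<le> card B + 2 * card (components (K B) S)" for B
  proof (induction B rule: finite_induct)
    case empty
    have "(K {})\<^sup>* = (cycle_rel \<sigma> S)\<^sup>*"
      by (rule rtrancl_eqI) (auto simp: K_def a_def cycle_rel_def)
    then have "components (K {}) S = components (cycle_rel \<sigma> S) S" by (rule components_cong)
    moreover have "\<sigma> \<circ> a {} = \<sigma>" by (auto simp: a_def)
    ultimately show ?case by simp
  next
    case (insert b B)
    then obtain p where p: "p \<in> S" "e p = b" by auto
    define q where "q = \<alpha> p"
    have q: "q \<in> S" "p \<noteq> q" using \<alpha>[OF p(1)] unfolding q_def by metis+
    have q_e: "e q = b" using e[OF p(1) q(1)] p(2) unfolding q_def by metis
    have b: "e x = b \<longleftrightarrow> x = p \<or> x = q" if "x \<in> S" for x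
      using e[OF p(1) that] p(2) unfolding q_def by metis
    have ap: "\<alpha> p = q" by (simp add: q_def)
    have aq: "\<alpha> q = p" using \<alpha>[OF p(1)] by (simp add: q_def)
    have a': "a (insert b B) x = a B (transpose p q x)" if "x \<in> S" for x
    proof -
      consider "x = p" | "x = q" | "x \<noteq> p" "x \<noteq> q" "e x \<noteq> b" using b[OF \<open>x \<in> S\<close>] by blast
      then show ?thesis
        using insert.hyps(2) p(2) q_e q by cases (auto simp: a_def ap aq)
    qed
    have phi': "cycle_rel (\<sigma> \<circ> a (insert b B)) S = cycle_rel ((\<sigma> \<circ> a B) \<circ> transpose p q) S"
      by (rule cycle_rel_cong) (simp add: a')
    have K': "(K (insert b B))\<^sup>* = (K B \<union> {(p, q), (q, p)})\<^sup>*"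
    proof (rule rtrancl_eqI)
      have "(x, a (insert b B) x) \<in> (K B \<union> {(p, q), (q, p)})\<^sup>*" if "x \<in> S" for x
      proof (cases "e x = b")
        case True
        then have "(x, a (insert b B) x) \<in> {(p, q), (q, p)}"
          using b[OF that] by (auto simp: a_def ap aq)
        then show ?thesis by blast
      next
        case False
        then have "a (insert b B) x = a B x" by (simp add: a_def)
        then have "(x, a (insert b B) x) \<in> K B" using that by (auto simp: K_def cycle_rel_def)
        then show ?thesis by blast
      qed
      then show "K (insert b B) \<subseteq> (K B \<union> {(p, q), (q, p)})\<^sup>*"
        by (auto simp: K_def cycle_rel_def)
      have "(x, a B x) \<in> (K (insert b B))\<^sup>*" if "x \<in> S" for x
      proof (cases "e x = b")
        case False
        then have "a (insert b B) x = a B x" by (simp add: a_def)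
        moreover have "(x, a (insert b B) x) \<in> K (insert b B)"
          using that by (auto simp: K_def cycle_rel_def)
        ultimately show ?thesis by auto
      qed (use insert.hyps(2) in \<open>simp add: a_def\<close>)
      moreover have "(p, q) \<in> K (insert b B)" "(q, p) \<in> K (insert b B)"
        using p q q_e by (auto simp: K_def cycle_rel_def a_def ap aq)
      ultimately show "K B \<union> {(p, q), (q, p)} \<subseteq> (K (insert b B))\<^sup>*"
        by (auto simp: K_def cycle_rel_def)
    qed
    have IH: "card (components (cycle_rel \<sigma> S) S) + card (components (cycle_rel (\<sigma> \<circ> a B) S) S)
      \<le> card B + 2 * card (components (K B) S)" using insert.IH insert.prems by blast
    note cyc = card_cycles_transpose[OF phi_bij[of B] p(1) q, folded phi']
    have cyc_le: "card (components (cycle_rel (\<sigma> \<circ> a (insert b B)) S) S)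
        \<le> Suc (card (components (cycle_rel (\<sigma> \<circ> a B) S) S))"
      using cyc by (metis Suc_n_not_le_n le_SucI nat_le_linear)
    have cB: "card (insert b B) = Suc (card B)" using insert by simp
    show ?case
    proof (cases "(p, q) \<in> (K B)\<^sup>*")
      case True
      then have "(K (insert b B))\<^sup>* = (K B)\<^sup>*"
        unfolding K' using K_sym[of B] by (intro rtrancl_eqI) (auto dest: symD)
      then have "components (K (insert b B)) S = components (K B) S" by (rule components_cong)
      then show ?thesis using IH cyc_le cB by presburger
    next
      case False
      \<comment> \<open>A face stays within one component, so ends in different components lie on
        different faces.\<close>
      then have "(p, q) \<notin> (cycle_rel (\<sigma> \<circ> a B) S)\<^sup>*" using phi_K by blast
      with cyc have "card (components (cycle_rel (\<sigma> \<circ> a B) S) S)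
        = Suc (card (components (cycle_rel (\<sigma> \<circ> a (insert b B)) S) S))"
        by (simp only: if_False)
      moreover have "card (components (K B) S) = Suc (card (components (K (insert b B)) S))"
        using card_components_join[OF K_sym p(1) q(1) False S] components_cong[OF K'] by metis
      ultimately show ?thesis using IH cB by presburger
    qed
  qed
  from this[of "e ` S"] have "card (components (cycle_rel \<sigma> S) S) + card (components (cycle_rel (\<sigma> \<circ> a (e ` S)) S) S)
    \<le> card (e ` S) + 2 * card (components (K (e ` S)) S)" using S by simp
  moreover have "cycle_rel (a (e ` S)) S = cycle_rel \<alpha> S"
    "cycle_rel (\<sigma> \<circ> a (e ` S)) S = cycle_rel (\<sigma> \<circ> \<alpha>) S"
    by (intro cycle_rel_cong, simp add: a_def)+
  ultimately show ?thesis by (simp add: K_def)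
qed

section \<open>A source-sink orientation of a planar diagram\<close>

definition arc_of :: "('x, 'a) diagram \<Rightarrow> 'x \<times> corner \<Rightarrow> 'a" where
  "arc_of D p = arc_at D (fst p) (snd p)"

definition rot_end :: "'x \<times> corner \<Rightarrow> 'x \<times> corner" where
  "rot_end p = (fst p, ccw (snd p))"

text \<open>The parity of the number of quarter turns from \<open>UL\<close>; it is false at the two
  ends of the over-strand.\<close>

definition off_diagonal :: "corner \<Rightarrow> bool" where
  "off_diagonal c \<longleftrightarrow> c = LL \<or> c = UR"

lemma off_diagonal_simps [simp]:
  "\<not> off_diagonal UL" "off_diagonal LL" "\<not> off_diagonal LR" "off_diagonal UR"
  by (auto simp: off_diagonal_def)

lemma off_diagonal_ccw: "off_diagonal (ccw c) \<longleftrightarrow> \<not> off_diagonal c"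
  by (cases c) auto

text \<open>A strand of either resolution joins neighbouring corners. This is why every resolution
  is compatible with an orientation that alternates around the crossing.\<close>

lemma off_diagonal_resolve: "off_diagonal (resolve b c) \<longleftrightarrow> \<not> off_diagonal c"
  by (cases c; cases b) auto

lemma resolve_resolve: "resolve b (resolve b c) = c"
  by (cases c; cases b) auto

lemma UNIV_corner: "(UNIV :: corner set) = {UL, LL, LR, UR}"
  using corner.exhaust by blast

instance corner :: finite
  by standard (simp add: UNIV_corner)

lemma ccw_inject: "ccw c = ccw d \<longleftrightarrow> c = d"
  by (cases c; cases d) auto

text \<open>A function that is constant along the steps of \<open>f\<close> is a function on cycles.
  The number of cycles is thus bounded from below by exhibiting an invariant with many
  values.\<close>

lemma card_image_le_components:
  assumes "finite S" "f ` S \<subseteq> S" "\<And>p. p \<in> S \<Longrightarrow> g (f p) = g p"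
  shows "card (g ` S) \<le> card (components (cycle_rel f S) S)"
proof -
  have inv: "g q = g p" if "(p, q) \<in> (cycle_rel f S)\<^sup>*" for p q
    using that by induction (auto simp: cycle_rel_def assms(3))
  have "g p \<in> (\<lambda>X. g (SOME q. q \<in> X)) ` components (cycle_rel f S) S" if "p \<in> S" for p
  proof -
    let ?X = "(cycle_rel f S)\<^sup>* `` {p}"
    have "p \<in> ?X" by simp
    then have "(SOME q. q \<in> ?X) \<in> ?X" by (rule someI)
    then have "g (SOME q. q \<in> ?X) = g p" using inv by blast
    moreover have "?X \<in> components (cycle_rel f S) S" using that by (simp add: components_def)
    ultimately show ?thesis by (metis image_eqI)
  qed
  then show ?thesis
    using assms(1) by (intro surj_card_le) (auto simp: components_def)
qed

locale planar_diagram =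
  fixes D :: "('x, 'a) diagram"
  assumes link: "link_diagram D"
begin

lemma finite_crossings: "finite (crossings D)"
  and finite_arcs: "finite (arcs D)"
  and arc_of_in_arcs: "p \<in> ends D \<Longrightarrow> arc_of D p \<in> arcs D"
  and arc_at_in_arcs: "x \<in> crossings D \<Longrightarrow> arc_at D x c \<in> arcs D"
  using link by (auto simp: link_diagram_def oriented_diagram_def ends_def arc_of_def)

lemma other_end_props:
  assumes p: "p \<in> ends D"
  shows "other_end D p \<in> ends D" "other_end D p \<noteq> p" "other_end D (other_end D p) = p"
    "arc_of D (other_end D p) = arc_of D p"
    "incoming D (fst (other_end D p)) (snd (other_end D p)) \<longleftrightarrow> \<not> incoming D (fst p) (snd p)"
    "q \<in> ends D \<Longrightarrow> arc_of D p = arc_of D q \<longleftrightarrow> q = p \<or> q = other_end D p"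
proof -
  have mem: "r \<in> ends_of D (arc_of D p) \<longleftrightarrow> r \<in> ends D \<and> arc_of D r = arc_of D p" for r
    by (cases r) (auto simp: ends_of_def arc_of_def)
  have "ends_of D (arc_of D p) \<noteq> {}" using mem[of p] p by blast
  then obtain x c y d where xy: "ends_of D (arc_of D p) = {(x, c), (y, d)}"
      "incoming D x c" "\<not> incoming D y d"
    using link arc_of_in_arcs[OF p] unfolding link_diagram_def oriented_diagram_def by metis
  obtain r where r: "ends_of D (arc_of D p) = {p, r}" "r \<noteq> p"
      "incoming D (fst r) (snd r) \<longleftrightarrow> \<not> incoming D (fst p) (snd p)"
  proof (cases "p = (x, c)")
    case True
    then show ?thesis using that[of "(y, d)"] xy by auto
  next
    case False
    then have "p = (y, d)" using mem[of p] p xy(1) by blast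
    then show ?thesis using that[of "(x, c)"] xy by auto
  qed
  have oth: "other_end D u = v" if "ends_of D (arc_of D u) = {u, v}" "u \<noteq> v" for u v
    unfolding other_end_def using that by (intro the_equality) (auto simp: arc_of_def)
  have pr: "other_end D p = r" using oth r by metis
  have rmem: "r \<in> ends D" "arc_of D r = arc_of D p" using mem[of r] r by auto
  have rp: "other_end D r = p" using oth[of r p] r rmem by (metis insert_commute)
  show "other_end D p \<in> ends D" "other_end D p \<noteq> p" "other_end D (other_end D p) = p"
    "arc_of D (other_end D p) = arc_of D p"
    "incoming D (fst (other_end D p)) (snd (other_end D p)) \<longleftrightarrow> \<not> incoming D (fst p) (snd p)"
    using pr rp rmem r by auto
  show "q \<in> ends D \<Longrightarrow> arc_of D p = arc_of D q \<longleftrightarrow> q = p \<or> q = other_end D p"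
    using mem[of q] unfolding r(1) pr by (metis insert_iff singletonD)
qed

lemma rot_end_ends: "p \<in> ends D \<Longrightarrow> rot_end p \<in> ends D"
  by (simp add: ends_def rot_end_def mem_Times_iff)

text \<open>
  The double cover of the diagram on which both \<open>rot_end\<close> and \<open>other_end\<close> exchange the sheets.
  Every face lifts to two faces, so Euler's inequality for the cover
  forces every component to lift to two components.
\<close>

definition cover :: "(('x \<times> corner) \<times> bool) set" where
  "cover = ends D \<times> UNIV"

definition cover_rotate :: "('x \<times> corner) \<times> bool \<Rightarrow> ('x \<times> corner) \<times> bool" where
  "cover_rotate u = (rot_end (fst u), \<not> snd u)"

definition cover_other :: "('x \<times> corner) \<times> bool \<Rightarrow> ('x \<times> corner) \<times> bool" where
  "cover_other u = (other_end D (fst u), \<not> snd u)"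

definition cover_rel :: "((('x \<times> corner) \<times> bool) \<times> (('x \<times> corner) \<times> bool)) set" where
  "cover_rel = cycle_rel cover_rotate cover \<union> cycle_rel cover_other cover"

lemma finite_cover: "finite cover"
  using finite_crossings by (simp add: cover_def ends_def)

lemma self_bij_cover_rotate: "self_bij cover_rotate cover"
proof -
  have "inj_on cover_rotate cover"
    by (rule inj_onI) (simp add: cover_rotate_def rot_end_def prod_eq_iff ccw_inject)
  moreover have "cover_rotate u \<in> cover" if "u \<in> cover" for u
    using that rot_end_ends by (simp add: cover_def cover_rotate_def mem_Times_iff)
  ultimately show ?thesis using finite_cover by (auto simp only: self_bij_def)
qed

lemma cover_other_props:
  assumes "u \<in> cover"
  shows "cover_other u \<in> cover \<and> cover_other (cover_other u) = u \<and> cover_other u \<noteq> u"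
  using assms other_end_props(1-3)[of "fst u"] by (auto simp: cover_def cover_other_def)

lemma self_bij_cover_other: "self_bij cover_other cover"
proof -
  have "inj_on cover_other cover"
    using cover_other_props by (intro inj_on_inverseI[of _ cover_other]) blast
  then show ?thesis using finite_cover cover_other_props by (auto simp only: self_bij_def)
qed

lemma sym_cover_rel: "sym (cover_rel\<^sup>*)"
  unfolding cover_rel_def
  by (intro sym_rtrancl_Un cycle_rel_sym self_bij_cover_rotate self_bij_cover_other)

lemma cover_relI:
  "p \<in> ends D \<Longrightarrow> ((p, b), (rot_end p, \<not> b)) \<in> cover_rel"
  "p \<in> ends D \<Longrightarrow> ((p, b), (other_end D p, \<not> b)) \<in> cover_rel"
proof -
  assume p: "p \<in> ends D"
  have "(u, cover_rotate u) \<in> cover_rel" "(u, cover_other u) \<in> cover_rel" if "u \<in> cover" for u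
    using that unfolding cover_rel_def cycle_rel_def by blast+
  from this[of "(p, b)"] p show "((p, b), (rot_end p, \<not> b)) \<in> cover_rel"
    "((p, b), (other_end D p, \<not> b)) \<in> cover_rel"
    by (simp_all add: cover_rotate_def cover_other_def cover_def)
qed

lemma cover_rel_flip:
  assumes "((p, b), (q, b')) \<in> cover_rel\<^sup>*"
  shows "((p, \<not> b), (q, \<not> b')) \<in> cover_rel\<^sup>*"
  using assms
proof (induction "(q, b')" arbitrary: q b' rule: rtrancl_induct)
  case (step v)
  obtain r b'' where v: "v = (r, b'')" by (cases v)
  have "((r, \<not> b''), (q, \<not> b')) \<in> cover_rel"
    using step.hyps(2) unfolding v
    by (auto simp: cover_rel_def cycle_rel_def cover_def cover_rotate_def cover_other_def)
  with step.hyps(3)[OF v] show ?case by (rule rtrancl_into_rtrancl)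
qed auto

lemma cover_rel_corner:
  assumes "x \<in> crossings D"
  shows "(((x, UL), b), ((x, c), b \<noteq> off_diagonal c)) \<in> cover_rel\<^sup>*"
proof -
  have step: "(((x, c), b'), ((x, ccw c), \<not> b')) \<in> cover_rel" for c b'
    using cover_relI(1)[of "(x, c)" b'] assms by (simp add: ends_def rot_end_def)
  have 1: "(((x, UL), b), ((x, LL), \<not> b)) \<in> cover_rel\<^sup>*" using step[of UL b] by auto
  have 2: "(((x, UL), b), ((x, LR), b)) \<in> cover_rel\<^sup>*"
    using rtrancl_into_rtrancl[OF 1 step] by simp
  have 3: "(((x, UL), b), ((x, UR), \<not> b)) \<in> cover_rel\<^sup>*"
    using rtrancl_into_rtrancl[OF 2 step] by simp
  show ?thesis using 1 2 3 by (cases c) auto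
qed

lemma face_step_eq: "face_step D p = rot_end (other_end D p)"
  by (simp add: face_step_def rot_end_def split: prod.split)

lemma self_bij_face_step: "self_bij (face_step D) (ends D)"
proof -
  have "inj_on (face_step D) (ends D)"
  proof (rule inj_onI)
    fix p q assume pq: "p \<in> ends D" "q \<in> ends D" "face_step D p = face_step D q"
    then have "other_end D p = other_end D q"
      by (auto simp: face_step_eq rot_end_def ccw_inject prod_eq_iff)
    then show "p = q" using pq other_end_props(3) by metis
  qed
  moreover have "face_step D p \<in> ends D" if "p \<in> ends D" for p
    unfolding face_step_eq using that other_end_props(1) rot_end_ends by blast
  moreover have "finite (ends D)" using finite_crossings by (simp add: ends_def)
  ultimately show ?thesis by (auto simp only: self_bij_def)
qed

lemma orbit_face_step:
  assumes "p \<in> ends D"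
  shows "orbit (face_step D) (face_step D p) = orbit (face_step D) p"
proof -
  obtain n where "n > 0" "(face_step D ^^ n) p = p"
    using self_bij_returns[OF self_bij_face_step assms] by blast
  then have "p \<in> orbit (face_step D) p" by (metis (mono_tags, lifting) mem_Collect_eq orbit_altdef)
  then show ?thesis by (rule self_in_orbit_step)
qed

lemma cover_components_ge: "2 * card (graph_components D) \<le> card (components cover_rel cover)"
proof -
  \<comment> \<open>Names of the edges of the cover. Passing along an arc flips both the sheet and
    the flag \<open>incoming\<close>, so whether they agree is preserved and distinguishes the two
    lifts of the arc.\<close>
  define e where "e = (\<lambda>(p, b). (arc_of D p, b = incoming D (fst p) (snd p)))"
  let ?E = "{a \<in> arcs D. ends_of D a \<noteq> {}}"
  have e: "e u = e v \<longleftrightarrow> v = u \<or> v = cover_other u" if "u \<in> cover" "v \<in> cover" for u v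
    using that other_end_props(5)[of "fst u"] other_end_props(6)[of "fst u" "fst v"]
    by (auto simp: cover_def e_def cover_other_def split_beta prod_eq_iff)
  have "card (components (cycle_rel cover_rotate cover) cover)
      + card (components (cycle_rel (cover_rotate \<circ> cover_other) cover) cover)
    \<le> card (e ` cover) + 2 * card (components cover_rel cover)"
    unfolding cover_rel_def
    by (rule euler_inequality[OF self_bij_cover_rotate cover_other_props e])
  moreover have "2 * card (crossings D) \<le> card (components (cycle_rel cover_rotate cover) cover)"
  proof -
    \<comment> \<open>A quarter turn flips both the sheet and \<open>off_diagonal\<close>; comparing
      them separates the two lifts of a crossing.\<close>
    define g where "g = (\<lambda>(p :: 'x \<times> corner, b). (fst p, b = off_diagonal (snd p)))"
    have "crossings D \<times> UNIV \<subseteq> g ` cover"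
    proof clarify
      fix x and b :: bool assume "x \<in> crossings D"
      then have "((x, UL), \<not> b) \<in> cover" by (simp add: cover_def ends_def)
      moreover have "g ((x, UL), \<not> b) = (x, b)" by (simp add: g_def)
      ultimately show "(x, b) \<in> g ` cover" by (metis image_eqI)
    qed
    then have "card (crossings D \<times> (UNIV :: bool set)) \<le> card (g ` cover)"
      using finite_cover by (intro card_mono) auto
    also have "\<dots> \<le> card (components (cycle_rel cover_rotate cover) cover)"
      using self_bij_cover_rotate
      by (intro card_image_le_components)
        (auto simp: self_bij_def g_def cover_rotate_def rot_end_def off_diagonal_ccw split_beta)
    finally show ?thesis by (simp add: card_cartesian_product)
  qed
  moreover have "2 * card (faces D)
    \<le> card (components (cycle_rel (cover_rotate \<circ> cover_other) cover) cover)"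
  proof -
    \<comment> \<open>One step along a face passes an arc and makes a turn. The two flips cancel, so
      a lifted face keeps its sheet.\<close>
    define g where "g = (\<lambda>(p, b :: bool). (orbit (face_step D) p, b))"
    have "faces D \<times> UNIV = g ` cover"
      by (auto simp: g_def faces_def cover_def image_def)
    then have "card (faces D \<times> (UNIV :: bool set)) = card (g ` cover)" by simp
    also have "\<dots> \<le> card (components (cycle_rel (cover_rotate \<circ> cover_other) cover) cover)"
    proof (rule card_image_le_components)
      show "finite cover" by (rule finite_cover)
      show "(cover_rotate \<circ> cover_other) ` cover \<subseteq> cover"
        using self_bij_cover_rotate self_bij_cover_other by (auto simp: self_bij_def)
    qed (auto simp: g_def cover_rotate_def cover_other_def cover_def orbit_face_step
          simp flip: face_step_eq)
    finally show ?thesis by (simp add: card_cartesian_product)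
  qed
  moreover have "card (e ` cover) \<le> 2 * card ?E"
  proof -
    have "e ` cover \<subseteq> ?E \<times> UNIV"
      using arc_of_in_arcs by (fastforce simp: e_def cover_def ends_of_def arc_of_def)
    then have "card (e ` cover) \<le> card (?E \<times> (UNIV :: bool set))"
      using finite_arcs by (intro card_mono) auto
    then show ?thesis by (simp add: card_cartesian_product)
  qed
  moreover have "int (card (crossings D)) - int (card ?E) + int (card (faces D))
     = 2 * int (card (graph_components D))"
    using link by (simp add: link_diagram_def planar_def)
  ultimately show ?thesis by linarith
qed

lemma sym_adjacent: "sym (adjacent D)"
proof (rule symI)
  fix x y assume "(x, y) \<in> adjacent D"
  then obtain c d where "x \<in> crossings D" "y \<in> crossings D" "arc_at D x c = arc_at D y d"
    unfolding adjacent_def by blast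
  then have "x \<in> crossings D" "y \<in> crossings D" "arc_at D y d = arc_at D x c" by simp_all
  then show "(y, x) \<in> adjacent D" unfolding adjacent_def by blast
qed

text \<open>Path lifting. The sheet on which the lift ends depends on the path, hence the
  existential.\<close>

lemma cover_rel_lift:
  assumes "(x, y) \<in> (adjacent D)\<^sup>*" "x \<in> crossings D"
  shows "\<exists>b'. (((x, UL), b), ((y, UL), b')) \<in> cover_rel\<^sup>*"
  using assms
proof (induction rule: rtrancl_induct)
  case (step y z)
  then obtain b' where b': "(((x, UL), b), ((y, UL), b')) \<in> cover_rel\<^sup>*" by blast
  obtain c d where yz: "y \<in> crossings D" "z \<in> crossings D" "arc_at D y c = arc_at D z d"
    using step.hyps(2) by (auto simp: adjacent_def)
  have s: "(v, u) \<in> cover_rel\<^sup>*" if "(u, v) \<in> cover_rel\<^sup>*" for u v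
    using sym_cover_rel that by (meson symD)
  have yz': "(y, c) \<in> ends D" "(z, d) \<in> ends D" using yz by (auto simp: ends_def)
  have "(z, d) = (y, c) \<or> (z, d) = other_end D (y, c)"
    using other_end_props(6)[OF yz'] yz(3) by (simp add: arc_of_def)
  then obtain b2 where "(((y, c), b' \<noteq> off_diagonal c), ((z, d), b2)) \<in> cover_rel\<^sup>*"
    using cover_relI(2)[OF yz'(1)] by (metis r_into_rtrancl rtrancl.rtrancl_refl)
  moreover obtain b3 where "(((z, d), b2), ((z, UL), b3)) \<in> cover_rel\<^sup>*"
    using s[OF cover_rel_corner[OF yz(2), of "b2 \<noteq> off_diagonal d" d]]
    by (cases "off_diagonal d"; cases b2) auto
  ultimately show ?case
    using b' cover_rel_corner[OF yz(1), of b' c] by (meson rtrancl_trans)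
qed auto

text \<open>A base point for each component. It is selected from the class of \<open>x\<close>, so
  that all crossings of a component share it.\<close>

definition rep :: "'x \<Rightarrow> 'x" where
  "rep x = (SOME y. y \<in> (adjacent D)\<^sup>* `` {x})"

lemma adjacent_in_crossings: "(x, y) \<in> adjacent D \<Longrightarrow> y \<in> crossings D"
  by (simp add: adjacent_def)

lemma adjacent_rtrancl_crossings:
  "(x, y) \<in> (adjacent D)\<^sup>* \<Longrightarrow> x \<in> crossings D \<Longrightarrow> y \<in> crossings D"
  by (induction rule: rtrancl_induct) (auto dest: adjacent_in_crossings)

lemma rep:
  assumes "x \<in> crossings D"
  shows "rep x \<in> crossings D" "(rep x, x) \<in> (adjacent D)\<^sup>*"
proof -
  have *: "(x, rep x) \<in> (adjacent D)\<^sup>*"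
    using someI[of "\<lambda>y. y \<in> (adjacent D)\<^sup>* `` {x}" x] by (simp add: rep_def)
  then show "rep x \<in> crossings D" using assms by (rule adjacent_rtrancl_crossings)
  show "(rep x, x) \<in> (adjacent D)\<^sup>*" by (rule symD[OF sym_rtrancl[OF sym_adjacent] *])
qed

lemma rep_cong: "(x, y) \<in> adjacent D \<Longrightarrow> rep x = rep y"
  unfolding rep_def using class_eq_iff[OF sym_rtrancl[OF sym_adjacent], of x y] by (metis r_into_rtrancl)

lemma cover_rel_rep:
  assumes "p \<in> ends D"
  shows "\<exists>b'. (((rep (fst p), UL), b), (p, b')) \<in> cover_rel\<^sup>*"
proof -
  obtain x c where p: "p = (x, c)" "x \<in> crossings D" using assms by (auto simp: ends_def)
  obtain b' where "(((rep x, UL), b), ((x, UL), b')) \<in> cover_rel\<^sup>*"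
    using cover_rel_lift rep[OF p(2)] by blast
  then show ?thesis using cover_rel_corner[OF p(2), of b' c] p by (auto intro: rtrancl_trans)
qed

text \<open>If the two lifts of one end were connected, its component would have a single lift while
  every other has at most two. That is fewer components than \<open>cover_components_ge\<close>
  allows.\<close>

lemma cover_disconnected:
  assumes p: "p \<in> ends D"
  shows "((p, b), (p, \<not> b)) \<notin> cover_rel\<^sup>*"
proof
  assume con: "((p, b), (p, \<not> b)) \<in> cover_rel\<^sup>*"
  have s: "(v, u) \<in> cover_rel\<^sup>*" if "(u, v) \<in> cover_rel\<^sup>*" for u v
    using sym_cover_rel that by (meson symD)
  define R where "R = (\<lambda>x. (adjacent D)\<^sup>* `` {x})"
  \<comment> \<open>\<open>T\<close> sends a component and a sheet to the lift through the base
    point on that sheet. It reaches every component of the cover, and under the assumption it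
    repeats a value.\<close>
  define T where "T = (\<lambda>(C, b). cover_rel\<^sup>* `` {(((SOME y. y \<in> C), UL), b)})"
  have T: "T (R x, b) = cover_rel\<^sup>* `` {((rep x, UL), b)}" for x b
    by (simp add: T_def R_def rep_def)
  let ?x = "fst p"
  have xc: "?x \<in> crossings D" using p by (auto simp: ends_def)
  obtain b1 where "(((rep ?x, UL), True), (p, b1)) \<in> cover_rel\<^sup>*" using cover_rel_rep[OF p] by blast
  moreover from cover_rel_flip[OF this] have "(((rep ?x, UL), False), (p, \<not> b1)) \<in> cover_rel\<^sup>*" by simp
  moreover have "((p, b1), (p, \<not> b1)) \<in> cover_rel\<^sup>*"
    using con cover_rel_flip[OF con] by (cases "b1 = b") auto
  ultimately have "(((rep ?x, UL), True), ((rep ?x, UL), False)) \<in> cover_rel\<^sup>*"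
    by (meson rtrancl_trans s)
  then have T_eq: "T (R ?x, True) = T (R ?x, False)"
    unfolding T using class_eq_iff[OF sym_cover_rel] by blast
  let ?G = "graph_components D \<times> (UNIV :: bool set)"
  have finG: "finite ?G" using finite_crossings by (simp add: graph_components_def)
  have memG: "(R ?x, True) \<in> ?G" "(R ?x, False) \<in> ?G"
    using xc by (auto simp: graph_components_def R_def)
  have "components cover_rel cover \<subseteq> T ` ?G"
  proof
    fix X assume "X \<in> components cover_rel cover"
    then obtain q b2 where q: "q \<in> ends D" "X = cover_rel\<^sup>* `` {(q, b2)}"
      by (auto simp: components_def cover_def)
    obtain b3 where "(((rep (fst q), UL), False), (q, b3)) \<in> cover_rel\<^sup>*"
      using cover_rel_rep[OF q(1)] by blast
    with cover_rel_flip[OF this] have "(((rep (fst q), UL), b3 \<noteq> b2), (q, b2)) \<in> cover_rel\<^sup>*"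
      by (cases b2; cases b3) auto
    then obtain b4 where "(((rep (fst q), UL), b4), (q, b2)) \<in> cover_rel\<^sup>*" by blast
    then have "X = T (R (fst q), b4)"
      unfolding T q using class_eq_iff[OF sym_cover_rel] by blast
    moreover have "(R (fst q), b4) \<in> ?G"
      using q(1) by (auto simp: graph_components_def R_def ends_def)
    ultimately show "X \<in> T ` ?G" by blast
  qed
  also have "T ` ?G = T ` (?G - {(R ?x, True)})"
  proof (intro subset_antisym subsetI)
    fix X assume "X \<in> T ` ?G"
    then obtain u where u: "u \<in> ?G" "X = T u" by blast
    show "X \<in> T ` (?G - {(R ?x, True)})"
    proof (cases "u = (R ?x, True)")
      case True
      then have "X = T (R ?x, False)" using u T_eq by simp
      then show ?thesis using memG by (intro image_eqI[of _ _ "(R ?x, False)"]) auto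
    qed (use u in blast)
  qed auto
  finally have "card (components cover_rel cover) \<le> card (?G - {(R ?x, True)})"
    using finG by (meson card_image_le card_mono finite_Diff finite_imageI order_trans)
  also have "\<dots> < card ?G" using memG finG by (meson card_Diff1_less)
  also have "\<dots> = 2 * card (graph_components D)" by (simp add: card_cartesian_product)
  finally show False using cover_components_ge by simp
qed

text \<open>In every component keep the lift through the base point on the sheet
  \<open>False\<close>. It contains exactly one of the two lifts of each end, and \<open>out\<close>
  records on which sheet that one lies; each turn and each passage along an arc changes the
  sheet.\<close>

lemma source_sink_orientation:
  obtains out where "\<And>p. p \<in> ends D \<Longrightarrow> out (rot_end p) \<longleftrightarrow> \<not> out p"
    "\<And>p. p \<in> ends D \<Longrightarrow> out (other_end D p) \<longleftrightarrow> \<not> out p"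
proof
  define L where "L = (\<lambda>p b. (((rep (fst p), UL), False), (p, b)) \<in> cover_rel\<^sup>*)"
  define out where "out = (\<lambda>p. L p True)"
  have s: "(v, u) \<in> cover_rel\<^sup>*" if "(u, v) \<in> cover_rel\<^sup>*" for u v
    using sym_cover_rel that by (meson symD)
  have ex1: "L p False \<longleftrightarrow> \<not> L p True" if p: "p \<in> ends D" for p
  proof -
    obtain b where "L p b" using cover_rel_rep[OF p, of False] unfolding L_def by blast
    then have "L p False \<or> L p True" by (cases b) auto
    moreover have False if "L p False" "L p True"
    proof -
      from that have "((p, False), (p, True)) \<in> cover_rel\<^sup>*"
        unfolding L_def by (blast intro: rtrancl_trans s)
      then show False using cover_disconnected[OF p, of False] by simp
    qed
    ultimately show ?thesis by blast
  qed
  have step: "out q \<longleftrightarrow> \<not> out p"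
    if "p \<in> ends D" "((p, False), (q, True)) \<in> cover_rel" "rep (fst q) = rep (fst p)" for p q
  proof -
    have "L q True \<longleftrightarrow> L p False"
      using that(2,3) s[OF r_into_rtrancl[OF that(2)]] unfolding L_def
      by (auto intro: rtrancl_into_rtrancl rtrancl_trans)
    then show ?thesis using ex1[OF that(1)] by (simp add: out_def)
  qed
  fix p assume p: "p \<in> ends D"
  show "out (rot_end p) \<longleftrightarrow> \<not> out p"
    using step[OF p, of "rot_end p"] cover_relI(1)[OF p, of False] by (simp add: rot_end_def)
  have "(fst p, fst (other_end D p)) \<in> adjacent D"
    using p other_end_props(1)[OF p] other_end_props(4)[OF p]
    by (auto simp: adjacent_def ends_def arc_of_def) metis
  from rep_cong[OF this] show "out (other_end D p) \<longleftrightarrow> \<not> out p"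
    using step[OF p, of "other_end D p"] cover_relI(2)[OF p, of False] by simp
qed

section \<open>Resolved circles as cycles of permutations of arcs\<close>

lemma sym_joined: "sym (joined D I)"
proof (rule symI)
  fix a b assume "(a, b) \<in> joined D I"
  then obtain x c where "x \<in> crossings D" "a = arc_at D x c" "b = arc_at D x (resolve (x \<in> I) c)"
    by (auto simp: joined_def)
  then have "x \<in> crossings D \<and> b = arc_at D x (resolve (x \<in> I) c) \<and>
      a = arc_at D x (resolve (x \<in> I) (resolve (x \<in> I) c))"
    by (simp add: resolve_resolve)
  then show "(b, a) \<in> joined D I" unfolding joined_def by blast
qed

lemma sym_joined_rtrancl: "sym ((joined D I)\<^sup>*)"
  by (rule sym_rtrancl[OF sym_joined])

lemma circle_of_eq_iff: "circle_of D I a = circle_of D I b \<longleftrightarrow> (a, b) \<in> (joined D I)\<^sup>*"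
  unfolding circle_of_def by (rule class_eq_iff[OF sym_joined_rtrancl])

text \<open>Following the alternating orientation, each resolution moves the arcs by a permutation
  whose cycles are its circles. A surgery at \<open>x\<close> exchanges the images of two arcs, that
  is, composes with a transposition, so it must connect or disconnect them.\<close>

proposition surgery_toggles:
  assumes x: "x \<in> crossings D" "x \<notin> I"
  shows "circle_of D (insert x I) (arc_at D x UL) = circle_of D (insert x I) (arc_at D x UR)
    \<longleftrightarrow> circle_of D I (arc_at D x UL) \<noteq> circle_of D I (arc_at D x LL)"
proof -
  obtain out where out: "\<And>p. p \<in> ends D \<Longrightarrow> out (rot_end p) \<longleftrightarrow> \<not> out p"
    "\<And>p. p \<in> ends D \<Longrightarrow> out (other_end D p) \<longleftrightarrow> \<not> out p"
    using source_sink_orientation by blast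
  have out_corner: "out (y, c) \<longleftrightarrow> (out (y, UL) \<noteq> off_diagonal c)" if "y \<in> crossings D" for y c
  proof -
    have "out (y, ccw d) \<longleftrightarrow> \<not> out (y, d)" for d
      using out(1)[of "(y, d)"] that by (simp add: ends_def rot_end_def)
    from this[of UL] this[of LL] this[of LR] show ?thesis by (cases c) auto
  qed
  \<comment> \<open>An arc is left at its end \<open>hd a\<close>, and \<open>\<pi> J\<close>
    crosses the strand of the resolution \<open>J\<close> found there. An arc without ends is a
    circle of its own, which the fixed point expresses.\<close>
  define hd where "hd = (\<lambda>a. THE p. p \<in> ends D \<and> out p \<and> arc_of D p = a)"
  define res where "res = (\<lambda>J p :: 'x \<times> corner. (fst p, resolve (fst p \<in> J) (snd p)))"
  define \<pi> where "\<pi> = (\<lambda>J a. if ends_of D a = {} then a else arc_of D (res J (hd a)))"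
  have hd_arc: "hd (arc_of D p) = p" if "p \<in> ends D" "out p" for p
    unfolding hd_def
    by (rule the_equality) (use that other_end_props(6)[of p] out(2)[of p] in metis)+
  have ends_arc: "ends_of D (arc_of D p) \<noteq> {}" if "p \<in> ends D" for p
    using that by (cases p) (auto simp: ends_of_def arc_of_def)
  have hd: "hd a \<in> ends D \<and> out (hd a) \<and> arc_of D (hd a) = a" if "ends_of D a \<noteq> {}" for a
  proof -
    from that obtain p where p: "p \<in> ends D" "arc_of D p = a"
      by (auto simp: ends_of_def arc_of_def)
    show ?thesis
    proof (cases "out p")
      case True
      then show ?thesis using hd_arc[OF p(1)] p by simp
    next
      case False
      then have "out (other_end D p)" using out(2) p by simp
      then show ?thesis using hd_arc[of "other_end D p"] p other_end_props(1,4)[of p] by simp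
    qed
  qed
  have res_ends: "res J p \<in> ends D" if "p \<in> ends D" for J p
    using that by (auto simp: res_def ends_def)
  have out_res: "out (res J p) \<longleftrightarrow> \<not> out p" if "p \<in> ends D" for J p
  proof -
    obtain y c where p: "p = (y, c)" "y \<in> crossings D"
      using \<open>p \<in> ends D\<close> by (cases p) (auto simp: ends_def)
    show ?thesis
      using out_corner[OF p(2), of c] out_corner[OF p(2), of "resolve (y \<in> J) c"]
      by (simp add: p res_def off_diagonal_resolve)
  qed
  have res_res: "res J (res J p) = p" for J p
    by (simp add: res_def resolve_resolve)
  have pi_arc: "\<pi> J (arc_of D p) = arc_of D (res J p)" if "p \<in> ends D" "out p" for J p
    using hd_arc[OF that] ends_arc[OF that(1)] by (simp add: \<pi>_def)
  have pi_in: "\<pi> J a \<in> arcs D" if "a \<in> arcs D" for J a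
    using that hd[of a] res_ends arc_of_in_arcs by (auto simp: \<pi>_def)
  have pi_bij: "self_bij (\<pi> J) (arcs D)" for J
  proof -
    have "inj_on (\<pi> J) (arcs D)"
    proof (rule inj_onI)
      fix a b assume ab: "a \<in> arcs D" "b \<in> arcs D" "\<pi> J a = \<pi> J b"
      have ne: "ends_of D (\<pi> J a) = {} \<longleftrightarrow> ends_of D a = {}" for a
        using hd[of a] res_ends ends_arc by (auto simp: \<pi>_def)
      show "a = b"
      proof (cases "ends_of D a = {}")
        case True
        then have "ends_of D b = {}" using ne ab(3) by metis
        with True ab(3) show ?thesis by (simp add: \<pi>_def)
      next
        case False
        then have False': "ends_of D b \<noteq> {}" using ne ab(3) by metis
        let ?p = "res J (hd a)" and ?q = "res J (hd b)"
        have p: "?p \<in> ends D" "\<not> out ?p" and q: "?q \<in> ends D" "\<not> out ?q"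
          using hd[OF False] hd[OF False'] res_ends out_res by auto
        have "arc_of D ?p = arc_of D ?q" using ab(3) False False' by (simp add: \<pi>_def)
        then have "?q = ?p" using other_end_props(6)[OF p(1) q(1)] out(2)[OF p(1)] p q by auto
        then have "hd a = hd b" using res_res by metis
        then show ?thesis using hd[OF False] hd[OF False'] by metis
      qed
    qed
    then show ?thesis using finite_arcs pi_in by (auto simp: self_bij_def)
  qed
  have pi_sym: "(b, a) \<in> (cycle_rel (\<pi> J) (arcs D))\<^sup>*" if "(a, b) \<in> (cycle_rel (\<pi> J) (arcs D))\<^sup>*" for J a b
    using cycle_rel_sym[OF pi_bij] that by (meson symD)
  have joined: "(joined D J)\<^sup>* \<inter> arcs D \<times> arcs D = (cycle_rel (\<pi> J) (arcs D))\<^sup>* \<inter> arcs D \<times> arcs D" for J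
  proof -
    have "(joined D J)\<^sup>* = (cycle_rel (\<pi> J) (arcs D))\<^sup>*"
    proof (rule rtrancl_eqI)
      show "joined D J \<subseteq> (cycle_rel (\<pi> J) (arcs D))\<^sup>*"
      proof
        fix z assume "z \<in> joined D J"
        then obtain y c where y: "y \<in> crossings D"
            "z = (arc_of D (y, c), arc_of D (res J (y, c)))"
          by (auto simp: joined_def res_def arc_of_def)
        have yc: "(y, c) \<in> ends D" using y by (simp add: ends_def)
        have rel: "(arc_of D p, arc_of D (res J p)) \<in> (cycle_rel (\<pi> J) (arcs D))\<^sup>*"
          if "p \<in> ends D" "out p" for p
          unfolding pi_arc[OF that, symmetric]
          using arc_of_in_arcs[OF that(1)] by (auto simp: cycle_rel_def)
        show "z \<in> (cycle_rel (\<pi> J) (arcs D))\<^sup>*"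
        proof (cases "out (y, c)")
          case True
          then show ?thesis using rel[OF yc] y by simp
        next
          case False
          then show ?thesis
            using rel[OF res_ends[OF yc]] out_res[OF yc] res_res y(2) pi_sym by metis
        qed
      qed
      show "cycle_rel (\<pi> J) (arcs D) \<subseteq> (joined D J)\<^sup>*"
      proof
        fix z assume "z \<in> cycle_rel (\<pi> J) (arcs D)"
        then obtain a where a: "z = (a, \<pi> J a)" by (auto simp: cycle_rel_def)
        show "z \<in> (joined D J)\<^sup>*"
        proof (cases "ends_of D a = {}")
          case True
          then show ?thesis by (simp add: a \<pi>_def)
        next
          case False
          obtain y c where yc: "hd a = (y, c)" by (cases "hd a")
          have "z = (a, arc_of D (res J (y, c)))" using a False by (simp add: \<pi>_def yc)
          moreover have "y \<in> crossings D" "a = arc_at D y c"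
            using hd[OF False] yc by (auto simp: ends_def arc_of_def)
          ultimately have "z = (arc_at D y c, arc_at D y (resolve (y \<in> J) c)) \<and> y \<in> crossings D"
            by (simp add: res_def arc_of_def)
          then have "z \<in> joined D J" unfolding joined_def by blast
          then show ?thesis by blast
        qed
      qed
    qed
    then show ?thesis by simp
  qed
  \<comment> \<open>\<open>p\<close> and \<open>q\<close> are the two arcs left at \<open>x\<close>.
    They are left at opposite corners, and the two resolutions lead from these to the remaining two
    corners in opposite ways.\<close>
  define p where "p = arc_at D x (if out (x, UL) then UL else LL)"
  define q where "q = arc_at D x (if out (x, UL) then LR else UR)"
  have xc: "(x, c) \<in> ends D" for c using x by (simp add: ends_def)
  have oc: "out (x, LL) \<longleftrightarrow> \<not> out (x, UL)" "out (x, LR) \<longleftrightarrow> out (x, UL)"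
      "out (x, UR) \<longleftrightarrow> \<not> out (x, UL)"
    using out_corner[OF x(1)] off_diagonal_simps by blast+
  have hdp: "hd p = (x, if out (x, UL) then UL else LL)" and hdq: "hd q = (x, if out (x, UL) then LR else UR)"
    using hd_arc[OF xc, of UL] hd_arc[OF xc, of LL] hd_arc[OF xc, of LR] hd_arc[OF xc, of UR] oc
    by (simp_all add: p_def q_def arc_of_def)
  have pq: "p \<in> arcs D" "q \<in> arcs D" "p \<noteq> q"
    using arc_at_in_arcs x hdp hdq by (auto simp: p_def q_def split: if_splits)
  have toggle: "\<pi> (insert x I) a = (\<pi> I \<circ> transpose p q) a" if "a \<in> arcs D" for a
  proof -
    have pi_x: "\<pi> J (arc_at D x c) = arc_at D x (resolve (x \<in> J) c)" if "out (x, c)" for J c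
      using pi_arc[OF xc that] by (simp add: arc_of_def res_def)
    consider "a = p" | "a = q" | "a \<noteq> p" "a \<noteq> q" by blast
    then show ?thesis
    proof cases
      case 1
      then show ?thesis
        using x oc by (cases "out (x, UL)") (simp_all add: p_def q_def pi_x)
    next
      case 2
      then show ?thesis
        using x oc by (cases "out (x, UL)") (simp_all add: p_def q_def pi_x)
    next
      case 3
      have "\<pi> (insert x I) a = \<pi> I a"
      proof (cases "ends_of D a = {}")
        case False
        have "fst (hd a) \<noteq> x"
        proof
          assume "fst (hd a) = x"
          then obtain c where c: "hd a = (x, c)" by (cases "hd a") auto
          then have "a = arc_at D x c" "out (x, c)" using hd[OF False] by (auto simp: arc_of_def)
          then show False using 3 oc by (cases c; cases "out (x, UL)") (simp_all add: p_def q_def)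
        qed
        then show ?thesis using False by (simp add: \<pi>_def res_def)
      qed (simp add: \<pi>_def)
      then show ?thesis using 3 by simp
    qed
  qed
  have cyc: "cycle_rel (\<pi> (insert x I)) (arcs D) = cycle_rel (\<pi> I \<circ> transpose p q) (arcs D)"
    using toggle by (rule cycle_rel_cong)
  have "(p, q) \<in> (joined D (insert x I))\<^sup>* \<longleftrightarrow> (p, q) \<notin> (joined D I)\<^sup>*"
    using transpose_toggles_connected[OF pi_bij pq, of I] joined[of I] joined[of "insert x I"] pq(1,2)
    unfolding cyc by blast
  then have main: "circle_of D (insert x I) p = circle_of D (insert x I) q \<longleftrightarrow> circle_of D I p \<noteq> circle_of D I q"
    by (simp add: circle_of_eq_iff)
  \<comment> \<open>Strands of the two resolutions carry the statement about \<open>p\<close> and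
    \<open>q\<close> to the corners that appear in the goal.\<close>
  have j: "circle_of D J (arc_at D x c) = circle_of D J (arc_at D x (resolve (x \<in> J) c))" for J c
    unfolding circle_of_eq_iff using x by (auto simp: joined_def)
  show ?thesis
    using main j[of I UL] j[of I LL] j[of "insert x I" UL] j[of "insert x I" LR] x
    by (auto simp: p_def q_def split: if_splits)
qed

end

section \<open>The exterior algebra on a family of circles\<close>

text \<open>Circles are sorted by the key \<open>Min\<close>, which is injective on a disjoint
  family but not on all sets. The locale \<open>folding_insort_key\<close> is therefore interpreted
  with a key that is injective on \<open>Z\<close>.\<close>

lemma (in linorder) sorted_key_list_of_set_inj_on:
  assumes f: "inj_on f Z"
  shows "sorted_key_list_of_set f {} = []"
    and "insert x A \<subseteq> Z \<Longrightarrow> finite A \<Longrightarrow> x \<notin> A \<Longrightarrow>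
      sorted_key_list_of_set f (insert x A) = insort_key f x (sorted_key_list_of_set f A)"
    and "A \<subseteq> Z \<Longrightarrow> finite A \<Longrightarrow> set (sorted_key_list_of_set f A) = A"
    and "A \<subseteq> Z \<Longrightarrow> sorted (map f (sorted_key_list_of_set f A))"
    and "A \<subseteq> Z \<Longrightarrow> distinct (sorted_key_list_of_set f A)"
proof -
  interpret s: folding_insort_key "(\<le>)" "(<)" Z f
    by unfold_locales (rule f)
  show "sorted_key_list_of_set f {} = []" by (rule s.sorted_key_list_of_set_empty)
  show "insert x A \<subseteq> Z \<Longrightarrow> finite A \<Longrightarrow> x \<notin> A \<Longrightarrow>
      sorted_key_list_of_set f (insert x A) = insort_key f x (sorted_key_list_of_set f A)"
    by (rule s.sorted_key_list_of_set_insert)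
  show "A \<subseteq> Z \<Longrightarrow> finite A \<Longrightarrow> set (sorted_key_list_of_set f A) = A"
    by (rule s.set_sorted_key_list_of_set)
  show "A \<subseteq> Z \<Longrightarrow> sorted (map f (sorted_key_list_of_set f A))"
    by (rule s.sorted_sorted_key_list_of_set)
  show "A \<subseteq> Z \<Longrightarrow> distinct (sorted_key_list_of_set f A)"
    using s.distinct_sorted_key_list_of_set by (simp add: distinct_map)
qed

text \<open>Under this condition the least arcs order the circles linearly, and a set of circles
  determines a monomial with a definite sign.\<close>

definition wedge_base :: "'a::linorder set set \<Rightarrow> bool" where
  "wedge_base Z \<longleftrightarrow> finite Z \<and> inj_on Min Z"

definition ext :: "'a set set \<Rightarrow> ('a set set \<Rightarrow>\<^sub>0 int) set" where
  "ext Z = {w. Poly_Mapping.keys w \<subseteq> Pow Z}"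

definition cwedge :: "'a::linorder set \<Rightarrow> ('a set set \<Rightarrow>\<^sub>0 int) \<Rightarrow> ('a set set \<Rightarrow>\<^sub>0 int)" where
  "cwedge c = frag_extend (circle_wedge c)"

lemma carrier_exterior_algebra: "carrier (exterior_algebra Z) = ext Z"
  by (simp add: exterior_algebra_def ext_def free_Abelian_group_def)

lemma wedge_frag_of: "wedge (frag_of c) = cwedge c"
  by (simp add: wedge_def cwedge_def fun_eq_iff)

lemma wedge_diff: "wedge (u - v) w = wedge u w - wedge v w"
  by (simp add: wedge_def frag_extend_diff)

lemma sign_square: "(- 1 :: int) ^ n * (- 1) ^ n = 1"
  by (induction n) auto

lemma frag_cmul_minus: "frag_cmul k (- u) = frag_cmul (- k) u"
  by (rule poly_mapping_eqI) simp

lemma cwedge_0 [simp]: "cwedge c 0 = 0"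
  and cwedge_diff: "cwedge c (u - v) = cwedge c u - cwedge c v"
  and cwedge_cmul: "cwedge c (frag_cmul k u) = frag_cmul k (cwedge c u)"
  and cwedge_frag_of: "cwedge c (frag_of S) = circle_wedge c S"
  by (simp_all add: cwedge_def frag_extend_diff frag_extend_minus frag_extend_cmul)

lemma exterior_map_0 [simp]: "exterior_map f 0 = 0"
  and exterior_map_diff: "exterior_map f (u - v) = exterior_map f u - exterior_map f v"
  and exterior_map_cmul: "exterior_map f (frag_cmul k u) = frag_cmul k (exterior_map f u)"
  by (simp_all add: exterior_map_def frag_extend_diff frag_extend_minus frag_extend_cmul)

lemma ext_diff: "u \<in> ext Z \<Longrightarrow> v \<in> ext Z \<Longrightarrow> u - v \<in> ext Z"
  unfolding ext_def by (simp add: order_trans[OF keys_diff])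

lemma ext_0: "0 \<in> ext Z"
  by (simp add: ext_def)

lemma ext_frag_of: "frag_of S \<in> ext Z \<longleftrightarrow> S \<subseteq> Z"
  by (simp add: ext_def keys_frag_of)

lemma ext_cmul: "u \<in> ext Z \<Longrightarrow> frag_cmul k u \<in> ext Z"
  unfolding ext_def by (simp add: order_trans[OF keys_cmul])

lemma ext_basis_induct [consumes 1, case_names zero one diff]:
  assumes "w \<in> ext Z" "P 0" "\<And>S. S \<subseteq> Z \<Longrightarrow> P (frag_of S)" "\<And>a b. P a \<Longrightarrow> P b \<Longrightarrow> P (a - b)"
  shows "P w"
proof (rule frag_induction[of w "Pow Z"])
  show "Poly_Mapping.keys w \<subseteq> Pow Z" using assms(1) by (simp add: ext_def)
  show "P (frag_of S)" if "S \<in> Pow Z" for S by (rule assms(3)) (use that in simp)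
qed (fact assms(2), fact assms(4))

lemma circle_wedge_ext: "c \<in> Z \<Longrightarrow> S \<subseteq> Z \<Longrightarrow> circle_wedge c S \<in> ext Z"
  by (simp add: circle_wedge_def ext_0 ext_cmul ext_frag_of)

lemma cwedge_ext:
  assumes "w \<in> ext Z" "c \<in> Z"
  shows "cwedge c w \<in> ext Z"
  using assms(1)
  by (induction rule: ext_basis_induct)
    (auto simp: ext_0 cwedge_diff ext_diff cwedge_frag_of circle_wedge_ext assms(2))

lemma cwedge_self: "cwedge c (cwedge c w) = 0"
proof -
  have "w \<in> ext UNIV" by (simp add: ext_def)
  then show ?thesis
    by (induction rule: ext_basis_induct)
      (auto simp: cwedge_diff cwedge_frag_of circle_wedge_def cwedge_cmul)
qed

lemma card_less_insert:
  assumes "finite S" "d \<notin> S"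
  shows "card {e. (e = d \<or> e \<in> S) \<and> Min e < Min c} = card {e \<in> S. Min e < Min c} + (if Min d < Min c then 1 else 0)"
proof -
  have "{e. (e = d \<or> e \<in> S) \<and> Min e < Min c}
      = (if Min d < Min c then insert d {e \<in> S. Min e < Min c} else {e \<in> S. Min e < Min c})"
    by auto
  then show ?thesis using assms by simp
qed

lemma cwedge_circle_wedge_swap:
  assumes "finite S" "Min c \<noteq> Min d"
  shows "cwedge c (circle_wedge d S) = - cwedge d (circle_wedge c S)"
proof -
  have cd: "c \<noteq> d" using assms by auto
  consider "c \<in> S" | "d \<in> S" | "c \<notin> S" "d \<notin> S" by blast
  then show ?thesis
  proof cases
    case 3
    \<comment> \<open>Only the factor with the larger least arc is counted past the other one, so
      exactly one of the two exponents grows.\<close>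
    have "Min c < Min d \<longleftrightarrow> \<not> Min d < Min c" using assms(2) by auto
    with 3 cd show ?thesis
      by (simp add: circle_wedge_def cwedge_cmul cwedge_frag_of card_less_insert[OF assms(1)]
          insert_commute power_add mult.commute)
  qed (use cd in \<open>auto simp: circle_wedge_def cwedge_cmul cwedge_frag_of\<close>)
qed

lemma cwedge_swap:
  assumes Z: "wedge_base Z" "c \<in> Z" "d \<in> Z" and w: "w \<in> ext Z"
  shows "cwedge c (cwedge d w) = - cwedge d (cwedge c w)"
proof (cases "c = d")
  case False
  then have Min: "Min c \<noteq> Min d" using Z by (auto simp: wedge_base_def inj_on_def)
  from w show ?thesis
  proof (induction rule: ext_basis_induct)
    case (one S)
    then have "finite S" using Z(1) finite_subset by (auto simp: wedge_base_def)
    from cwedge_circle_wedge_swap[OF this Min] show ?case by (simp add: cwedge_frag_of)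
  next
    case (diff a b)
    show ?case by (simp only: cwedge_diff diff) simp
  qed simp
qed (simp add: cwedge_self)

abbreviation wedge_list :: "('a::linorder set \<Rightarrow> 'a set) \<Rightarrow> 'a set list \<Rightarrow> ('a set set \<Rightarrow>\<^sub>0 int)" where
  "wedge_list f xs \<equiv> foldr (\<lambda>c. cwedge (f c)) xs (frag_of {})"

lemma exterior_map_frag_of:
  "exterior_map f (frag_of S) = wedge_list f (sorted_key_list_of_set Min S)"
  by (simp add: exterior_map_def wedge_frag_of)

lemma wedge_list_ext: "f ` set xs \<subseteq> Z \<Longrightarrow> wedge_list f xs \<in> ext Z"
  by (induction xs) (auto simp: ext_frag_of intro: cwedge_ext)

lemma cwedge_wedge_list_mem:
  assumes Z: "wedge_base Z" and "f ` set xs \<subseteq> Z" "c \<in> set xs"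
  shows "cwedge (f c) (wedge_list f xs) = 0"
  using assms(2,3)
proof (induction xs)
  case (Cons x xs)
  show ?case
  proof (cases "c = x")
    case False
    then have "cwedge (f c) (wedge_list f xs) = 0" using Cons by auto
    moreover have "f c \<in> Z" "f x \<in> Z" "wedge_list f xs \<in> ext Z"
      using Cons.prems by (auto intro: wedge_list_ext)
    ultimately show ?thesis using cwedge_swap[OF Z, of "f c" "f x" "wedge_list f xs"] by simp
  qed (simp add: cwedge_self)
qed simp

text \<open>Inserting \<open>c\<close> by key moves it past the factors with smaller least arc, one
  exchange and one sign each. The map \<open>f\<close> may destroy the order, so the sign is counted
  on the arguments and not on their images.\<close>

lemma wedge_list_insort:
  assumes Z: "wedge_base Z" and "f ` set xs \<subseteq> Z" "f c \<in> Z" "sorted (map Min xs)"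
    "\<And>x. x \<in> set xs \<Longrightarrow> Min x \<noteq> Min c"
  shows "wedge_list f (insort_key Min c xs)
    = frag_cmul ((-1) ^ length (filter (\<lambda>d. Min d < Min c) xs)) (cwedge (f c) (wedge_list f xs))"
  using assms(2-)
proof (induction xs)
  case (Cons x xs)
  show ?case
  proof (cases "Min c \<le> Min x")
    case True
    have "\<not> Min d < Min c" if "d \<in> set (x # xs)" for d
    proof -
      have "Min x \<le> Min d" using Cons.prems(3) that by auto
      with True show ?thesis by (meson leD order_trans)
    qed
    then have "filter (\<lambda>d. Min d < Min c) (x # xs) = []" unfolding filter_empty_conv by blast
    moreover have "insort_key Min c (x # xs) = c # x # xs" using True by simp
    ultimately show ?thesis by (simp only: list.size power_0 frag_cmul_one foldr.simps o_apply)
  next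
    case False
    have mem: "f x \<in> Z" "wedge_list f xs \<in> ext Z" using Cons.prems by (auto intro: wedge_list_ext)
    have "wedge_list f (insort_key Min c (x # xs)) = cwedge (f x) (wedge_list f (insort_key Min c xs))"
      using False by simp
    also have "wedge_list f (insort_key Min c xs)
      = frag_cmul ((-1) ^ length (filter (\<lambda>d. Min d < Min c) xs)) (cwedge (f c) (wedge_list f xs))"
      using Cons by simp
    also have "cwedge (f x) \<dots> = frag_cmul ((-1) ^ length (filter (\<lambda>d. Min d < Min c) xs))
        (- cwedge (f c) (cwedge (f x) (wedge_list f xs)))"
      using cwedge_swap[OF Z mem(1) \<open>f c \<in> Z\<close> mem(2)] by (simp only: cwedge_cmul)
    finally have "wedge_list f (insort_key Min c (x # xs)) = \<dots>" .
    moreover have "length (filter (\<lambda>d. Min d < Min c) (x # xs)) = Suc (length (filter (\<lambda>d. Min d < Min c) xs))"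
      using False by (simp add: not_le)
    moreover have "wedge_list f (x # xs) = cwedge (f x) (wedge_list f xs)" by simp
    ultimately show ?thesis by (simp only: frag_cmul_minus power_Suc mult_minus1)
  qed
qed simp

text \<open>This is the rule that makes \<open>exterior_map\<close> multiplicative. A repeated
  circle gives zero on both sides; for a new one, the sign in \<open>circle_wedge\<close> is the
  sign of its insertion into the sorted list.\<close>

lemma exterior_map_cwedge:
  assumes Z: "wedge_base Z" and Z': "wedge_base Z'" and f: "f ` Z \<subseteq> Z'"
    and c: "c \<in> Z" and w: "w \<in> ext Z"
  shows "exterior_map f (cwedge c w) = cwedge (f c) (exterior_map f w)"
  using w
proof (induction rule: ext_basis_induct)
  case (one S)
  have S: "finite S" "inj_on Min S" using one Z by (auto simp: wedge_base_def intro: finite_subset inj_on_subset)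
  let ?xs = "sorted_key_list_of_set Min S"
  have inj: "inj_on Min Z" using Z by (simp add: wedge_base_def)
  note xs = sorted_key_list_of_set_inj_on(3)[OF inj one S(1)]
    sorted_key_list_of_set_inj_on(4,5)[OF inj one]
  have fS: "f ` S \<subseteq> Z'" "f c \<in> Z'" using one f c by auto
  show ?case
  proof (cases "c \<in> S")
    case True
    have "cwedge (f c) (wedge_list f ?xs) = 0"
      by (rule cwedge_wedge_list_mem[OF Z']) (simp_all add: xs(1) fS True)
    with True show ?thesis by (simp add: cwedge_frag_of circle_wedge_def exterior_map_frag_of)
  next
    case False
    have "length (filter (\<lambda>d. Min d < Min c) ?xs) = card {d \<in> S. Min d < Min c}"
      using distinct_card[of "filter (\<lambda>d. Min d < Min c) ?xs"] xs(1,3) by (simp add: distinct_filter)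
    moreover have "Min x \<noteq> Min c" if "x \<in> S" for x
    proof
      assume "Min x = Min c"
      then have "x = c" using Z one that c by (auto simp: wedge_base_def dest: inj_onD)
      with that False show False by simp
    qed
    ultimately have "wedge_list f (insort_key Min c ?xs)
        = frag_cmul ((-1) ^ card {d \<in> S. Min d < Min c}) (cwedge (f c) (wedge_list f ?xs))"
      using wedge_list_insort[OF Z', of f ?xs c] fS xs(1,2) by simp
    moreover have "sorted_key_list_of_set Min (insert c S) = insort_key Min c ?xs"
      by (rule sorted_key_list_of_set_inj_on(2)[OF inj]) (simp_all add: one c False S(1))
    ultimately have "exterior_map f (frag_of (insert c S))
        = frag_cmul ((-1) ^ card {d \<in> S. Min d < Min c}) (cwedge (f c) (exterior_map f (frag_of S)))"
      by (simp add: exterior_map_frag_of)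
    then show ?thesis using False
      by (simp add: cwedge_frag_of circle_wedge_def exterior_map_cmul sign_square)
  qed
next
  case (diff a b)
  then show ?case by (simp only: cwedge_diff exterior_map_diff)
qed simp

lemma exterior_map_one [simp]:
  fixes f :: "'a::linorder set \<Rightarrow> 'a set"
  shows "exterior_map f (frag_of {}) = frag_of {}"
  using sorted_key_list_of_set_inj_on(1)[of "Min :: 'a set \<Rightarrow> 'a" "{}"] by (simp add: exterior_map_frag_of)

lemma frag_of_insert:
  assumes "c \<notin> S"
  shows "frag_of (insert c S) = frag_cmul ((-1) ^ card {d \<in> S. Min d < Min c}) (cwedge c (frag_of S))"
  using assms by (simp add: cwedge_frag_of circle_wedge_def sign_square)

text \<open>Every monomial is, up to sign, an iterated wedge of circles with the unit. Inductions of
  this form never meet the signs of the chosen basis.\<close>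

lemma ext_induct [consumes 2, case_names zero one diff wedge]:
  assumes Z: "wedge_base Z" and w: "w \<in> ext Z"
    and 0: "P 0" and 1: "P (frag_of {})"
    and minus: "\<And>a b. P a \<Longrightarrow> P b \<Longrightarrow> P (a - b)"
    and wedge: "\<And>c u. c \<in> Z \<Longrightarrow> u \<in> ext Z \<Longrightarrow> P u \<Longrightarrow> P (cwedge c u)"
  shows "P w"
  using w
proof (induction rule: ext_basis_induct)
  case (one S)
  have "finite S" using one Z finite_subset by (auto simp: wedge_base_def)
  then show ?case using one
  proof (induction S rule: finite_induct)
    case (insert c S)
    have "P (cwedge c (frag_of S))" by (rule wedge) (use insert in \<open>auto simp: ext_frag_of\<close>)
    then show ?case
      unfolding frag_of_insert[OF insert.hyps(2)]
      by (intro frag_closure_minus_cmul[where P = P, OF 0]) (rule minus)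
  qed (rule 1)
next
  case (diff a b)
  from diff show ?case by (rule minus)
qed (rule 0)

lemma exterior_map_ext:
  assumes "wedge_base Z" "wedge_base Z'" "f ` Z \<subseteq> Z'" "w \<in> ext Z"
  shows "exterior_map f w \<in> ext Z'"
  using assms(1,4)
proof (induction rule: ext_induct)
  case (wedge c u)
  have "f c \<in> Z'" using assms(3) wedge(1) by blast
  then show ?case
    unfolding exterior_map_cwedge[OF assms(1-3) wedge(1,2)] by (rule cwedge_ext[OF wedge(3)])
qed (auto simp: ext_0 ext_frag_of exterior_map_diff ext_diff)

lemma exterior_map_cong:
  assumes "wedge_base Z" "wedge_base Z'" "f ` Z \<subseteq> Z'" "w \<in> ext Z" "\<And>c. c \<in> Z \<Longrightarrow> f c = g c"
  shows "exterior_map f w = exterior_map g w"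
  using assms(1,4)
proof (induction rule: ext_induct)
  case (wedge c u)
  have "f ` Z = g ` Z" by (rule image_cong[OF refl]) (rule assms(5))
  then have gZ: "g ` Z \<subseteq> Z'" using assms(3) by simp
  show ?case
    unfolding exterior_map_cwedge[OF assms(1-3) wedge(1,2)] exterior_map_cwedge[OF assms(1,2) gZ wedge(1,2)]
    using wedge(3) assms(5)[OF wedge(1)] by simp
qed (auto simp: exterior_map_diff)

lemma exterior_map_comp:
  assumes "wedge_base Z" "wedge_base Z'" "wedge_base Z''" "f ` Z \<subseteq> Z'" "g ` Z' \<subseteq> Z''" "w \<in> ext Z"
  shows "exterior_map g (exterior_map f w) = exterior_map (g \<circ> f) w"
  using assms(1,6)
proof (induction rule: ext_induct)
  case (wedge c u)
  have gf: "(g \<circ> f) ` Z \<subseteq> Z''" using assms(4,5) by (simp add: image_subset_iff)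
  have fc: "f c \<in> Z'" using assms(4) wedge(1) by (simp add: image_subset_iff)
  have "exterior_map g (exterior_map f (cwedge c u)) = cwedge (g (f c)) (exterior_map g (exterior_map f u))"
    unfolding exterior_map_cwedge[OF assms(1,2,4) wedge(1,2)]
    by (rule exterior_map_cwedge[OF assms(2,3,5) fc exterior_map_ext[OF assms(1,2,4) wedge(2)]])
  also have "\<dots> = cwedge ((g \<circ> f) c) (exterior_map (g \<circ> f) u)" by (metis wedge(3) comp_apply)
  also have "\<dots> = exterior_map (g \<circ> f) (cwedge c u)"
    by (rule exterior_map_cwedge[OF assms(1,3) gf wedge(1,2), symmetric])
  finally show ?case .
qed (auto simp: exterior_map_diff)

lemma exterior_map_ident:
  assumes "wedge_base Z" "w \<in> ext Z" "\<And>c. c \<in> Z \<Longrightarrow> f c = c"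
  shows "exterior_map f w = w"
  using assms(1,2)
proof (induction rule: ext_induct)
  case (wedge c u)
  have "f ` Z \<subseteq> Z" by (simp add: image_subset_iff assms(3))
  from exterior_map_cwedge[OF assms(1,1) this wedge(1,2)] show ?case
    by (simp only: wedge(3) assms(3)[OF wedge(1)])
qed (auto simp: exterior_map_diff)

text \<open>A repeated image gives a repeated factor and hence zero; distinct images only have to be
  reordered. The parity of \<open>k\<close> is what survives modulo two.\<close>

lemma exterior_map_frag_of_image:
  assumes "wedge_base Z" "wedge_base Z'" "f ` Z \<subseteq> Z'" "S \<subseteq> Z"
  shows "\<exists>k. exterior_map f (frag_of S) = frag_cmul k (frag_of (f ` S)) \<and>
    (if inj_on f S then \<bar>k\<bar> = 1 else k = 0)"
proof -
  have "finite S" using finite_subset[OF assms(4)] assms(1) by (simp add: wedge_base_def)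
  then show ?thesis using assms(4)
  proof (induction S rule: finite_induct)
    case empty
    show ?case by (rule exI[of _ 1]) simp
  next
    case (insert c S)
    have S: "S \<subseteq> Z" "c \<in> Z" using insert.prems by simp_all
    obtain k where k: "exterior_map f (frag_of S) = frag_cmul k (frag_of (f ` S))"
      "if inj_on f S then \<bar>k\<bar> = 1 else k = 0" using insert.IH[OF S(1)] by blast
    have eq: "exterior_map f (frag_of (insert c S))
      = frag_cmul ((-1) ^ card {d \<in> S. Min d < Min c} * k) (circle_wedge (f c) (f ` S))"
      unfolding frag_of_insert[OF insert.hyps(2)]
      using exterior_map_cwedge[OF assms(1-3) S(2), of "frag_of S"] S(1) k(1)
      by (simp add: exterior_map_cmul cwedge_cmul cwedge_frag_of ext_frag_of)
    show ?case
    proof (cases "f c \<in> f ` S")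
      case True
      then have "\<not> inj_on f (insert c S)" using insert.hyps by simp
      moreover have "exterior_map f (frag_of (insert c S)) = 0" using eq True by (simp add: circle_wedge_def)
      ultimately show ?thesis by (intro exI[of _ 0]) simp
    next
      case False
      then have inj: "inj_on f (insert c S) \<longleftrightarrow> inj_on f S" using insert.hyps by simp
      let ?k = "(-1) ^ card {d \<in> S. Min d < Min c} * k * (-1) ^ card {d \<in> f ` S. Min d < Min (f c)}"
      have "exterior_map f (frag_of (insert c S)) = frag_cmul ?k (frag_of (f ` insert c S))"
        using eq False by (simp add: circle_wedge_def)
      moreover have "if inj_on f (insert c S) then \<bar>?k\<bar> = 1 else ?k = 0"
        using k(2) unfolding inj by (cases "inj_on f S") (simp_all add: abs_mult power_abs)
      ultimately show ?thesis by blast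
    qed
  qed
qed

text \<open>
  Wedging with \<open>a1 - a2\<close> factors through the identification of \<open>a1\<close> with \<open>a2\<close>, because
  \<open>(a1 - a2) \<and> a1 = (a1 - a2) \<and> a2\<close>. Hence the split map does not depend on the lift.
\<close>

definition diff_wedge :: "'a::linorder set \<Rightarrow> 'a set \<Rightarrow> ('a set set \<Rightarrow>\<^sub>0 int) \<Rightarrow> ('a set set \<Rightarrow>\<^sub>0 int)" where
  "diff_wedge a b w = cwedge a w - cwedge b w"

lemma diff_wedge_same [simp]: "diff_wedge a a w = 0"
  by (simp add: diff_wedge_def)

lemma diff_wedge_diff: "diff_wedge a b (u - v) = diff_wedge a b u - diff_wedge a b v"
  by (simp add: diff_wedge_def cwedge_diff)

lemma diff_wedge_commute: "diff_wedge b a w = - diff_wedge a b w"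
  by (simp add: diff_wedge_def)

lemma wedge_frag_of_diff: "wedge (frag_of a - frag_of b) w = diff_wedge a b w"
  by (simp add: wedge_diff wedge_frag_of diff_wedge_def)

lemma diff_wedge_ext: "a \<in> Z \<Longrightarrow> b \<in> Z \<Longrightarrow> w \<in> ext Z \<Longrightarrow> diff_wedge a b w \<in> ext Z"
  by (simp add: diff_wedge_def cwedge_ext ext_diff)

lemma diff_wedge_cwedge:
  assumes "wedge_base Z" "a \<in> Z" "b \<in> Z" "c \<in> Z" "w \<in> ext Z"
  shows "diff_wedge a b (cwedge c w) = - cwedge c (diff_wedge a b w)"
  using cwedge_swap[OF assms(1,2,4,5)] cwedge_swap[OF assms(1,3,4,5)]
  by (simp add: diff_wedge_def cwedge_diff)

lemma diff_wedge_swap: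
  assumes "wedge_base Z" "a \<in> Z" "b \<in> Z" "c \<in> Z" "d \<in> Z" "w \<in> ext Z"
  shows "diff_wedge a b (diff_wedge c d w) = - diff_wedge c d (diff_wedge a b w)"
proof -
  have "diff_wedge a b (diff_wedge c d w)
      = diff_wedge a b (cwedge c w) - diff_wedge a b (cwedge d w)"
    by (simp add: diff_wedge_def[of c d] diff_wedge_diff)
  then show ?thesis
    using diff_wedge_cwedge[OF assms(1-4,6)] diff_wedge_cwedge[OF assms(1-3,5,6)]
    by (simp add: diff_wedge_def[of c d])
qed

lemma exterior_map_diff_wedge:
  assumes "wedge_base Z" "wedge_base Z'" "f ` Z \<subseteq> Z'" "a \<in> Z" "b \<in> Z" "w \<in> ext Z"
  shows "exterior_map f (diff_wedge a b w) = diff_wedge (f a) (f b) (exterior_map f w)"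
  using exterior_map_cwedge[OF assms(1-3) _ assms(6)] assms(4,5)
  by (simp add: diff_wedge_def exterior_map_diff)

lemma diff_wedge_section:
  assumes Z: "wedge_base Z" "wedge_base Z'" and \<pi>: "\<pi> ` Z' \<subseteq> Z" and j: "j ` Z \<subseteq> Z'"
    and ab: "a \<in> Z'" "b \<in> Z'"
    and sec: "\<And>c. c \<in> Z' \<Longrightarrow> j (\<pi> c) = (if c = b then a else c)"
    and w: "w \<in> ext Z'"
  shows "diff_wedge a b (exterior_map j (exterior_map \<pi> w)) = diff_wedge a b w"
proof -
  define h where "h = j \<circ> \<pi>"
  have hZ: "h ` Z' \<subseteq> Z'" using \<pi> j by (auto simp: h_def)
  have "diff_wedge a b (exterior_map h w) = diff_wedge a b w"
    using Z(2) w
  proof (induction rule: ext_induct)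
    case (wedge c u)
    let ?X = "exterior_map h u"
    have X: "?X \<in> ext Z'" by (rule exterior_map_ext[OF Z(2,2) hZ wedge(2)])
    have eq: "exterior_map h (cwedge c u) = cwedge (h c) ?X"
      by (rule exterior_map_cwedge[OF Z(2,2) hZ wedge(1,2)])
    show ?case
    proof (cases "c = b")
      case False
      then have "h c = c" using sec[OF wedge(1)] by (simp add: h_def)
      then show ?thesis
        using eq diff_wedge_cwedge[OF Z(2) ab wedge(1) X] diff_wedge_cwedge[OF Z(2) ab wedge(1,2)] wedge(3)
        by simp
    next
      case True
      then have hc: "h c = a" using sec[OF wedge(1)] by (simp add: h_def)
      \<comment> \<open>The induction hypothesis speaks of \<open>diff_wedge a b\<close> only, so
        the product with \<open>b\<close> is first rewritten in terms of it.\<close>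
      have *: "cwedge a (cwedge b v) = - cwedge a (diff_wedge a b v)" for v
        by (simp add: diff_wedge_def cwedge_diff cwedge_self)
      have "diff_wedge a b (cwedge a ?X) = cwedge a (cwedge b ?X)"
        using cwedge_swap[OF Z(2) ab X] by (simp add: diff_wedge_def cwedge_self)
      also have "\<dots> = cwedge a (cwedge b u)" unfolding * wedge(3) ..
      also have "\<dots> = diff_wedge a b (cwedge b u)" by (simp add: diff_wedge_def cwedge_self)
      finally show ?thesis using eq hc True by simp
    qed
  qed (auto simp: exterior_map_diff diff_wedge_diff)
  then show ?thesis using exterior_map_comp[OF Z(2,1,2) \<pi> j w] by (simp add: h_def)
qed

section \<open>Commutation of the squares of the odd cube\<close>

definition disjoint_family :: "'a set set \<Rightarrow> bool" where
  "disjoint_family Z \<longleftrightarrow> finite Z \<and> (\<forall>c\<in>Z. finite c \<and> c \<noteq> {}) \<and>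
     (\<forall>c\<in>Z. \<forall>d\<in>Z. c \<inter> d \<noteq> {} \<longrightarrow> c = d)"

definition finer :: "'a set set \<Rightarrow> 'a set set \<Rightarrow> bool" where
  "finer Z Z' \<longleftrightarrow> (\<forall>c\<in>Z. \<exists>d\<in>Z'. c \<subseteq> d)"

text \<open>With circles encoded as sets of arcs, a merge sends a circle to the new circle that
  contains it. Unlike \<open>identify\<close>, this description composes along any sequence of
  merges.\<close>

definition super :: "'a set set \<Rightarrow> 'a set \<Rightarrow> 'a set" where
  "super Z c = (THE d. d \<in> Z \<and> c \<subseteq> d)"

text \<open>Also read backwards, as a split of a circle of \<open>Z'\<close> into \<open>a\<close>
  and \<open>b\<close>.\<close>

definition merges :: "'a set set \<Rightarrow> 'a set \<Rightarrow> 'a set \<Rightarrow> 'a set set \<Rightarrow> bool" where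
  "merges Z a b Z' \<longleftrightarrow> a \<in> Z \<and> b \<in> Z \<and> a \<noteq> b \<and> Z' = insert (a \<union> b) (Z - {a, b})"

lemma disjoint_family_eq:
  "disjoint_family Z \<Longrightarrow> c \<in> Z \<Longrightarrow> d \<in> Z \<Longrightarrow> x \<in> c \<Longrightarrow> x \<in> d \<Longrightarrow> c = d"
proof -
  assume *: "disjoint_family Z" "c \<in> Z" "d \<in> Z" "x \<in> c" "x \<in> d"
  then have "c \<inter> d \<noteq> {}" by blast
  with * show "c = d" by (simp add: disjoint_family_def)
qed

lemma disjoint_family_nonempty: "disjoint_family Z \<Longrightarrow> c \<in> Z \<Longrightarrow> c \<noteq> {}"
  by (simp add: disjoint_family_def)

lemma disjoint_family_wedge_base:
  assumes "disjoint_family Z"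
  shows "wedge_base Z"
  unfolding wedge_base_def
proof (intro conjI inj_onI)
  show "finite Z" using assms by (simp add: disjoint_family_def)
  fix c d assume cd: "c \<in> Z" "d \<in> Z" "Min c = Min d"
  have "Min c \<in> c" "Min d \<in> d" using assms cd(1,2) by (simp_all add: disjoint_family_def)
  then show "c = d" using disjoint_family_eq[OF assms cd(1,2), of "Min c"] cd(3) by simp
qed

lemma superI:
  assumes "disjoint_family Z" "d \<in> Z" "c \<subseteq> d" "c \<noteq> {}"
  shows "super Z c = d"
  unfolding super_def
proof (rule the_equality)
  fix e assume e: "e \<in> Z \<and> c \<subseteq> e"
  obtain x where "x \<in> c" using assms(4) by blast
  then show "e = d" using disjoint_family_eq[OF assms(1), of e d x] e assms(2,3) by (simp add: subset_iff)
qed (use assms in simp)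

lemma super_mem:
  assumes "disjoint_family Z" "disjoint_family Z'" "finer Z Z'" "c \<in> Z"
  shows "super Z' c \<in> Z'" "c \<subseteq> super Z' c"
proof -
  obtain d where "d \<in> Z'" "c \<subseteq> d" using assms(3,4) unfolding finer_def by blast
  with superI[OF assms(2) this] disjoint_family_nonempty[OF assms(1,4)]
  show "super Z' c \<in> Z'" "c \<subseteq> super Z' c" by simp_all
qed

lemma super_image:
  assumes "disjoint_family Z" "disjoint_family Z'" "finer Z Z'"
  shows "super Z' ` Z \<subseteq> Z'"
  using super_mem(1)[OF assms] by (simp add: image_subset_iff)

lemma super_super:
  assumes "disjoint_family Z" "disjoint_family Z'" "disjoint_family Z''" "finer Z Z'" "finer Z' Z''" "c \<in> Z"
  shows "super Z'' (super Z' c) = super Z'' c"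
proof -
  note 1 = super_mem[OF assms(1,2,4,6)]
  note 2 = super_mem[OF assms(2,3,5) 1(1)]
  have "c \<subseteq> super Z'' (super Z' c)" using 1(2) 2(2) by (rule order_trans)
  from superI[OF assms(3) 2(1) this disjoint_family_nonempty[OF assms(1,6)]] show ?thesis by simp
qed

lemma exterior_map_super_super:
  assumes "disjoint_family Z" "disjoint_family Z'" "disjoint_family Z''" "finer Z Z'" "finer Z' Z''" "w \<in> ext Z"
  shows "exterior_map (super Z'') (exterior_map (super Z') w) = exterior_map (super Z'') w"
proof -
  note wb = assms(1-3)[THEN disjoint_family_wedge_base]
  note im = super_image[OF assms(1,2,4)] super_image[OF assms(2,3,5)]
  have "exterior_map (super Z'') (exterior_map (super Z') w) = exterior_map (super Z'' \<circ> super Z') w"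
    by (rule exterior_map_comp[OF wb im assms(6)])
  also have "\<dots> = exterior_map (super Z'') w"
  proof (rule exterior_map_cong[OF wb(1,3) _ assms(6)])
    show "(super Z'' \<circ> super Z') ` Z \<subseteq> Z''" using im by (simp add: image_subset_iff)
  qed (simp add: super_super[OF assms(1-5)])
  finally show ?thesis .
qed

lemma exterior_map_super_ext:
  assumes "disjoint_family Z" "disjoint_family Z'" "finer Z Z'" "w \<in> ext Z"
  shows "exterior_map (super Z') w \<in> ext Z'"
  by (rule exterior_map_ext[OF disjoint_family_wedge_base disjoint_family_wedge_base super_image]) fact+

lemma exterior_map_super_diff_wedge:
  assumes "disjoint_family Z" "disjoint_family Z'" "finer Z Z'" "a \<in> Z" "b \<in> Z" "w \<in> ext Z"
  shows "exterior_map (super Z') (diff_wedge a b w)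
    = diff_wedge (super Z' a) (super Z' b) (exterior_map (super Z') w)"
  by (rule exterior_map_diff_wedge[OF disjoint_family_wedge_base disjoint_family_wedge_base super_image]) fact+

section \<open>Merging two members of a disjoint family\<close>

context
  fixes Z Z' :: "'a set set" and a b
  assumes Z: "disjoint_family Z" and m: "merges Z a b Z'"
begin

lemma merges_mem: "a \<in> Z" "b \<in> Z" "a \<noteq> b" "a \<union> b \<in> Z'"
  using m by (simp_all add: merges_def)

lemma merges_new: "a \<union> b \<notin> Z" "a \<notin> Z'" "b \<notin> Z'"
proof -
  obtain u v where uv: "u \<in> a" "v \<in> b"
    using disjoint_family_nonempty[OF Z] merges_mem by (metis ex_in_conv)
  show new: "a \<union> b \<notin> Z"
  proof
    assume ab: "a \<union> b \<in> Z"
    have "a \<union> b = a" "a \<union> b = b"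
      using disjoint_family_eq[OF Z ab merges_mem(1)] disjoint_family_eq[OF Z ab merges_mem(2)] uv by blast+
    with merges_mem show False by simp
  qed
  then have "a \<noteq> a \<union> b" "b \<noteq> a \<union> b" using merges_mem by metis+
  then show "a \<notin> Z'" "b \<notin> Z'" using m by (simp_all add: merges_def)
qed

lemma merges_diff: "Z - Z' = {a, b}"
  using merges_mem merges_new m by (auto simp: merges_def)

lemma merges_card: "card Z = Suc (card Z')"
proof -
  have fin: "finite Z" using Z by (simp add: disjoint_family_def)
  have "card Z' = Suc (card (Z - {a, b}))"
    using m merges_new(1) fin by (simp add: merges_def)
  moreover have "card Z = card (Z - {a, b}) + card {a, b}"
    using merges_mem fin by (metis Diff_subset card_Diff_subset card_mono empty_subsetI
        finite.emptyI finite.insertI insert_subset le_add_diff_inverse2)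
  ultimately show ?thesis using merges_mem(3) by simp
qed

lemma merges_finer: "finer Z Z'"
  unfolding finer_def
proof
  fix c assume c: "c \<in> Z"
  show "\<exists>d\<in>Z'. c \<subseteq> d"
  proof (cases "c = a \<or> c = b")
    case True
    then show ?thesis using merges_mem(4) by blast
  next
    case False
    then have "c \<in> Z'" using c m by (simp add: merges_def)
    then show ?thesis by blast
  qed
qed

lemma merges_disjoint_family: "disjoint_family Z'"
proof -
  have old: "e \<in> Z \<and> e \<noteq> a \<and> e \<noteq> b \<or> e = a \<union> b" if "e \<in> Z'" for e
    using that m by (simp add: merges_def) blast
  have eq: "c = d" if "c \<in> Z'" "d \<in> Z'" "x \<in> c" "x \<in> d" for c d x
  proof -
    have away: False if "e \<in> Z" "e \<noteq> a" "e \<noteq> b" "x \<in> e" "x \<in> a \<union> b" for e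
      using that(2-) disjoint_family_eq[OF Z that(1) merges_mem(1)]
        disjoint_family_eq[OF Z that(1) merges_mem(2)] by blast
    show ?thesis
      using old[OF \<open>c \<in> Z'\<close>] old[OF \<open>d \<in> Z'\<close>] away[of c] away[of d] \<open>x \<in> c\<close> \<open>x \<in> d\<close>
        disjoint_family_eq[OF Z, of c d x] by metis
  qed
  have fin: "finite e \<and> e \<noteq> {}" if "e \<in> Z" for e using Z that by (simp add: disjoint_family_def)
  show ?thesis
    unfolding disjoint_family_def
  proof (intro conjI ballI impI)
    show "finite Z'" using Z m by (simp add: disjoint_family_def merges_def)
    fix c assume c: "c \<in> Z'"
    show "finite c" "c \<noteq> {}"
      using old[OF c] fin[of c] fin[OF merges_mem(1)] fin[OF merges_mem(2)] by auto
    fix d assume "d \<in> Z'" "c \<inter> d \<noteq> {}"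
    then show "c = d" using eq[OF c] by blast
  qed
qed

lemma merges_super:
  assumes "c \<in> Z"
  shows "super Z' c = (if c = a \<or> c = b then a \<union> b else c)"
proof (rule superI[OF merges_disjoint_family])
  show "c \<noteq> {}" by (rule disjoint_family_nonempty[OF Z assms])
qed (use assms m in \<open>auto simp: merges_def\<close>)

lemma merges_super_eq:
  assumes "c \<in> Z" "d \<in> Z" "super Z' c = super Z' d" "c \<noteq> d"
  shows "{c, d} = {a, b}"
proof -
  have *: "e \<noteq> a \<union> b" if "e \<in> Z" for e using merges_new(1) that by metis
  show ?thesis
    using assms(3,4) *[OF assms(1)] *[OF assms(2)] unfolding merges_super[OF assms(1)] merges_super[OF assms(2)]
    by (cases "c = a \<or> c = b"; cases "d = a \<or> d = b") auto
qed

end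

lemma merges_commute: "merges Z a b Z' \<longleftrightarrow> merges Z b a Z'"
  by (auto simp: merges_def Un_commute insert_commute)

section \<open>Edge maps of a merge and of a split\<close>

context
  fixes Z Z' :: "'a::linorder set set" and a b
  assumes Z: "disjoint_family Z" and m: "merges Z a b Z'"
begin

lemma exterior_map_identify:
  assumes "w \<in> ext Z"
  shows "exterior_map (identify a b (a \<union> b)) w = exterior_map (super Z') w"
proof (rule exterior_map_cong[OF _ _ _ assms])
  show "wedge_base Z" "wedge_base Z'"
    using Z merges_disjoint_family[OF Z m] by (simp_all add: disjoint_family_wedge_base)
  show eq: "identify a b (a \<union> b) c = super Z' c" if "c \<in> Z" for c
    using merges_super[OF Z m that] by (simp add: identify_def)
  show "identify a b (a \<union> b) ` Z \<subseteq> Z'"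
    using super_image[OF Z merges_disjoint_family[OF Z m] merges_finer[OF Z m]]
    by (simp add: image_subset_iff eq)
qed

text \<open>\<open>j\<close> sends the merged circle to \<open>a\<close> and is a section of
  \<open>super Z'\<close>. It provides a lift of every element, and wedging with a - b gives the
  same result on any lift as on this one.\<close>

lemma split_section:
  defines "j \<equiv> \<lambda>c. if c = a \<union> b then a else c"
  shows "j ` Z' \<subseteq> Z"
    and "\<And>c. c \<in> Z \<Longrightarrow> j (super Z' c) = (if c = b then a else c)"
    and "\<And>w. w \<in> ext Z \<Longrightarrow> diff_wedge a b (exterior_map j (exterior_map (super Z') w)) = diff_wedge a b w"
    and "\<And>v. v \<in> ext Z' \<Longrightarrow> exterior_map j v \<in> ext Z"
    and "\<And>v. v \<in> ext Z' \<Longrightarrow> exterior_map (super Z') (exterior_map j v) = v"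
proof -
  note Z' = merges_disjoint_family[OF Z m]
  note wb = Z[THEN disjoint_family_wedge_base] Z'[THEN disjoint_family_wedge_base]
  note ab = merges_mem[OF Z m]
  note im = super_image[OF Z Z' merges_finer[OF Z m]]
  show j: "j ` Z' \<subseteq> Z" using m by (auto simp: j_def merges_def)
  show sec: "j (super Z' c) = (if c = b then a else c)" if "c \<in> Z" for c
  proof -
    have "c \<noteq> a \<union> b" using merges_new(1)[OF Z m] that by metis
    then show ?thesis using merges_super[OF Z m that] by (simp add: j_def)
  qed
  show "diff_wedge a b (exterior_map j (exterior_map (super Z') w)) = diff_wedge a b w" if "w \<in> ext Z" for w
    by (rule diff_wedge_section[OF wb(2,1) im j ab(1,2) sec that])
  show ext: "exterior_map j v \<in> ext Z" if "v \<in> ext Z'" for v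
    by (rule exterior_map_ext[OF wb(2,1) j that])
  show "exterior_map (super Z') (exterior_map j v) = v" if "v \<in> ext Z'" for v
  proof -
    have "exterior_map (super Z') (exterior_map j v) = exterior_map (super Z' \<circ> j) v"
      by (rule exterior_map_comp[OF wb(2,1,2) j im that])
    also have "\<dots> = v"
    proof (rule exterior_map_ident[OF wb(2) that])
      fix c assume c: "c \<in> Z'"
      show "(super Z' \<circ> j) c = c"
      proof (cases "c = a \<union> b")
        case True
        then show ?thesis using merges_super[OF Z m ab(1)] by (simp add: j_def)
      next
        case False
        then have "c \<in> Z" "c \<noteq> a" "c \<noteq> b" using c m by (auto simp: merges_def)
        then show ?thesis using False merges_super[OF Z m] by (simp add: j_def)
      qed
    qed
    finally show ?thesis .
  qed
qed

text \<open>This removes the choice from the split map: whichever lift is selected, it may be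
  replaced by any known lift \<open>w\<close>.\<close>

lemma split_lift_value:
  assumes w: "w \<in> ext Z"
  shows "wedge (frag_of a - frag_of b)
      (SOME u. u \<in> carrier (exterior_algebra Z) \<and>
        exterior_map (identify a b (a \<union> b)) u = exterior_map (super Z') w) = diff_wedge a b w"
proof -
  let ?P = "\<lambda>u. u \<in> carrier (exterior_algebra Z) \<and>
        exterior_map (identify a b (a \<union> b)) u = exterior_map (super Z') w"
  define u where "u = (SOME u. ?P u)"
  have "?P w" using w exterior_map_identify[OF w] by (simp add: carrier_exterior_algebra)
  then have u: "?P u" unfolding u_def by (rule someI)
  then have u_ext: "u \<in> ext Z" by (simp add: carrier_exterior_algebra)
  have "exterior_map (super Z') u = exterior_map (super Z') w"
    using u exterior_map_identify[OF u_ext] by simp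
  then have "diff_wedge a b u = diff_wedge a b w"
    using split_section(3)[OF u_ext] split_section(3)[OF w] by simp
  then show ?thesis by (simp only: wedge_frag_of_diff u_def)
qed

end

section \<open>Circles before and after a surgery\<close>

context planar_diagram
begin

lemma circle_of_subset_arcs:
  assumes "a \<in> arcs D"
  shows "circle_of D I a \<subseteq> arcs D"
proof
  fix b assume "b \<in> circle_of D I a"
  then have "(a, b) \<in> (joined D I)\<^sup>*" by (simp add: circle_of_def)
  then show "b \<in> arcs D"
    using assms
  proof (induction rule: rtrancl_induct)
    case (step b c)
    from step.hyps(2) show ?case using arc_at_in_arcs by (auto simp: joined_def)
  qed
qed

lemma circle_of_mem: "a \<in> circle_of D I a"
  by (simp add: circle_of_def)

lemma circle_of_in_circles: "a \<in> arcs D \<Longrightarrow> circle_of D I a \<in> circles D I"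
  by (simp add: circles_def)

lemma disjoint_family_circles: "disjoint_family (circles D I)"
  unfolding disjoint_family_def
proof (intro conjI ballI impI)
  show "finite (circles D I)" using finite_arcs by (simp add: circles_def)
  fix c assume "c \<in> circles D I"
  then obtain a where a: "a \<in> arcs D" "c = circle_of D I a" by (auto simp: circles_def)
  show "finite c" using a circle_of_subset_arcs finite_arcs finite_subset by metis
  show "c \<noteq> {}" using a circle_of_mem by (metis empty_iff)
  fix d assume "d \<in> circles D I" "c \<inter> d \<noteq> {}"
  then obtain b e where "b \<in> arcs D" "d = circle_of D I b" "e \<in> c" "e \<in> d" by (auto simp: circles_def)
  then have "circle_of D I a = circle_of D I e" "circle_of D I b = circle_of D I e"
    unfolding circle_of_eq_iff using a by (simp_all add: circle_of_def)
  then show "c = d" using a \<open>d = circle_of D I b\<close> by simp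
qed

lemma circles_eq_components: "circles D I = components (joined D I) (arcs D)"
  by (simp add: circles_def components_def circle_of_def[abs_def])

lemma joinedI:
  "x \<in> crossings D \<Longrightarrow> (arc_at D x c, arc_at D x (resolve (x \<in> I) c)) \<in> joined D I"
  unfolding joined_def by blast

text \<open>Once the two strands at \<open>x\<close> are linked, all four corners at
  \<open>x\<close> are connected in either resolution; away from \<open>x\<close> the resolutions
  agree.\<close>

lemma surgery_join:
  assumes x: "x \<in> crossings D" "x \<notin> I"
  shows "(joined D I \<union> {(arc_at D x UL, arc_at D x LL), (arc_at D x LL, arc_at D x UL)})\<^sup>*
    = (joined D (insert x I) \<union> {(arc_at D x UL, arc_at D x UR), (arc_at D x UR, arc_at D x UL)})\<^sup>*"
    (is "(?J0 \<union> ?P0)\<^sup>* = (?J1 \<union> ?P1)\<^sup>*")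
proof (rule rtrancl_eqI)
  let ?R0 = "(?J0 \<union> ?P0)\<^sup>*" and ?R1 = "(?J1 \<union> ?P1)\<^sup>*"
  have j0: "(arc_at D x c, arc_at D x (resolve False c)) \<in> ?R0" for c
    using joinedI[OF x(1), of c I] x(2) by (simp add: r_into_rtrancl)
  have j1: "(arc_at D x c, arc_at D x (resolve True c)) \<in> ?R1" for c
    using joinedI[OF x(1), of c "insert x I"] by (simp add: r_into_rtrancl)
  have "(arc_at D x UL, arc_at D x LL) \<in> ?R0" "(arc_at D x LL, arc_at D x UL) \<in> ?R0" by auto
  with j0[of UL] j0[of UR] j0[of LL] j0[of LR]
  have 1: "(arc_at D x c, arc_at D x UL) \<in> ?R0 \<and> (arc_at D x UL, arc_at D x c) \<in> ?R0" for c
    by (cases c) (simp_all, (meson rtrancl_trans)+)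
  have all0: "(arc_at D x c, arc_at D x d) \<in> ?R0" for c d
    using 1[of c] 1[of d] by (meson rtrancl_trans)
  have "(arc_at D x UL, arc_at D x UR) \<in> ?R1" "(arc_at D x UR, arc_at D x UL) \<in> ?R1" by auto
  with j1[of UL] j1[of UR] j1[of LL] j1[of LR]
  have 2: "(arc_at D x c, arc_at D x UL) \<in> ?R1 \<and> (arc_at D x UL, arc_at D x c) \<in> ?R1" for c
    by (cases c) (simp_all, (meson rtrancl_trans)+)
  have all1: "(arc_at D x c, arc_at D x d) \<in> ?R1" for c d
    using 2[of c] 2[of d] by (meson rtrancl_trans)
  have "z \<in> ?R1" if z: "z \<in> ?J0" for z
  proof -
    obtain y c where y: "y \<in> crossings D" "z = (arc_at D y c, arc_at D y (resolve (y \<in> I) c))"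
      using z unfolding joined_def by blast
    show ?thesis
    proof (cases "y = x")
      case False
      then have "z \<in> ?J1" using joinedI[OF y(1), of c "insert x I"] y(2) by simp
      then show ?thesis by (simp add: r_into_rtrancl)
    qed (use y all1 in simp)
  qed
  then show "?J0 \<union> ?P0 \<subseteq> ?R1" using all1 by auto
  have "z \<in> ?R0" if z: "z \<in> ?J1" for z
  proof -
    obtain y c where y: "y \<in> crossings D" "z = (arc_at D y c, arc_at D y (resolve (y \<in> insert x I) c))"
      using z unfolding joined_def by blast
    show ?thesis
    proof (cases "y = x")
      case False
      then have "z \<in> ?J0" using joinedI[OF y(1), of c I] y(2) by simp
      then show ?thesis by (simp add: r_into_rtrancl)
    qed (use y all0 in simp)
  qed
  then show "?J1 \<union> ?P1 \<subseteq> ?R0" using all0 by auto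
qed

lemma components_absorb:
  assumes "sym (r\<^sup>*)" "(p, q) \<in> r\<^sup>*"
  shows "(r \<union> {(p, q), (q, p)})\<^sup>* = r\<^sup>*"
  by (rule rtrancl_eqI) (use assms in \<open>auto dest: symD\<close>)

lemma join_circles:
  assumes r: "\<And>a. r\<^sup>* `` {a} = circle_of D I' a"
    and eq: "r\<^sup>* = (joined D I \<union> {(p, q), (q, p)})\<^sup>*"
    and pq: "p \<in> arcs D" "q \<in> arcs D" "(p, q) \<notin> (joined D I)\<^sup>*"
  shows "merges (circles D I) (circle_of D I p) (circle_of D I q) (circles D I')"
    and "circle_of D I' p = circle_of D I p \<union> circle_of D I q"
proof -
  have "circles D I' = components r (arcs D)"
    using r by (simp add: circles_def components_def)
  also have "\<dots> = components (joined D I \<union> {(p, q), (q, p)}) (arcs D)" by (rule components_cong[OF eq])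
  also have "\<dots> = insert (circle_of D I p \<union> circle_of D I q) (circles D I - {circle_of D I p, circle_of D I q})"
    unfolding components_join[OF sym_joined_rtrancl pq(1,2)] circles_eq_components by (simp add: circle_of_def)
  finally have C: "circles D I'
    = insert (circle_of D I p \<union> circle_of D I q) (circles D I - {circle_of D I p, circle_of D I q})" .
  show "merges (circles D I) (circle_of D I p) (circle_of D I q) (circles D I')"
    unfolding merges_def
    by (intro conjI circle_of_in_circles pq(1,2) C) (use pq(3) circle_of_eq_iff in simp)
  have 1: "circle_of D I' p \<in> circles D I'" by (rule circle_of_in_circles[OF pq(1)])
  have 2: "circle_of D I p \<union> circle_of D I q \<in> circles D I'" unfolding C by (rule insertI1)
  show "circle_of D I' p = circle_of D I p \<union> circle_of D I q"
    by (rule disjoint_family_eq[OF disjoint_family_circles 1 2, of p]) (simp_all add: circle_of_mem)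
qed

text \<open>In the merge case \<open>surgery_toggles\<close> puts the two strands of the
  1-resolution on one circle. The joined relation of \<open>surgery_join\<close> is then the
  relation after the surgery, and it unites two classes of the relation before.\<close>

lemma merge_circles:
  assumes x: "x \<in> crossings D" "x \<notin> I" and m: "is_merge D I x"
  shows "merges (circles D I) (circle_of D I (arc_at D x UL)) (circle_of D I (arc_at D x LL))
      (circles D (insert x I))"
    and "circle_of D (insert x I) (arc_at D x UL)
      = circle_of D I (arc_at D x UL) \<union> circle_of D I (arc_at D x LL)"
proof -
  have n: "(arc_at D x UL, arc_at D x LL) \<notin> (joined D I)\<^sup>*"
    using m by (simp add: is_merge_def circle_of_eq_iff)
  have "(arc_at D x UL, arc_at D x UR) \<in> (joined D (insert x I))\<^sup>*"
    using m surgery_toggles[OF x] by (simp add: is_merge_def circle_of_eq_iff)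
  then have "(joined D (insert x I))\<^sup>*
      = (joined D I \<union> {(arc_at D x UL, arc_at D x LL), (arc_at D x LL, arc_at D x UL)})\<^sup>*"
    using surgery_join[OF x] components_absorb[OF sym_joined_rtrancl] by metis
  from join_circles[OF _ this _ _ n] arc_at_in_arcs[OF x(1)]
  show "merges (circles D I) (circle_of D I (arc_at D x UL)) (circle_of D I (arc_at D x LL))
      (circles D (insert x I))"
    "circle_of D (insert x I) (arc_at D x UL)
      = circle_of D I (arc_at D x UL) \<union> circle_of D I (arc_at D x LL)"
    by (simp_all add: circle_of_def)
qed

lemma split_circles:
  assumes x: "x \<in> crossings D" "x \<notin> I" and m: "\<not> is_merge D I x"
  shows "merges (circles D (insert x I)) (circle_of D (insert x I) (arc_at D x UL))
      (circle_of D (insert x I) (arc_at D x UR)) (circles D I)"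
    and "circle_of D I (arc_at D x UL)
      = circle_of D (insert x I) (arc_at D x UL) \<union> circle_of D (insert x I) (arc_at D x UR)"
proof -
  have n: "(arc_at D x UL, arc_at D x UR) \<notin> (joined D (insert x I))\<^sup>*"
    using m surgery_toggles[OF x] by (simp add: is_merge_def circle_of_eq_iff)
  have "(arc_at D x UL, arc_at D x LL) \<in> (joined D I)\<^sup>*"
    using m by (simp add: is_merge_def circle_of_eq_iff)
  then have "(joined D I)\<^sup>*
      = (joined D (insert x I) \<union> {(arc_at D x UL, arc_at D x UR), (arc_at D x UR, arc_at D x UL)})\<^sup>*"
    using surgery_join[OF x] components_absorb[OF sym_joined_rtrancl] by metis
  from join_circles[OF _ this _ _ n] arc_at_in_arcs[OF x(1)]
  show "merges (circles D (insert x I)) (circle_of D (insert x I) (arc_at D x UL))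
      (circle_of D (insert x I) (arc_at D x UR)) (circles D I)"
    "circle_of D I (arc_at D x UL)
      = circle_of D (insert x I) (arc_at D x UL) \<union> circle_of D (insert x I) (arc_at D x UR)"
    by (simp_all add: circle_of_def)
qed

lemma super_circle_of:
  assumes "finer (circles D I) (circles D J)" "a \<in> arcs D"
  shows "super (circles D J) (circle_of D I a) = circle_of D J a"
proof -
  note s = super_mem[OF disjoint_family_circles disjoint_family_circles assms(1) circle_of_in_circles[OF assms(2)]]
  then have "a \<in> super (circles D J) (circle_of D I a)" using circle_of_mem by blast
  then show ?thesis
    using disjoint_family_eq[OF disjoint_family_circles s(1) circle_of_in_circles[OF assms(2)]] circle_of_mem
    by blast
qed

end

section \<open>Edge maps of the odd cube as wedges and coarsenings\<close>

locale arrow_diagram = planar_diagram D for D :: "('x, 'a::linorder) diagram" +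
  fixes up :: "'x \<Rightarrow> bool"
begin

text \<open>The ends of the rotated arrow are named by arcs and not by circles, so that they make
  sense at every vertex of the cube.\<close>

definition arrow_tail :: "'x \<Rightarrow> 'a" where
  "arrow_tail x = arc_at D x (if up x then UR else UL)"

definition arrow_head :: "'x \<Rightarrow> 'a" where
  "arrow_head x = arc_at D x (if up x then UL else UR)"

abbreviation coarsen :: "'x set \<Rightarrow> ('a set set \<Rightarrow>\<^sub>0 int) \<Rightarrow> ('a set set \<Rightarrow>\<^sub>0 int)" where
  "coarsen J \<equiv> exterior_map (super (circles D J))"

text \<open>This is available at any vertex; it vanishes where both ends of the arrow lie on one
  circle.\<close>

abbreviation arrow_wedge :: "'x set \<Rightarrow> 'x \<Rightarrow> ('a set set \<Rightarrow>\<^sub>0 int) \<Rightarrow> ('a set set \<Rightarrow>\<^sub>0 int)" where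
  "arrow_wedge J x \<equiv> diff_wedge (circle_of D J (arrow_tail x)) (circle_of D J (arrow_head x))"

lemma odd_split_circles_eq:
  "odd_split_circles D up I x
    = (circle_of D (insert x I) (arrow_tail x), circle_of D (insert x I) (arrow_head x))"
  by (simp add: odd_split_circles_def arrow_tail_def arrow_head_def Let_def)

lemma arrow_in_arcs: "x \<in> crossings D \<Longrightarrow> arrow_tail x \<in> arcs D" "x \<in> crossings D \<Longrightarrow> arrow_head x \<in> arcs D"
  by (simp_all add: arrow_tail_def arrow_head_def arc_at_in_arcs)

lemma split_merges:
  assumes "x \<in> crossings D" "x \<notin> I" "\<not> is_merge D I x"
  shows "merges (circles D (insert x I)) (circle_of D (insert x I) (arrow_tail x))
      (circle_of D (insert x I) (arrow_head x)) (circles D I)"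
    and "circle_of D I (arc_at D x UL)
      = circle_of D (insert x I) (arrow_tail x) \<union> circle_of D (insert x I) (arrow_head x)"
  using split_circles[OF assms]
  by (simp_all add: arrow_tail_def arrow_head_def merges_commute[of _ "circle_of D (insert x I) (arc_at D x UR)"]
      Un_commute)

lemma merge_finer:
  assumes "x \<in> crossings D" "x \<notin> I"
  shows "is_merge D I x \<Longrightarrow> finer (circles D I) (circles D (insert x I))"
    and "\<not> is_merge D I x \<Longrightarrow> finer (circles D (insert x I)) (circles D I)"
    and "is_merge D I x \<Longrightarrow> card (circles D I) = Suc (card (circles D (insert x I)))"
    and "\<not> is_merge D I x \<Longrightarrow> card (circles D (insert x I)) = Suc (card (circles D I))"
  using merges_finer[OF disjoint_family_circles merge_circles(1)[OF assms]]
    merges_card[OF disjoint_family_circles merge_circles(1)[OF assms]]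
    merges_finer[OF disjoint_family_circles split_merges(1)[OF assms]]
    merges_card[OF disjoint_family_circles split_merges(1)[OF assms]] by simp_all

lemma odd_edge_map_merge:
  assumes "x \<in> crossings D" "x \<notin> I" "is_merge D I x" "v \<in> ext (circles D I)"
  shows "odd_edge_map D up I x v = coarsen (insert x I) v"
  using exterior_map_identify[OF disjoint_family_circles merge_circles(1)[OF assms(1-3)] assms(4)]
    assms(3) merge_circles(2)[OF assms(1-3)] by (simp add: odd_edge_map_def)

text \<open>The formula is stated on \<open>coarsen I w\<close> because every element at
  \<open>I\<close> has such a lift. A path through the cube can then be followed on a single lifted
  element.\<close>

lemma odd_edge_map_split:
  assumes "x \<in> crossings D" "x \<notin> I" "\<not> is_merge D I x" "w \<in> ext (circles D (insert x I))"
  shows "odd_edge_map D up I x (coarsen I w) = arrow_wedge (insert x I) x w"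
  using split_lift_value[OF disjoint_family_circles split_merges(1)[OF assms(1-3)] assms(4)]
    assms(3) split_merges(2)[OF assms(1-3)] by (simp add: odd_edge_map_def odd_split_circles_eq)

lemma split_lift_exists:
  assumes "x \<in> crossings D" "x \<notin> I" "\<not> is_merge D I x" "v \<in> ext (circles D I)"
  obtains w where "w \<in> ext (circles D (insert x I))" "coarsen I w = v"
  using split_section(4,5)[OF disjoint_family_circles split_merges(1)[OF assms(1-3)] assms(4)] by (rule that)

lemma coarsen_ext:
  "finer (circles D I) (circles D J) \<Longrightarrow> w \<in> ext (circles D I) \<Longrightarrow> coarsen J w \<in> ext (circles D J)"
  by (rule exterior_map_super_ext[OF disjoint_family_circles disjoint_family_circles])

lemma coarsen_coarsen:
  "finer (circles D I) (circles D J) \<Longrightarrow> finer (circles D J) (circles D K) \<Longrightarrow> w \<in> ext (circles D I) \<Longrightarrow>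
    coarsen K (coarsen J w) = coarsen K w"
  by (rule exterior_map_super_super[OF disjoint_family_circles disjoint_family_circles disjoint_family_circles])

lemma coarsen_arrow_wedge:
  assumes "finer (circles D I) (circles D J)" "x \<in> crossings D" "w \<in> ext (circles D I)"
  shows "coarsen J (arrow_wedge I x w) = arrow_wedge J x (coarsen J w)"
  using exterior_map_super_diff_wedge[OF disjoint_family_circles disjoint_family_circles assms(1)
      circle_of_in_circles circle_of_in_circles assms(3)] arrow_in_arcs[OF assms(2)]
  by (simp add: super_circle_of[OF assms(1)])

lemma arrow_wedge_ext:
  "x \<in> crossings D \<Longrightarrow> w \<in> ext (circles D J) \<Longrightarrow> arrow_wedge J x w \<in> ext (circles D J)"
  by (rule diff_wedge_ext) (simp_all add: circle_of_in_circles arrow_in_arcs)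

lemma odd_edge_map_ext:
  assumes x: "x \<in> crossings D" "x \<notin> I" and v: "v \<in> ext (circles D I)"
  shows "odd_edge_map D up I x v \<in> ext (circles D (insert x I))"
proof (cases "is_merge D I x")
  case True
  then show ?thesis
    using odd_edge_map_merge[OF x True v] coarsen_ext[OF merge_finer(1)[OF x True] v] by simp
next
  case False
  obtain w where w: "w \<in> ext (circles D (insert x I))" "coarsen I w = v"
    using split_lift_exists[OF x False v] by blast
  then show ?thesis
    using odd_edge_map_split[OF x False w(1)] arrow_wedge_ext[OF x(1) w(1)] by simp
qed

lemma odd_edge_map_diff:
  assumes x: "x \<in> crossings D" "x \<notin> I" and u: "u \<in> ext (circles D I)" and v: "v \<in> ext (circles D I)"
  shows "odd_edge_map D up I x (u - v) = odd_edge_map D up I x u - odd_edge_map D up I x v"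
proof (cases "is_merge D I x")
  case True
  then show ?thesis
    using odd_edge_map_merge[OF x True] u v ext_diff[OF u v] by (simp add: exterior_map_diff)
next
  case False
  obtain w where w: "w \<in> ext (circles D (insert x I))" "coarsen I w = u"
    using split_lift_exists[OF x False u] by blast
  obtain z where z: "z \<in> ext (circles D (insert x I))" "coarsen I z = v"
    using split_lift_exists[OF x False v] by blast
  have "u - v = coarsen I (w - z)" using w z by (simp add: exterior_map_diff)
  then show ?thesis
    using odd_edge_map_split[OF x False ext_diff[OF w(1) z(1)]] odd_edge_map_split[OF x False w(1)]
      odd_edge_map_split[OF x False z(1)] w(2) z(2) by (simp add: diff_wedge_diff)
qed

section \<open>The two paths around a square\<close>

context
  fixes I x y
  assumes xy: "x \<in> crossings D" "x \<notin> I" "y \<in> crossings D" "y \<notin> I" "x \<noteq> y"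
begin

lemma y_notin: "y \<notin> insert x I"
  using xy by simp

lemma path_merge_merge:
  assumes m: "is_merge D I x" "is_merge D (insert x I) y" and v: "v \<in> ext (circles D I)"
  shows "odd_edge_map D up (insert x I) y (odd_edge_map D up I x v) = coarsen (insert y (insert x I)) v"
proof -
  note f = merge_finer(1)[OF xy(1,2) m(1)] merge_finer(1)[OF xy(3) y_notin m(2)]
  show ?thesis
    unfolding odd_edge_map_merge[OF xy(1,2) m(1) v]
      odd_edge_map_merge[OF xy(3) y_notin m(2) coarsen_ext[OF f(1) v]]
    by (rule coarsen_coarsen[OF f v])
qed

text \<open>One lift \<open>w\<close> to the far vertex serves both splits, because wedging at the
  far vertex commutes with coarsening to the middle one.\<close>

lemma path_split_split:
  assumes m: "\<not> is_merge D I x" "\<not> is_merge D (insert x I) y"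
    and w: "w \<in> ext (circles D (insert y (insert x I)))"
  shows "odd_edge_map D up (insert x I) y (odd_edge_map D up I x (coarsen I w))
    = arrow_wedge (insert y (insert x I)) y (arrow_wedge (insert y (insert x I)) x w)"
proof -
  note f = merge_finer(2)[OF xy(1,2) m(1)] merge_finer(2)[OF xy(3) y_notin m(2)]
  have "odd_edge_map D up I x (coarsen I w) = odd_edge_map D up I x (coarsen I (coarsen (insert x I) w))"
    by (simp only: coarsen_coarsen[OF f(2,1) w])
  also have "\<dots> = arrow_wedge (insert x I) x (coarsen (insert x I) w)"
    by (rule odd_edge_map_split[OF xy(1,2) m(1) coarsen_ext[OF f(2) w]])
  also have "\<dots> = coarsen (insert x I) (arrow_wedge (insert y (insert x I)) x w)"
    by (rule coarsen_arrow_wedge[OF f(2) xy(1) w, symmetric])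
  finally show ?thesis
    using odd_edge_map_split[OF xy(3) y_notin m(2) arrow_wedge_ext[OF xy(1) w]] by simp
qed

lemma path_merge_split:
  assumes m: "is_merge D I x" "\<not> is_merge D (insert x I) y"
    and v: "v \<in> ext (circles D I)" and w: "w \<in> ext (circles D (insert y (insert x I)))"
    and vw: "coarsen (insert x I) v = coarsen (insert x I) w"
  shows "odd_edge_map D up (insert x I) y (odd_edge_map D up I x v)
    = arrow_wedge (insert y (insert x I)) y w"
  unfolding odd_edge_map_merge[OF xy(1,2) m(1) v] vw
  by (rule odd_edge_map_split[OF xy(3) y_notin m(2) w])

lemma path_split_merge:
  assumes m: "\<not> is_merge D I x" "is_merge D (insert x I) y"
    and w: "w \<in> ext (circles D (insert x I))"
  shows "odd_edge_map D up (insert x I) y (odd_edge_map D up I x (coarsen I w))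
    = arrow_wedge (insert y (insert x I)) x (coarsen (insert y (insert x I)) w)"
proof -
  note f = merge_finer(1)[OF xy(3) y_notin m(2)]
  show ?thesis
    unfolding odd_edge_map_split[OF xy(1,2) m(1) w]
      odd_edge_map_merge[OF xy(3) y_notin m(2) arrow_wedge_ext[OF xy(1) w]]
    by (rule coarsen_arrow_wedge[OF f xy(1) w])
qed

text \<open>Here \<open>y\<close> joins the two circles that \<open>x\<close> separates: the arcs interleave on one circle.\<close>

lemma split_merge_vanishes:
  assumes m: "\<not> is_merge D I x" "is_merge D (insert x I) y" "\<not> is_merge D I y"
    and v: "v \<in> ext (circles D I)"
  shows "odd_edge_map D up (insert x I) y (odd_edge_map D up I x v) = 0"
proof -
  let ?K = "insert y (insert x I)"
  let ?ul = "circle_of D (insert x I) (arc_at D y UL)" and ?ll = "circle_of D (insert x I) (arc_at D y LL)"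
  let ?t = "circle_of D (insert x I) (arrow_tail x)" and ?h = "circle_of D (insert x I) (arrow_head x)"
  note arcs = arc_at_in_arcs[OF xy(3)] arrow_in_arcs[OF xy(1)]
  note f = merge_finer(2)[OF xy(1,2) m(1)] and g = merge_finer(1)[OF xy(3) y_notin m(2)]
  note s = split_merges(1)[OF xy(1,2) m(1)] and mg = merge_circles(1)[OF xy(3) y_notin m(2)]
  have "?ul \<noteq> ?ll" using m(2) by (simp add: is_merge_def)
  moreover have "super (circles D I) ?ul = super (circles D I) ?ll"
    using super_circle_of[OF f arcs(1)] m(3) by (simp add: is_merge_def)
  ultimately have eq: "{?ul, ?ll} = {?t, ?h}"
    using merges_super_eq[OF disjoint_family_circles s] circle_of_in_circles arcs(1) by simp
  have "super (circles D ?K) ?ul = super (circles D ?K) ?ll"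
    using merges_super[OF disjoint_family_circles mg] circle_of_in_circles arcs(1) by simp
  then have "super (circles D ?K) ?t = super (circles D ?K) ?h" using eq by (metis doubleton_eq_iff)
  then have th: "circle_of D ?K (arrow_tail x) = circle_of D ?K (arrow_head x)"
    using super_circle_of[OF g] arcs(2,3) by simp
  obtain w where w: "w \<in> ext (circles D (insert x I))" "coarsen I w = v"
    using split_lift_exists[OF xy(1,2) m(1) v] by blast
  show ?thesis using path_split_merge[OF m(1,2) w(1)] w(2) th by simp
qed

text \<open>The surgery at \<open>y\<close> splits after the merge at \<open>x\<close>, so that
  merge has put both strands at \<open>y\<close> on one circle. As they were on different circles
  before, \<open>x\<close> and \<open>y\<close> join the same two circles.\<close>

lemma merge_split_same:
  assumes m: "is_merge D I x" "\<not> is_merge D (insert x I) y" "is_merge D I y"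
  shows "circles D (insert y I) = circles D (insert x I)"
proof -
  let ?ul = "circle_of D I (arc_at D y UL)" and ?ll = "circle_of D I (arc_at D y LL)"
  note f = merge_finer(1)[OF xy(1,2) m(1)]
  note arcs = arc_at_in_arcs[OF xy(3)]
  note mx = merge_circles(1)[OF xy(1,2) m(1)] and my = merge_circles(1)[OF xy(3,4) m(3)]
  have "?ul \<noteq> ?ll" using m(3) by (simp add: is_merge_def)
  moreover have "super (circles D (insert x I)) ?ul = super (circles D (insert x I)) ?ll"
    using super_circle_of[OF f arcs] m(2) by (simp add: is_merge_def)
  ultimately have eq: "{?ul, ?ll} = {circle_of D I (arc_at D x UL), circle_of D I (arc_at D x LL)}"
    using merges_super_eq[OF disjoint_family_circles mx] circle_of_in_circles arcs by simp
  have "circles D (insert y I) = insert (\<Union>{?ul, ?ll}) (circles D I - {?ul, ?ll})"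
    using my by (simp add: merges_def)
  also have "\<dots> = circles D (insert x I)"
    unfolding eq using mx by (simp add: merges_def)
  finally show ?thesis .
qed

end

lemma diff_wedge_doubleton:
  assumes "{a, b} = {c, d}"
  shows "(\<forall>w. diff_wedge a b w = diff_wedge c d w) \<or> (\<forall>w. diff_wedge a b w = - diff_wedge c d w)"
  using assms diff_wedge_commute by (metis doubleton_eq_iff)

text \<open>Six patterns of merges and splits are possible. Two merges commute, and so do a merge
  and a split that exchange their order; two splits anticommute as wedges do. If both arcs join the
  same two circles, both paths end by a split into the same pair and the directions of the arrows
  decide the sign. Interleaved arcs give zero.\<close>

proposition odd_square_commutes:
  assumes xy: "x \<in> crossings D" "x \<notin> I" "y \<in> crossings D" "y \<notin> I" "x \<noteq> y"
  defines "f \<equiv> \<lambda>v. odd_edge_map D up (insert x I) y (odd_edge_map D up I x v)"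
    and "g \<equiv> \<lambda>v. odd_edge_map D up (insert y I) x (odd_edge_map D up I y v)"
  shows "(\<forall>v\<in>ext (circles D I). f v = g v) \<or> (\<forall>v\<in>ext (circles D I). f v = - g v)"
proof -
  have yx: "y \<in> crossings D" "y \<notin> I" "x \<in> crossings D" "x \<notin> I" "y \<noteq> x" using xy by simp_all
  have ic: "insert y (insert x I) = insert x (insert y I)" by (rule insert_commute)
  have xn: "x \<notin> insert y I" and yn: "y \<notin> insert x I" using xy by auto
  have count: "int (card (circles D (insert z J))) = int (card (circles D J)) + (if is_merge D J z then -1 else 1)"
    if "z \<in> crossings D" "z \<notin> J" for z J
    using merge_finer(3,4)[OF that] by simp
  \<comment> \<open>Each merge lowers and each split raises the number of circles by one, and both
    paths end at the same vertex.\<close>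
  have cc: "(if is_merge D I x then -1 else 1) + (if is_merge D (insert x I) y then -1 else (1::int))
      = (if is_merge D I y then -1 else 1) + (if is_merge D (insert y I) x then -1 else 1)"
    using count[OF xy(1,2)] count[OF xy(3) yn] count[OF yx(1,2)] count[OF xy(1) xn] ic by simp
  have mixed: "\<forall>v\<in>ext (circles D I). odd_edge_map D up (insert p I) q (odd_edge_map D up I p v)
      = odd_edge_map D up (insert q I) p (odd_edge_map D up I q v)"
    if pq: "p \<in> crossings D" "p \<notin> I" "q \<in> crossings D" "q \<notin> I" "p \<noteq> q"
      and m: "is_merge D I p" "\<not> is_merge D (insert p I) q" "\<not> is_merge D I q" "is_merge D (insert q I) p"
    for p q
  proof
    fix v assume v: "v \<in> ext (circles D I)"
    have qp: "q \<noteq> p" and qn: "q \<notin> insert p I" and pn: "p \<notin> insert q I" using pq by auto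
    have icq: "insert q (insert p I) = insert p (insert q I)" by (rule insert_commute)
    obtain w where w: "w \<in> ext (circles D (insert q I))" "coarsen I w = v"
      using split_lift_exists[OF pq(3,4) m(3) v] by blast
    have f0: "finer (circles D I) (circles D (insert p I))" by (rule merge_finer(1)[OF pq(1,2) m(1)])
    have f1: "finer (circles D (insert q I)) (circles D I)" by (rule merge_finer(2)[OF pq(3,4) m(3)])
    have f2: "finer (circles D (insert q I)) (circles D (insert q (insert p I)))"
      using merge_finer(1)[OF pq(1) pn m(4)] icq by simp
    have f3: "finer (circles D (insert q (insert p I))) (circles D (insert p I))"
      by (rule merge_finer(2)[OF pq(3) qn m(2)])
    have "coarsen (insert p I) v = coarsen (insert p I) (coarsen (insert q (insert p I)) w)"
      using coarsen_coarsen[OF f1 f0 w(1)] coarsen_coarsen[OF f2 f3 w(1)] w(2) by simp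
    from path_merge_split[OF pq m(1,2) v coarsen_ext[OF f2 w(1)] this]
    show "odd_edge_map D up (insert p I) q (odd_edge_map D up I p v)
      = odd_edge_map D up (insert q I) p (odd_edge_map D up I q v)"
      using path_split_merge[OF pq(3,4,1,2) qp m(3,4) w(1)] w(2) icq by simp
  qed
  consider (mm) "is_merge D I x" "is_merge D (insert x I) y" "is_merge D I y" "is_merge D (insert y I) x"
    | (ss) "\<not> is_merge D I x" "\<not> is_merge D (insert x I) y" "\<not> is_merge D I y" "\<not> is_merge D (insert y I) x"
    | (ms_sm) "is_merge D I x" "\<not> is_merge D (insert x I) y" "\<not> is_merge D I y" "is_merge D (insert y I) x"
    | (sm_ms) "\<not> is_merge D I x" "is_merge D (insert x I) y" "is_merge D I y" "\<not> is_merge D (insert y I) x"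
    | (ms_ms) "is_merge D I x" "\<not> is_merge D (insert x I) y" "is_merge D I y" "\<not> is_merge D (insert y I) x"
    | (sm_sm) "\<not> is_merge D I x" "is_merge D (insert x I) y" "\<not> is_merge D I y" "is_merge D (insert y I) x"
    using cc by (cases "is_merge D I x"; cases "is_merge D (insert x I) y";
        cases "is_merge D I y"; cases "is_merge D (insert y I) x") simp_all
  then show ?thesis
  proof cases
    case mm
    have "f v = g v" if "v \<in> ext (circles D I)" for v
      unfolding f_def g_def path_merge_merge[OF xy mm(1,2) that] path_merge_merge[OF yx mm(3,4) that] ic ..
    then show ?thesis by simp
  next
    case ss
    have "f v = - g v" if v: "v \<in> ext (circles D I)" for v
    proof -
      obtain u where u: "u \<in> ext (circles D (insert x I))" "coarsen I u = v"
        using split_lift_exists[OF xy(1,2) ss(1) v] by blast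
      obtain w where w: "w \<in> ext (circles D (insert y (insert x I)))" "coarsen (insert x I) w = u"
        using split_lift_exists[OF xy(3) yn ss(2) u(1)] by blast
      have v: "v = coarsen I w"
        using coarsen_coarsen[OF merge_finer(2)[OF xy(3) yn ss(2)] merge_finer(2)[OF xy(1,2) ss(1)] w(1)] w(2) u(2)
        by simp
      have w': "w \<in> ext (circles D (insert x (insert y I)))" using w(1) ic by simp
      show ?thesis
        unfolding f_def g_def v path_split_split[OF xy ss(1,2) w(1)] path_split_split[OF yx ss(3,4) w'] ic
        by (rule diff_wedge_swap[OF disjoint_family_wedge_base[OF disjoint_family_circles] _ _ _ _ w'])
          (simp_all add: circle_of_in_circles arrow_in_arcs xy)
    qed
    then show ?thesis by simp
  next
    case ms_sm
    show ?thesis using mixed[OF xy ms_sm] unfolding f_def g_def by (rule disjI1)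
  next
    case sm_ms
    show ?thesis using mixed[OF yx sm_ms(3,4,1,2)] unfolding f_def g_def by simp
  next
    case ms_ms
    let ?K = "insert y (insert x I)"
    have same: "circles D (insert y I) = circles D (insert x I)"
      by (rule merge_split_same[OF xy ms_ms(1,2,3)])
    \<comment> \<open>The two pieces are the circles at the far vertex that are absent in the
      middle. The middle families agree, so both paths wedge with the same difference up to
      sign.\<close>
    have d1: "{circle_of D ?K (arrow_tail y), circle_of D ?K (arrow_head y)} = circles D ?K - circles D (insert x I)"
      using merges_diff[OF disjoint_family_circles split_merges(1)[OF xy(3) yn ms_ms(2)]] by simp
    have d2: "{circle_of D ?K (arrow_tail x), circle_of D ?K (arrow_head x)} = circles D ?K - circles D (insert x I)"
      using merges_diff[OF disjoint_family_circles split_merges(1)[OF xy(1) xn ms_ms(4)]] same ic by simp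
    have fg: "\<exists>w. f v = arrow_wedge ?K y w \<and> g v = arrow_wedge ?K x w" if v: "v \<in> ext (circles D I)" for v
    proof -
      obtain w where w: "w \<in> ext (circles D ?K)" "coarsen (insert x I) w = coarsen (insert x I) v"
        using split_lift_exists[OF xy(3) yn ms_ms(2) coarsen_ext[OF merge_finer(1)[OF xy(1,2) ms_ms(1)] v]]
        by blast
      have "f v = arrow_wedge ?K y w"
        unfolding f_def by (rule path_merge_split[OF xy ms_ms(1,2) v w(1) w(2)[symmetric]])
      moreover have "g v = arrow_wedge (insert x (insert y I)) x w"
        unfolding g_def
        by (rule path_merge_split[OF yx ms_ms(3,4) v])
          (use w same ic in simp_all)
      ultimately show ?thesis unfolding ic by blast
    qed
    show ?thesis
      using diff_wedge_doubleton[OF d1[folded d2]] fg by metis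
  next
    case sm_sm
    have "f v = 0 \<and> g v = 0" if "v \<in> ext (circles D I)" for v
      unfolding f_def g_def
      using split_merge_vanishes[OF xy sm_sm(1,2,3) that] split_merge_vanishes[OF yx sm_sm(3,4,1) that] by simp
    then show ?thesis by simp
  qed
qed

end

section \<open>Elementary abelian 2-groups\<close>

definition elementary_2_group :: "('g, 'm) monoid_scheme \<Rightarrow> bool" where
  "elementary_2_group G \<longleftrightarrow> comm_group G \<and> (\<forall>x\<in>carrier G. x \<otimes>\<^bsub>G\<^esub> x = \<one>\<^bsub>G\<^esub>)"

text \<open>In an elementary 2-group elements are their own inverses, so a subset that contains the
  unit and is closed under products is a subgroup.\<close>

definition partial_iso :: "('g, 'm) monoid_scheme \<Rightarrow> ('h, 'n) monoid_scheme \<Rightarrow> 'g set \<Rightarrow> ('g \<Rightarrow> 'h) \<Rightarrow> bool" where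
  "partial_iso G H K f \<longleftrightarrow> K \<subseteq> carrier G \<and> \<one>\<^bsub>G\<^esub> \<in> K \<and> (\<forall>a\<in>K. \<forall>b\<in>K. a \<otimes>\<^bsub>G\<^esub> b \<in> K) \<and>
     f ` K \<subseteq> carrier H \<and> inj_on f K \<and> (\<forall>a\<in>K. \<forall>b\<in>K. f (a \<otimes>\<^bsub>G\<^esub> b) = f a \<otimes>\<^bsub>H\<^esub> f b)"

text \<open>One step in extending a basis over the field with two elements: \<open>x\<close> is sent
  to \<open>y\<close>, and the coset of \<open>x\<close> follows.\<close>

lemma partial_iso_extend:
  assumes G: "elementary_2_group G" and H: "elementary_2_group H" and f: "partial_iso G H K f"
    and x: "x \<in> carrier G" "x \<notin> K" and y: "y \<in> carrier H" "y \<notin> f ` K"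
  shows "\<exists>K' f'. partial_iso G H K' f' \<and> K \<subset> K'"
proof -
  interpret G: comm_group G using G by (simp add: elementary_2_group_def)
  interpret H: comm_group H using H by (simp add: elementary_2_group_def)
  have sqG: "a \<otimes>\<^bsub>G\<^esub> a = \<one>\<^bsub>G\<^esub>" if "a \<in> carrier G" for a using G that by (simp add: elementary_2_group_def)
  have sqH: "a \<otimes>\<^bsub>H\<^esub> a = \<one>\<^bsub>H\<^esub>" if "a \<in> carrier H" for a using H that by (simp add: elementary_2_group_def)
  have sqG2: "a \<otimes>\<^bsub>G\<^esub> (a \<otimes>\<^bsub>G\<^esub> b) = b" if "a \<in> carrier G" "b \<in> carrier G" for a b
    using that sqG by (simp flip: G.m_assoc)
  have sqH2: "a \<otimes>\<^bsub>H\<^esub> (a \<otimes>\<^bsub>H\<^esub> b) = b" if "a \<in> carrier H" "b \<in> carrier H" for a b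
    using that sqH by (simp flip: H.m_assoc)
  have KG: "a \<in> carrier G" if "a \<in> K" for a using f that by (auto simp: partial_iso_def)
  have one: "\<one>\<^bsub>G\<^esub> \<in> K" and inj: "inj_on f K" using f by (simp_all add: partial_iso_def)
  have mK: "a \<otimes>\<^bsub>G\<^esub> b \<in> K" if "a \<in> K" "b \<in> K" for a b using f that by (simp add: partial_iso_def)
  have fH: "f a \<in> carrier H" if "a \<in> K" for a using f that by (auto simp: partial_iso_def)
  have fm: "f (a \<otimes>\<^bsub>G\<^esub> b) = f a \<otimes>\<^bsub>H\<^esub> f b" if "a \<in> K" "b \<in> K" for a b
    using f that by (simp add: partial_iso_def)
  \<comment> \<open>Since \<open>x\<close> is its own inverse, this is the coset of \<open>K\<close>
    through \<open>x\<close>.\<close>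
  define L where "L = {z \<in> carrier G. z \<otimes>\<^bsub>G\<^esub> x \<in> K}"
  define f' where "f' = (\<lambda>z. if z \<in> K then f z else f (z \<otimes>\<^bsub>G\<^esub> x) \<otimes>\<^bsub>H\<^esub> y)"
  have LG: "z \<in> carrier G" "z \<otimes>\<^bsub>G\<^esub> x \<in> K" if "z \<in> L" for z using that by (simp_all add: L_def)
  have disj: "z \<notin> K" if "z \<in> L" for z
  proof
    assume "z \<in> K"
    then have "z \<otimes>\<^bsub>G\<^esub> (z \<otimes>\<^bsub>G\<^esub> x) \<in> K" using mK LG that by blast
    then show False using sqG2[OF LG(1)[OF that] x(1)] x(2) by simp
  qed
  have KL: "a \<otimes>\<^bsub>G\<^esub> b \<in> L" "a \<otimes>\<^bsub>G\<^esub> b \<otimes>\<^bsub>G\<^esub> x = a \<otimes>\<^bsub>G\<^esub> (b \<otimes>\<^bsub>G\<^esub> x)" if "a \<in> K" "b \<in> L" for a b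
  proof -
    show eq: "a \<otimes>\<^bsub>G\<^esub> b \<otimes>\<^bsub>G\<^esub> x = a \<otimes>\<^bsub>G\<^esub> (b \<otimes>\<^bsub>G\<^esub> x)"
      using KG[OF that(1)] LG(1)[OF that(2)] x(1) by (simp add: G.m_assoc)
    show "a \<otimes>\<^bsub>G\<^esub> b \<in> L"
      using KG[OF that(1)] LG[OF that(2)] mK[OF that(1)] eq by (simp add: L_def)
  qed
  have LL: "a \<otimes>\<^bsub>G\<^esub> b = (a \<otimes>\<^bsub>G\<^esub> x) \<otimes>\<^bsub>G\<^esub> (b \<otimes>\<^bsub>G\<^esub> x)" if "a \<in> L" "b \<in> L" for a b
    using LG(1)[OF that(1)] LG(1)[OF that(2)] x(1) sqG2[OF x(1)] by (simp add: G.m_ac)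
  have LLK: "a \<otimes>\<^bsub>G\<^esub> b \<in> K" if "a \<in> L" "b \<in> L" for a b
    using LL[OF that] mK LG(2)[OF that(1)] LG(2)[OF that(2)] by simp
  have fK: "f' z = f z" if "z \<in> K" for z using that by (simp add: f'_def)
  have fL: "f' z = f (z \<otimes>\<^bsub>G\<^esub> x) \<otimes>\<^bsub>H\<^esub> y" if "z \<in> L" for z using disj[OF that] by (simp add: f'_def)
  have KL_ne: "f' a \<noteq> f' b" if "a \<in> K" "b \<in> L" for a b
  proof
    assume eq: "f' a = f' b"
    have "f (b \<otimes>\<^bsub>G\<^esub> x \<otimes>\<^bsub>G\<^esub> a) = f (b \<otimes>\<^bsub>G\<^esub> x) \<otimes>\<^bsub>H\<^esub> (f (b \<otimes>\<^bsub>G\<^esub> x) \<otimes>\<^bsub>H\<^esub> y)"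
      using fm[OF LG(2)[OF that(2)] that(1)] eq fK[OF that(1)] fL[OF that(2)] by simp
    also have "\<dots> = y" by (rule sqH2[OF fH[OF LG(2)[OF that(2)]] y(1)])
    finally have "y \<in> f ` K" using mK[OF LG(2)[OF that(2)] that(1)] by (metis image_eqI)
    with y(2) show False by simp
  qed
  have "partial_iso G H (K \<union> L) f'"
    unfolding partial_iso_def
  proof (intro conjI ballI)
    show "K \<union> L \<subseteq> carrier G" using KG LG(1) by blast
    show "\<one>\<^bsub>G\<^esub> \<in> K \<union> L" using one by simp
    show "f' ` (K \<union> L) \<subseteq> carrier H"
      using fK fL fH LG(2) y(1) by (auto simp del: f'_def)
    show "inj_on f' (K \<union> L)"
    proof (rule inj_onI)
      fix a b assume ab: "a \<in> K \<union> L" "b \<in> K \<union> L" "f' a = f' b"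
      have "a \<in> K \<and> b \<in> K \<or> a \<in> L \<and> b \<in> L" using ab KL_ne by (metis Un_iff)
      then show "a = b"
      proof
        assume "a \<in> K \<and> b \<in> K"
        then show ?thesis using ab(3) fK inj by (simp add: inj_on_def)
      next
        assume L: "a \<in> L \<and> b \<in> L"
        then have "f (a \<otimes>\<^bsub>G\<^esub> x) = f (b \<otimes>\<^bsub>G\<^esub> x)"
          using ab(3) fL fH LG(2) y(1) H.right_cancel by metis
        then have "a \<otimes>\<^bsub>G\<^esub> x = b \<otimes>\<^bsub>G\<^esub> x" using inj L LG(2) by (metis inj_onD)
        then show ?thesis using L LG(1) x(1) G.right_cancel by metis
      qed
    qed
    fix a b assume a: "a \<in> K \<union> L" and b: "b \<in> K \<union> L"
    have comm: "u \<otimes>\<^bsub>G\<^esub> v = v \<otimes>\<^bsub>G\<^esub> u" if "u \<in> K" "v \<in> L" for u v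
      using KG[OF that(1)] LG(1)[OF that(2)] by (rule G.m_comm)
    have mixed: "f' (u \<otimes>\<^bsub>G\<^esub> v) = f' u \<otimes>\<^bsub>H\<^esub> f' v" if "u \<in> K" "v \<in> L" for u v
      using fL[OF KL(1)[OF that]] KL(2)[OF that] fm[OF that(1) LG(2)[OF that(2)]] fK[OF that(1)]
        fL[OF that(2)] fH[OF that(1)] fH[OF LG(2)[OF that(2)]] y(1) by (simp add: H.m_assoc)
    have fH': "f' u \<in> carrier H" if "u \<in> K \<union> L" for u
      using that fK fL fH LG(2) y(1) by (metis H.m_closed Un_iff)
    consider "a \<in> K" "b \<in> K" | "a \<in> K" "b \<in> L" | "a \<in> L" "b \<in> K" | "a \<in> L" "b \<in> L"
      using a b by blast
    then have "a \<otimes>\<^bsub>G\<^esub> b \<in> K \<union> L \<and> f' (a \<otimes>\<^bsub>G\<^esub> b) = f' a \<otimes>\<^bsub>H\<^esub> f' b"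
    proof cases
      case 1
      then show ?thesis using mK fm fK by simp
    next
      case 2
      then show ?thesis using KL mixed by simp
    next
      case 3
      then show ?thesis
        using KL(1)[OF 3(2,1)] mixed[OF 3(2,1)] comm[OF 3(2,1)] H.m_comm[OF fH'[OF a] fH'[OF b]] by simp
    next
      case 4
      let ?u = "f (a \<otimes>\<^bsub>G\<^esub> x)" and ?v = "f (b \<otimes>\<^bsub>G\<^esub> x)"
      have uv: "?u \<in> carrier H" "?v \<in> carrier H" using fH LG(2) 4 by simp_all
      have "f' (a \<otimes>\<^bsub>G\<^esub> b) = ?u \<otimes>\<^bsub>H\<^esub> ?v"
        using fK[OF LLK[OF 4]] LL[OF 4] fm[OF LG(2)[OF 4(1)] LG(2)[OF 4(2)]] by simp
      also have "\<dots> = (?u \<otimes>\<^bsub>H\<^esub> y) \<otimes>\<^bsub>H\<^esub> (?v \<otimes>\<^bsub>H\<^esub> y)"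
        using uv y(1) sqH2[OF y(1), of "?u \<otimes>\<^bsub>H\<^esub> ?v"] by (simp add: H.m_ac)
      finally show ?thesis using LLK[OF 4] fL 4 by simp
    qed
    then show "a \<otimes>\<^bsub>G\<^esub> b \<in> K \<union> L" "f' (a \<otimes>\<^bsub>G\<^esub> b) = f' a \<otimes>\<^bsub>H\<^esub> f' b" by simp_all
  qed
  moreover have "x \<in> L" using x(1) sqG one by (simp add: L_def)
  then have "K \<subset> K \<union> L" using x(2) by blast
  ultimately show ?thesis by blast
qed

text \<open>A maximal partial isomorphism is total: if its domain were proper, equal cardinality
  would leave an element of \<open>H\<close> outside the image, and the map could be
  extended.\<close>

proposition elementary_2_group_iso:
  assumes G: "elementary_2_group G" and H: "elementary_2_group H"
    and card: "card (carrier G) = card (carrier H)" and fin: "finite (carrier G)" "finite (carrier H)"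
  shows "G \<cong> H"
proof -
  interpret G: comm_group G using G by (simp add: elementary_2_group_def)
  interpret H: comm_group H using H by (simp add: elementary_2_group_def)
  let ?A = "{K. \<exists>f. partial_iso G H K f}"
  have "?A \<subseteq> Pow (carrier G)" by (auto simp: partial_iso_def)
  then have "finite ?A" using fin(1) finite_subset by blast
  moreover have "partial_iso G H {\<one>\<^bsub>G\<^esub>} (\<lambda>_. \<one>\<^bsub>H\<^esub>)" by (simp add: partial_iso_def)
  then have "?A \<noteq> {}" by blast
  ultimately obtain K where K: "K \<in> ?A" "\<And>K'. K' \<in> ?A \<Longrightarrow> K \<subseteq> K' \<Longrightarrow> K = K'"
    using finite_has_maximal[of ?A] by blast
  obtain f where f: "partial_iso G H K f" using K(1) by blast
  have KG: "K \<subseteq> carrier G" and fH: "f ` K \<subseteq> carrier H" and inj: "inj_on f K"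
    using f by (simp_all add: partial_iso_def)
  have "K = carrier G"
  proof (rule ccontr)
    assume "K \<noteq> carrier G"
    then have "K \<subset> carrier G" using KG by blast
    then have "card (f ` K) < card (carrier H)"
      using card card_image[OF inj] psubset_card_mono[OF fin(1)] by simp
    then have "f ` K \<noteq> carrier H" by auto
    then obtain x y where "x \<in> carrier G" "x \<notin> K" "y \<in> carrier H" "y \<notin> f ` K"
      using \<open>K \<subset> carrier G\<close> fH by blast
    from partial_iso_extend[OF G H f this] K(2) show False by blast
  qed
  moreover from this have "f ` carrier G = carrier H"
    using fH inj card card_image[OF inj] fin(2) by (simp add: card_subset_eq)
  ultimately have "f \<in> iso G H"
    using f inj by (auto simp: iso_def hom_def bij_betw_def partial_iso_def)
  then show ?thesis by (auto simp: is_iso_def)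
qed

lemma elementary_2_group_DirProd:
  assumes "elementary_2_group G" "elementary_2_group H"
  shows "elementary_2_group (G \<times>\<times> H)"
proof -
  interpret G: comm_group G using assms by (simp add: elementary_2_group_def)
  interpret H: comm_group H using assms by (simp add: elementary_2_group_def)
  have "comm_group (G \<times>\<times> H)"
    by (rule group.group_comm_groupI[OF DirProd_group[OF G.is_group H.is_group]])
      (auto simp: DirProd_def G.m_comm H.m_comm)
  then show ?thesis using assms by (auto simp: elementary_2_group_def DirProd_def)
qed

section \<open>Tensor and torsion products with \<open>\<int>/2\<close>\<close>

text \<open>Multiplication in \<open>free_Abelian_group\<close> is literally addition of functions,
  so its subgroups and cosets can be handled in the additive type class, independently of the basis
  set.\<close>

definition add_subgroup :: "'b::ab_group_add set \<Rightarrow> bool" where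
  "add_subgroup T \<longleftrightarrow> 0 \<in> T \<and> (\<forall>a\<in>T. \<forall>b\<in>T. a - b \<in> T)"

definition add_coset :: "'b::ab_group_add set \<Rightarrow> 'b \<Rightarrow> 'b set" where
  "add_coset T c = (\<lambda>t. t + c) ` T"

lemma add_subgroupD:
  assumes "add_subgroup T"
  shows "0 \<in> T" and "a \<in> T \<Longrightarrow> b \<in> T \<Longrightarrow> a - b \<in> T" and "a \<in> T \<Longrightarrow> - a \<in> T"
    and "a \<in> T \<Longrightarrow> b \<in> T \<Longrightarrow> a + b \<in> T"
proof -
  show 0: "0 \<in> T" and d: "a \<in> T \<Longrightarrow> b \<in> T \<Longrightarrow> a - b \<in> T" for a b
    using assms by (simp_all add: add_subgroup_def)
  show n: "a \<in> T \<Longrightarrow> - a \<in> T" for a using d[OF 0, of a] by simp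
  show "a \<in> T \<Longrightarrow> b \<in> T \<Longrightarrow> a + b \<in> T" using d[of a "- b"] n[of b] by simp
qed

lemma add_coset_eq:
  assumes T: "add_subgroup T"
  shows "add_coset T a = add_coset T b \<longleftrightarrow> a - b \<in> T"
proof
  assume "add_coset T a = add_coset T b"
  moreover have "a \<in> add_coset T a"
    unfolding add_coset_def using add_subgroupD(1)[OF T] by (intro image_eqI[of _ _ 0]) simp_all
  ultimately obtain t where "t \<in> T" "a = t + b" by (auto simp: add_coset_def)
  then show "a - b \<in> T" by simp
next
  assume ab: "a - b \<in> T"
  have *: "add_coset T u \<subseteq> add_coset T v" if "u - v \<in> T" for u v
  proof
    fix z assume "z \<in> add_coset T u"
    then obtain t where t: "t \<in> T" "z = t + u" by (auto simp: add_coset_def)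
    then have "z = (t + (u - v)) + v" "t + (u - v) \<in> T"
      using add_subgroupD(4)[OF T t(1) that] by simp_all
    then show "z \<in> add_coset T v" unfolding add_coset_def by (rule image_eqI)
  qed
  have "b - a \<in> T" using add_subgroupD(3)[OF T ab] by simp
  then show "add_coset T a = add_coset T b" using *[OF ab] *[of b a] by blast
qed

lemma r_coset_free: "T #>\<^bsub>free_Abelian_group A\<^esub> c = add_coset T c"
  unfolding r_coset_def add_coset_def mult_free_Abelian_group by blast

lemma subgroup_add_subgroup:
  assumes "subgroup T (free_Abelian_group A)"
  shows "add_subgroup T"
  unfolding add_subgroup_def
proof (intro conjI ballI)
  show "0 \<in> T" using subgroup.one_closed[OF assms] by simp
  fix a b assume a: "a \<in> T" and b: "b \<in> T"
  have "Poly_Mapping.keys b \<subseteq> A" using subgroup.mem_carrier[OF assms b] by simp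
  then have "- b \<in> T" using subgroup.m_inv_closed[OF assms b] by simp
  then show "a - b \<in> T" using subgroup.m_closed[OF assms a, of "- b"] by simp
qed

abbreviation (input) Z2 :: "int monoid" where
  "Z2 \<equiv> integer_mod_group 2"

lemma carrier_Z2: "carrier Z2 = {0, 1}"
  by (auto simp: carrier_integer_mod_group)

text \<open>The class of k tensor 1. These classes exhaust the tensor product with
  \<open>Z2\<close>, which identifies it with K / 2 K.\<close>

definition mod_two :: "('g, 'm) monoid_scheme \<Rightarrow> 'g \<Rightarrow> ('g \<times> int \<Rightarrow>\<^sub>0 int) set" where
  "mod_two K k = add_coset (tensor_relations K Z2) (frag_of (k, 1))"

context
  fixes K :: "('g, 'm) monoid_scheme"
  assumes K: "comm_group K"
begin

interpretation K: comm_group K by (rule K)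

lemma tensor_relations_gens:
  "g \<in> carrier K \<Longrightarrow> g' \<in> carrier K \<Longrightarrow> h \<in> carrier Z2 \<Longrightarrow>
    frag_of (g \<otimes>\<^bsub>K\<^esub> g', h) - frag_of (g, h) - frag_of (g', h) \<in> tensor_relations K Z2"
  "g \<in> carrier K \<Longrightarrow> h \<in> carrier Z2 \<Longrightarrow> h' \<in> carrier Z2 \<Longrightarrow>
    frag_of (g, h \<otimes>\<^bsub>Z2\<^esub> h') - frag_of (g, h) - frag_of (g, h') \<in> tensor_relations K Z2"
  unfolding tensor_relations_def by (rule generate.incl, blast)+

lemma frag_of_keys3:
  "a \<in> A \<Longrightarrow> b \<in> A \<Longrightarrow> c \<in> A \<Longrightarrow> Poly_Mapping.keys (frag_of a - frag_of b - frag_of c) \<subseteq> A"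
  by (intro order_trans[OF keys_diff] Un_least) (simp_all add: keys_frag_of)

lemma tensor_gens_carrier:
  "{frag_of (g \<otimes>\<^bsub>K\<^esub> g', h) - frag_of (g, h) - frag_of (g', h) | g g' h.
         g \<in> carrier K \<and> g' \<in> carrier K \<and> h \<in> carrier Z2} \<union>
      {frag_of (g, h \<otimes>\<^bsub>Z2\<^esub> h') - frag_of (g, h) - frag_of (g, h') | g h h'.
         g \<in> carrier K \<and> h \<in> carrier Z2 \<and> h' \<in> carrier Z2}
   \<subseteq> carrier (free_Abelian_group (carrier K \<times> carrier Z2))"
proof -
  have Z2: "h \<otimes>\<^bsub>Z2\<^esub> h' \<in> carrier Z2" if "h \<in> carrier Z2" "h' \<in> carrier Z2" for h h'
    using monoid.m_closed[OF group.is_monoid[OF group_integer_mod_group] that] .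
  have "frag_of (g \<otimes>\<^bsub>K\<^esub> g', h) - frag_of (g, h) - frag_of (g', h)
      \<in> carrier (free_Abelian_group (carrier K \<times> carrier Z2))"
    if "g \<in> carrier K" "g' \<in> carrier K" "h \<in> carrier Z2" for g g' h
    unfolding carrier_free_Abelian_group_iff by (rule frag_of_keys3) (simp_all add: that)
  moreover have "frag_of (g, h \<otimes>\<^bsub>Z2\<^esub> h') - frag_of (g, h) - frag_of (g, h')
      \<in> carrier (free_Abelian_group (carrier K \<times> carrier Z2))"
    if "g \<in> carrier K" "h \<in> carrier Z2" "h' \<in> carrier Z2" for g h h'
    unfolding carrier_free_Abelian_group_iff
    by (rule frag_of_keys3) (simp_all add: that Z2 del: mult_integer_mod_group)
  ultimately show ?thesis by blast
qed

lemma tensor_relations_subgroup: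
  "subgroup (tensor_relations K Z2) (free_Abelian_group (carrier K \<times> carrier Z2))"
  unfolding tensor_relations_def
  by (rule group.generate_is_subgroup[OF group_free_Abelian_group tensor_gens_carrier])

lemmas rel_sub = subgroup_add_subgroup[OF tensor_relations_subgroup]

lemma rel_zero: "k \<in> carrier K \<Longrightarrow> frag_of (k, 0) \<in> tensor_relations K Z2"
  using add_subgroupD(3)[OF rel_sub tensor_relations_gens(2)[of k 0 0]] by (simp add: carrier_Z2)

lemma rel_double:
  assumes k: "k \<in> carrier K"
  shows "frag_of (k, 1) + frag_of (k, 1) \<in> tensor_relations K Z2"
proof -
  have "frag_of (k, 0) - frag_of (k, 1) - frag_of (k, 1) \<in> tensor_relations K Z2"
    using tensor_relations_gens(2)[of k 1 1] k by (simp add: carrier_Z2)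
  from add_subgroupD(2)[OF rel_sub rel_zero[OF k] this] show ?thesis by (simp add: algebra_simps)
qed

lemma rel_mult: "k \<in> carrier K \<Longrightarrow> l \<in> carrier K \<Longrightarrow>
    frag_of (k \<otimes>\<^bsub>K\<^esub> l, 1) - frag_of (k, 1) - frag_of (l, 1) \<in> tensor_relations K Z2"
  by (rule tensor_relations_gens(1)) (simp_all add: carrier_Z2)

lemma rel_square: "k \<in> carrier K \<Longrightarrow> frag_of (k \<otimes>\<^bsub>K\<^esub> k, 1) \<in> tensor_relations K Z2"
  using add_subgroupD(4)[OF rel_sub rel_mult[of k k] rel_double[of k]] by simp

lemma rel_representative:
  assumes "Poly_Mapping.keys c \<subseteq> carrier K \<times> carrier Z2"
  shows "\<exists>k\<in>carrier K. c - frag_of (k, 1) \<in> tensor_relations K Z2"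
  using assms
proof (induction rule: frag_induction)
  case zero
  have "frag_of (\<one>\<^bsub>K\<^esub>, 1) \<in> tensor_relations K Z2" using rel_square[of "\<one>\<^bsub>K\<^esub>"] by simp
  then show ?case using add_subgroupD(3)[OF rel_sub] by (intro bexI[of _ "\<one>\<^bsub>K\<^esub>"]) simp_all
next
  case (diff c d)
  then obtain k l where kl: "k \<in> carrier K" "c - frag_of (k, 1) \<in> tensor_relations K Z2"
    "l \<in> carrier K" "d - frag_of (l, 1) \<in> tensor_relations K Z2" by blast
  let ?m = "k \<otimes>\<^bsub>K\<^esub> l"
  \<comment> \<open>The product \<open>?m\<close> may stand for a quotient because twice
    \<open>(l, 1)\<close> is a relation.\<close>
  have "(c - d) - frag_of (?m, 1)
    = ((c - frag_of (k, 1)) - (d - frag_of (l, 1)))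
      - ((frag_of (?m, 1) - frag_of (k, 1) - frag_of (l, 1)) + (frag_of (l, 1) + frag_of (l, 1)))"
    by (simp add: algebra_simps)
  also have "\<dots> \<in> tensor_relations K Z2"
    by (intro add_subgroupD(2,4)[OF rel_sub] kl rel_mult rel_double)
  finally show ?case using kl by blast
next
  case (one p)
  then obtain k h where p: "p = (k, h)" "k \<in> carrier K" "h = 0 \<or> h = 1" by (auto simp: carrier_Z2)
  have one: "frag_of (\<one>\<^bsub>K\<^esub>, 1) \<in> tensor_relations K Z2" using rel_square[of "\<one>\<^bsub>K\<^esub>"] by simp
  show ?case
  proof (cases "h = 1")
    case True
    then show ?thesis using p add_subgroupD(1)[OF rel_sub] by (intro bexI[of _ k]) simp_all
  next
    case False
    then have "frag_of p - frag_of (\<one>\<^bsub>K\<^esub>, 1) \<in> tensor_relations K Z2"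
      using p add_subgroupD(2)[OF rel_sub rel_zero[OF p(2)] one] by simp
    then show ?thesis by (intro bexI[of _ "\<one>\<^bsub>K\<^esub>"]) simp_all
  qed
qed

lemma tensor_comm_group: "comm_group (tensor_product K Z2)"
  unfolding tensor_product_def
  by (rule comm_group.abelian_FactGroup[OF abelian_free_Abelian_group tensor_relations_subgroup])

lemma tensor_carrier: "carrier (tensor_product K Z2) = mod_two K ` carrier K"
proof -
  have eq: "carrier (tensor_product K Z2)
    = add_coset (tensor_relations K Z2) ` carrier (free_Abelian_group (carrier K \<times> carrier Z2))"
    unfolding tensor_product_def carrier_FactGroup r_coset_free ..
  show ?thesis
    unfolding eq
  proof (intro subset_antisym subsetI)
    fix X assume "X \<in> add_coset (tensor_relations K Z2) ` carrier (free_Abelian_group (carrier K \<times> carrier Z2))"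
    then obtain c where c: "Poly_Mapping.keys c \<subseteq> carrier K \<times> carrier Z2" "X = add_coset (tensor_relations K Z2) c"
      by auto
    obtain k where k: "k \<in> carrier K" "c - frag_of (k, 1) \<in> tensor_relations K Z2"
      using rel_representative[OF c(1)] by blast
    then have "X = mod_two K k" unfolding c(2) mod_two_def by (simp add: add_coset_eq[OF rel_sub])
    then show "X \<in> mod_two K ` carrier K" using k(1) by (rule image_eqI)
  next
    fix X assume "X \<in> mod_two K ` carrier K"
    then obtain k where "k \<in> carrier K" "X = mod_two K k" by blast
    then show "X \<in> add_coset (tensor_relations K Z2) ` carrier (free_Abelian_group (carrier K \<times> carrier Z2))"
      unfolding mod_two_def by (intro image_eqI[of _ _ "frag_of (k, 1)"]) (simp_all add: carrier_Z2)
  qed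
qed

lemma mod_two_mult:
  assumes "k \<in> carrier K" "l \<in> carrier K"
  shows "mod_two K (k \<otimes>\<^bsub>K\<^esub> l) = mod_two K k \<otimes>\<^bsub>tensor_product K Z2\<^esub> mod_two K l"
proof -
  have n: "tensor_relations K Z2 \<lhd> free_Abelian_group (carrier K \<times> carrier Z2)"
    by (rule comm_group.subgroup_imp_normal[OF abelian_free_Abelian_group tensor_relations_subgroup])
  have "mod_two K k \<otimes>\<^bsub>tensor_product K Z2\<^esub> mod_two K l
    = add_coset (tensor_relations K Z2) (frag_of (k, 1) + frag_of (l, 1))"
    using normal.rcos_sum[OF n, of "frag_of (k, 1)" "frag_of (l, 1)"] assms
    by (simp add: tensor_product_def mod_two_def r_coset_free carrier_Z2)
  also have "\<dots> = mod_two K (k \<otimes>\<^bsub>K\<^esub> l)"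
    using add_subgroupD(3)[OF rel_sub rel_mult[OF assms]]
    by (simp add: mod_two_def add_coset_eq[OF rel_sub] algebra_simps)
  finally show ?thesis by simp
qed

lemma one_tensor: "\<one>\<^bsub>tensor_product K Z2\<^esub> = tensor_relations K Z2"
  by (simp add: tensor_product_def)

text \<open>Squares die because 1 + 1 = 0 in \<open>Z2\<close>. For the converse, the bilinear map
  from \<open>K\<close> and \<open>Z2\<close> to K / 2 K is extended to formal sums; it kills all
  relations and recovers the class of \<open>k\<close>.\<close>

lemma mod_two_one_iff:
  assumes k: "k \<in> carrier K"
  shows "mod_two K k = \<one>\<^bsub>tensor_product K Z2\<^esub> \<longleftrightarrow> (\<exists>j\<in>carrier K. k = j \<otimes>\<^bsub>K\<^esub> j)"
proof -
  have "tensor_relations K Z2 = add_coset (tensor_relations K Z2) 0" by (simp add: add_coset_def)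
  then have one: "mod_two K k = \<one>\<^bsub>tensor_product K Z2\<^esub> \<longleftrightarrow> frag_of (k, 1) \<in> tensor_relations K Z2"
    using add_coset_eq[OF rel_sub, of "frag_of (k, 1)" 0] by (simp add: one_tensor mod_two_def)
  \<comment> \<open>In additive notation this is 2 K.\<close>
  define N where "N = {j \<otimes>\<^bsub>K\<^esub> j | j. j \<in> carrier K}"
  have N: "subgroup N K"
  proof (rule K.subgroupI)
    show "N \<subseteq> carrier K" "N \<noteq> {}" by (auto simp: N_def)
    show "inv\<^bsub>K\<^esub> a \<in> N" if "a \<in> N" for a
    proof -
      obtain j where j: "j \<in> carrier K" "a = j \<otimes>\<^bsub>K\<^esub> j"
        using \<open>a \<in> N\<close> by (auto simp: N_def)
      then have "inv\<^bsub>K\<^esub> a = inv\<^bsub>K\<^esub> j \<otimes>\<^bsub>K\<^esub> inv\<^bsub>K\<^esub> j" by (simp add: K.inv_mult)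
      then show ?thesis using j(1) K.inv_closed unfolding N_def by blast
    qed
    show "a \<otimes>\<^bsub>K\<^esub> b \<in> N" if "a \<in> N" "b \<in> N" for a b
    proof -
      obtain i j where ij: "i \<in> carrier K" "a = i \<otimes>\<^bsub>K\<^esub> i" "j \<in> carrier K" "b = j \<otimes>\<^bsub>K\<^esub> j"
        using \<open>a \<in> N\<close> \<open>b \<in> N\<close> by (auto simp: N_def)
      then have "a \<otimes>\<^bsub>K\<^esub> b = (i \<otimes>\<^bsub>K\<^esub> j) \<otimes>\<^bsub>K\<^esub> (i \<otimes>\<^bsub>K\<^esub> j)" by (simp add: K.m_ac)
      then show ?thesis using ij K.m_closed unfolding N_def by blast
    qed
  qed
  have N_normal: "N \<lhd> K" by (rule K.subgroup_imp_normal[OF N])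
  define Q where "Q = K Mod N"
  interpret Q: comm_group Q unfolding Q_def by (rule K.abelian_FactGroup[OF N])
  have Q_carrier: "N #>\<^bsub>K\<^esub> g \<in> carrier Q" if "g \<in> carrier K" for g
    using that by (simp add: Q_def carrier_FactGroup)
  have Q_mult: "(N #>\<^bsub>K\<^esub> g) \<otimes>\<^bsub>Q\<^esub> (N #>\<^bsub>K\<^esub> g') = N #>\<^bsub>K\<^esub> (g \<otimes>\<^bsub>K\<^esub> g')"
    if "g \<in> carrier K" "g' \<in> carrier K" for g g'
    using normal.rcos_sum[OF N_normal that] by (simp add: Q_def)
  have Q_one: "\<one>\<^bsub>Q\<^esub> = N" by (simp add: Q_def)
  have Q_one_iff: "N #>\<^bsub>K\<^esub> g = \<one>\<^bsub>Q\<^esub> \<longleftrightarrow> g \<in> N" if "g \<in> carrier K" for g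
    using K.coset_join1[OF _ that N] K.coset_join2[OF that N] subgroup.subset[OF N] by (auto simp: Q_one)
  \<comment> \<open>The bilinear map taking g and h to h g modulo \<open>N\<close>; the values of
    \<open>h\<close> in \<open>Z2\<close> are 0 and 1.\<close>
  define f where "f = (\<lambda>(g, h :: int). if h = 0 then \<one>\<^bsub>Q\<^esub> else N #>\<^bsub>K\<^esub> g)"
  have f_carrier: "f p \<in> carrier Q" if "p \<in> carrier K \<times> carrier Z2" for p
    using that Q_carrier by (auto simp: f_def)
  have f_image: "f ` (carrier K \<times> carrier Z2) \<subseteq> carrier Q" using f_carrier by blast
  obtain h where h: "h \<in> hom (free_Abelian_group (carrier K \<times> carrier Z2)) Q"
      "\<And>p. p \<in> carrier K \<times> carrier Z2 \<Longrightarrow> h (frag_of p) = f p"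
    using Q.free_Abelian_group_universal[OF f_image] by blast
  let ?FG = "free_Abelian_group (carrier K \<times> carrier Z2)"
  interpret h: group_hom ?FG Q h
    by (intro group_hom.intro group_hom_axioms.intro group_free_Abelian_group Q.is_group h(1))
  have add: "h (a + b) = h a \<otimes>\<^bsub>Q\<^esub> h b" if "a \<in> carrier ?FG" "b \<in> carrier ?FG" for a b
    using h.hom_mult[OF that] by simp
  have in_ker: "frag_of a - frag_of b - frag_of c \<in> kernel ?FG Q h"
    if "a \<in> carrier K \<times> carrier Z2" "b \<in> carrier K \<times> carrier Z2" "c \<in> carrier K \<times> carrier Z2"
      "f a = f b \<otimes>\<^bsub>Q\<^esub> f c" for a b c
  proof -
    let ?d = "frag_of a - frag_of b - frag_of c"
    have d: "?d \<in> carrier ?FG" using frag_of_keys3 that(1-3) by simp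
    have bc: "frag_of b + frag_of c \<in> carrier ?FG"
      using that(2,3) unfolding carrier_free_Abelian_group_iff
      by (intro order_trans[OF keys_add] Un_least) (simp_all add: keys_frag_of)
    have "f a = h (?d + (frag_of b + frag_of c))" using h(2)[OF that(1)] by simp
    also have "\<dots> = h ?d \<otimes>\<^bsub>Q\<^esub> (h (frag_of b) \<otimes>\<^bsub>Q\<^esub> h (frag_of c))"
      unfolding add[OF d bc] using add[of "frag_of b" "frag_of c"] that(2,3) by simp
    also have "\<dots> = h ?d \<otimes>\<^bsub>Q\<^esub> f a" using h(2) that by simp
    finally have "h ?d = \<one>\<^bsub>Q\<^esub>"
      using f_carrier[OF that(1)] h.hom_closed[OF d] by (metis Q.l_cancel_one' Q.m_comm)
    then show ?thesis using d by (simp add: kernel_def)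
  qed
  have "tensor_relations K Z2 \<subseteq> kernel ?FG Q h"
    unfolding tensor_relations_def
  proof (rule group.generate_subgroup_incl[OF group_free_Abelian_group _ h.subgroup_kernel], rule Un_least)
    show "{frag_of (g \<otimes>\<^bsub>K\<^esub> g', h) - frag_of (g, h) - frag_of (g', h) | g g' h.
         g \<in> carrier K \<and> g' \<in> carrier K \<and> h \<in> carrier Z2} \<subseteq> kernel ?FG Q h"
    proof clarify
      fix g g' and i :: int assume g: "g \<in> carrier K" "g' \<in> carrier K" and i: "i \<in> carrier Z2"
      show "frag_of (g \<otimes>\<^bsub>K\<^esub> g', i) - frag_of (g, i) - frag_of (g', i) \<in> kernel ?FG Q h"
        by (rule in_ker) (use g i Q_mult[OF g] in \<open>simp_all add: f_def\<close>)
    qed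
    show "{frag_of (g, h \<otimes>\<^bsub>Z2\<^esub> h') - frag_of (g, h) - frag_of (g, h') | g h h'.
         g \<in> carrier K \<and> h \<in> carrier Z2 \<and> h' \<in> carrier Z2} \<subseteq> kernel ?FG Q h"
    proof clarify
      fix g and i i' :: int assume g: "g \<in> carrier K" and i: "i \<in> carrier Z2" "i' \<in> carrier Z2"
      have sq: "(N #>\<^bsub>K\<^esub> g) \<otimes>\<^bsub>Q\<^esub> (N #>\<^bsub>K\<^esub> g) = \<one>\<^bsub>Q\<^esub>"
        using Q_mult[OF g g] Q_one_iff[of "g \<otimes>\<^bsub>K\<^esub> g"] g by (auto simp: N_def)
      have ii: "i = 0 \<or> i = 1" "i' = 0 \<or> i' = 1" using i by (simp_all add: carrier_Z2)
      have "f (g, i \<otimes>\<^bsub>Z2\<^esub> i') = f (g, i) \<otimes>\<^bsub>Q\<^esub> f (g, i')"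
        using ii by (elim disjE) (simp_all add: f_def sq Q_carrier[OF g])
      then show "frag_of (g, i \<otimes>\<^bsub>Z2\<^esub> i') - frag_of (g, i) - frag_of (g, i') \<in> kernel ?FG Q h"
        by (rule in_ker[rotated 3]) (use ii in \<open>elim disjE; simp add: carrier_Z2 g\<close>)+
    qed
  qed
  then have "k \<in> N" if "frag_of (k, 1) \<in> tensor_relations K Z2"
  proof -
    have "h (frag_of (k, 1)) = \<one>\<^bsub>Q\<^esub>"
      using that \<open>tensor_relations K Z2 \<subseteq> kernel ?FG Q h\<close> unfolding kernel_def by blast
    moreover have "h (frag_of (k, 1)) = N #>\<^bsub>K\<^esub> k"
      using h(2)[of "(k, 1)"] k by (simp add: carrier_Z2 f_def)
    ultimately show ?thesis using Q_one_iff[OF k] by simp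
  qed
  moreover have "frag_of (k, 1) \<in> tensor_relations K Z2" if "k \<in> N"
  proof -
    obtain j where "j \<in> carrier K" "k = j \<otimes>\<^bsub>K\<^esub> j" using \<open>k \<in> N\<close> unfolding N_def by blast
    then show ?thesis using rel_square by simp
  qed
  moreover have "k \<in> N \<longleftrightarrow> (\<exists>j\<in>carrier K. k = j \<otimes>\<^bsub>K\<^esub> j)" unfolding N_def by blast
  ultimately show ?thesis unfolding one by metis
qed

lemma tensor_elementary: "elementary_2_group (tensor_product K Z2)"
  unfolding elementary_2_group_def tensor_carrier
proof (intro conjI ballI tensor_comm_group)
  fix X assume "X \<in> mod_two K ` carrier K"
  then obtain k where k: "k \<in> carrier K" "X = mod_two K k" by blast
  show "X \<otimes>\<^bsub>tensor_product K Z2\<^esub> X = \<one>\<^bsub>tensor_product K Z2\<^esub>"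
    unfolding k(2) mod_two_mult[OF k(1) k(1), symmetric]
    using mod_two_one_iff[of "k \<otimes>\<^bsub>K\<^esub> k"] k(1) by auto
qed

lemma mod_two_eq_iff:
  assumes kl: "k \<in> carrier K" "l \<in> carrier K"
  shows "mod_two K k = mod_two K l \<longleftrightarrow> (\<exists>j\<in>carrier K. k = l \<otimes>\<^bsub>K\<^esub> (j \<otimes>\<^bsub>K\<^esub> j))"
proof -
  let ?T = "tensor_product K Z2"
  interpret T: comm_group ?T by (rule tensor_comm_group)
  have mem: "mod_two K a \<in> carrier ?T" if "a \<in> carrier K" for a using that by (simp add: tensor_carrier)
  let ?m = "inv\<^bsub>K\<^esub> l \<otimes>\<^bsub>K\<^esub> k"
  have m: "?m \<in> carrier K" "l \<otimes>\<^bsub>K\<^esub> ?m = k" using kl by (simp_all flip: K.m_assoc)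
  have "mod_two K k = mod_two K l \<otimes>\<^bsub>?T\<^esub> mod_two K ?m"
    using mod_two_mult[OF kl(2) m(1)] m(2) by simp
  then have "mod_two K k = mod_two K l \<longleftrightarrow> mod_two K ?m = \<one>\<^bsub>?T\<^esub>"
    using mem[OF kl(2)] mem[OF m(1)] by simp
  also have "\<dots> \<longleftrightarrow> (\<exists>j\<in>carrier K. ?m = j \<otimes>\<^bsub>K\<^esub> j)" by (rule mod_two_one_iff[OF m(1)])
  also have "\<dots> \<longleftrightarrow> (\<exists>j\<in>carrier K. k = l \<otimes>\<^bsub>K\<^esub> (j \<otimes>\<^bsub>K\<^esub> j))"
  proof (rule bex_cong[OF refl])
    fix j assume j: "j \<in> carrier K"
    show "?m = j \<otimes>\<^bsub>K\<^esub> j \<longleftrightarrow> k = l \<otimes>\<^bsub>K\<^esub> (j \<otimes>\<^bsub>K\<^esub> j)"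
    proof
      assume "?m = j \<otimes>\<^bsub>K\<^esub> j"
      then show "k = l \<otimes>\<^bsub>K\<^esub> (j \<otimes>\<^bsub>K\<^esub> j)" using m(2) by simp
    next
      assume "k = l \<otimes>\<^bsub>K\<^esub> (j \<otimes>\<^bsub>K\<^esub> j)"
      then show "?m = j \<otimes>\<^bsub>K\<^esub> j" using j kl(2) by (simp flip: K.m_assoc)
    qed
  qed
  finally show ?thesis .
qed

end

text \<open>Both images are the quotient of \<open>X\<close> by the same equivalence. Quotient
  groups are compared through this without constructing maps on cosets, and infinite quotients are
  covered as well.\<close>

lemma card_image_same_fibers:
  assumes "\<And>x y. x \<in> X \<Longrightarrow> y \<in> X \<Longrightarrow> f x = f y \<longleftrightarrow> g x = g y"
  shows "card (f ` X) = card (g ` X)"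
proof -
  define r where "r = (\<lambda>z. SOME x. x \<in> X \<and> f x = z)"
  have r: "r z \<in> X \<and> f (r z) = z" if "z \<in> f ` X" for z
    unfolding r_def by (rule someI_ex) (use that in blast)
  have "bij_betw (\<lambda>z. g (r z)) (f ` X) (g ` X)"
  proof (rule bij_betw_imageI)
    show "inj_on (\<lambda>z. g (r z)) (f ` X)"
    proof (rule inj_onI)
      fix z w assume zw: "z \<in> f ` X" "w \<in> f ` X" "g (r z) = g (r w)"
      then have "f (r z) = f (r w)" using assms r by blast
      then show "z = w" using r zw by metis
    qed
    show "(\<lambda>z. g (r z)) ` f ` X = g ` X"
    proof (intro subset_antisym subsetI)
      fix w assume "w \<in> g ` X"
      then obtain x where x: "x \<in> X" "w = g x" by blast
      have fx: "f x \<in> f ` X" using x(1) by (rule imageI)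
      then have "g (r (f x)) = g x" using r[OF fx] x(1) assms by blast
      then show "w \<in> (\<lambda>z. g (r z)) ` f ` X" using x(2) fx by (metis image_eqI)
    next
      fix w assume "w \<in> (\<lambda>z. g (r z)) ` f ` X"
      then obtain z where "z \<in> f ` X" "w = g (r z)" by blast
      then show "w \<in> g ` X" using r by blast
    qed
  qed
  then show ?thesis by (rule bij_betw_same_card)
qed

lemma finite_image_coarser:
  assumes "finite (p ` X)" "\<And>x y. x \<in> X \<Longrightarrow> y \<in> X \<Longrightarrow> p x = p y \<Longrightarrow> f x = f y"
  shows "finite (f ` X)"
proof -
  have "f ` X \<subseteq> (\<lambda>z. f (SOME x. x \<in> X \<and> p x = z)) ` p ` X"
  proof
    fix w assume "w \<in> f ` X"
    then obtain x where x: "x \<in> X" "w = f x" by blast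
    have "(SOME y. y \<in> X \<and> p y = p x) \<in> X \<and> p (SOME y. y \<in> X \<and> p y = p x) = p x"
      by (rule someI[of "\<lambda>y. y \<in> X \<and> p y = p x" x]) (use x in simp)
    then have "f (SOME y. y \<in> X \<and> p y = p x) = f x" using assms(2) x(1) by blast
    then show "w \<in> (\<lambda>z. f (SOME x. x \<in> X \<and> p x = z)) ` p ` X"
      using x by (intro image_eqI[of _ _ "p x"]) simp_all
  qed
  then show ?thesis using assms(1) finite_subset by blast
qed

text \<open>Free abelian groups have no 2-torsion, which makes the half of a chain unique.\<close>

lemma frag_double_inject: "a + a = b + b \<longleftrightarrow> a = (b :: 'b \<Rightarrow>\<^sub>0 int)"
proof
  assume eq: "a + a = b + b"
  show "a = b"
  proof (rule poly_mapping_eqI)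
    fix k
    have "Poly_Mapping.lookup (a + a) k = Poly_Mapping.lookup (b + b) k" using eq by simp
    then show "Poly_Mapping.lookup a k = Poly_Mapping.lookup b k" by (simp add: lookup_add)
  qed
qed simp

lemma generate_free_subset:
  assumes "add_subgroup T" "S \<subseteq> carrier (free_Abelian_group A)" "S \<subseteq> T"
  shows "generate (free_Abelian_group A) S \<subseteq> T"
proof
  fix c assume "c \<in> generate (free_Abelian_group A) S"
  then show "c \<in> T"
  proof (induction rule: generate.induct)
    case (inv h)
    then have "inv\<^bsub>free_Abelian_group A\<^esub> h = - h" using assms(2) by auto
    then show ?case using add_subgroupD(3)[OF assms(1), of h] assms(3) inv by auto
  qed (use add_subgroupD(1,4)[OF assms(1)] assms(3) in auto)
qed

section \<open>The torsion product with Z/2 as two-torsion\<close>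

context
  fixes G :: "('g, 'm) monoid_scheme"
  assumes G: "comm_group G"
begin

interpretation G: comm_group G by (rule G)

abbreviation (input) "free_on_G \<equiv> free_Abelian_group (carrier G)"

lemma resolution_eval_superset:
  assumes "finite A" "Poly_Mapping.keys c \<subseteq> A" "A \<subseteq> carrier G"
  shows "resolution_eval G c = finprod G (\<lambda>g. g [^]\<^bsub>G\<^esub> Poly_Mapping.lookup c g) A"
  unfolding resolution_eval_def
proof (rule G.finprod_mono_neutral_cong_left[OF assms(1,2)])
  show "(\<lambda>g. g [^]\<^bsub>G\<^esub> Poly_Mapping.lookup c g) \<in> A \<rightarrow> carrier G"
    using assms(3) by (intro Pi_I G.int_pow_closed) blast
qed (simp_all add: in_keys_iff)

lemma resolution_eval_hom: "resolution_eval G \<in> hom free_on_G G"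
proof (rule homI)
  fix c assume "c \<in> carrier free_on_G"
  then have "(\<lambda>g. g [^]\<^bsub>G\<^esub> Poly_Mapping.lookup c g) \<in> Poly_Mapping.keys c \<rightarrow> carrier G"
    by (intro Pi_I G.int_pow_closed) auto
  then show "resolution_eval G c \<in> carrier G" unfolding resolution_eval_def by (rule G.finprod_closed)
next
  fix a b assume ab: "a \<in> carrier free_on_G" "b \<in> carrier free_on_G"
  let ?A = "Poly_Mapping.keys a \<union> Poly_Mapping.keys b"
  have A: "finite ?A" "?A \<subseteq> carrier G" using ab by simp_all
  have cl: "(\<lambda>g. g [^]\<^bsub>G\<^esub> Poly_Mapping.lookup c g) \<in> ?A \<rightarrow> carrier G" for c :: "'g \<Rightarrow>\<^sub>0 int"
    by (rule Pi_I, rule G.int_pow_closed, rule subsetD[OF A(2)])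
  have "resolution_eval G (a + b) = finprod G (\<lambda>g. g [^]\<^bsub>G\<^esub> Poly_Mapping.lookup (a + b) g) ?A"
    by (rule resolution_eval_superset[OF A(1) keys_add A(2)])
  also have "\<dots> = finprod G (\<lambda>g. g [^]\<^bsub>G\<^esub> Poly_Mapping.lookup a g \<otimes>\<^bsub>G\<^esub> g [^]\<^bsub>G\<^esub> Poly_Mapping.lookup b g) ?A"
  proof (rule G.finprod_cong'[OF refl])
    show "(\<lambda>g. g [^]\<^bsub>G\<^esub> Poly_Mapping.lookup a g \<otimes>\<^bsub>G\<^esub> g [^]\<^bsub>G\<^esub> Poly_Mapping.lookup b g) \<in> ?A \<rightarrow> carrier G"
      by (rule Pi_I, rule G.m_closed) (rule G.int_pow_closed, rule subsetD[OF A(2)], assumption)+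
    fix g assume "g \<in> ?A"
    then have "g \<in> carrier G" by (rule subsetD[OF A(2)])
    then show "g [^]\<^bsub>G\<^esub> Poly_Mapping.lookup (a + b) g
      = g [^]\<^bsub>G\<^esub> Poly_Mapping.lookup a g \<otimes>\<^bsub>G\<^esub> g [^]\<^bsub>G\<^esub> Poly_Mapping.lookup b g"
      by (simp add: lookup_add G.int_pow_mult)
  qed
  also have "\<dots> = resolution_eval G a \<otimes>\<^bsub>G\<^esub> resolution_eval G b"
    unfolding resolution_eval_superset[OF A(1) Un_upper1 A(2)] resolution_eval_superset[OF A(1) Un_upper2 A(2)]
    by (rule G.finprod_multf[OF cl cl])
  finally show "resolution_eval G (a \<otimes>\<^bsub>free_on_G\<^esub> b) = resolution_eval G a \<otimes>\<^bsub>G\<^esub> resolution_eval G b" by simp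
qed

lemma resolution_eval_frag_of: "g \<in> carrier G \<Longrightarrow> resolution_eval G (frag_of g) = g"
  using resolution_eval_superset[of "{g}" "frag_of g"] by (simp add: G.int_pow_1)

interpretation ev: group_hom free_on_G G "resolution_eval G"
  by (intro group_hom.intro group_hom_axioms.intro group_free_Abelian_group G.is_group resolution_eval_hom)

lemma resolution_eval_add:
  "Poly_Mapping.keys a \<subseteq> carrier G \<Longrightarrow> Poly_Mapping.keys b \<subseteq> carrier G \<Longrightarrow>
    resolution_eval G (a + b) = resolution_eval G a \<otimes>\<^bsub>G\<^esub> resolution_eval G b"
  using ev.hom_mult[of a b] by simp

lemma carrier_resolution_kernel:
  "carrier (resolution_kernel G) = {c. Poly_Mapping.keys c \<subseteq> carrier G \<and> resolution_eval G c = \<one>\<^bsub>G\<^esub>}"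
  using subgroup.carrier_subgroup_generated_subgroup[OF ev.subgroup_kernel]
  by (simp add: resolution_kernel_def kernel_def)

lemma resolution_kernel_comm: "comm_group (resolution_kernel G)"
  unfolding resolution_kernel_def
  by (rule group.abelian_subgroup_generated[OF group_free_Abelian_group abelian_free_Abelian_group])

lemma mult_resolution_kernel: "x \<otimes>\<^bsub>resolution_kernel G\<^esub> y = x + y"
  by (simp add: resolution_kernel_def)

abbreviation (input) "R \<equiv> resolution_kernel G"

lemma free_comm: "comm_group free_on_G"
  by (rule abelian_free_Abelian_group)

lemma tensor_relations_kernel_subset: "tensor_relations R Z2 \<subseteq> tensor_relations free_on_G Z2"
proof -
  have "frag_of (g \<otimes>\<^bsub>R\<^esub> g', h) - frag_of (g, h) - frag_of (g', h) \<in> tensor_relations free_on_G Z2"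
    if "g \<in> carrier R" "g' \<in> carrier R" "h \<in> carrier Z2" for g g' h
    using tensor_relations_gens(1)[OF free_comm, of g g' h] that
    by (simp add: mult_resolution_kernel carrier_resolution_kernel)
  moreover have "frag_of (g, h \<otimes>\<^bsub>Z2\<^esub> h') - frag_of (g, h) - frag_of (g, h') \<in> tensor_relations free_on_G Z2"
    if "g \<in> carrier R" "h \<in> carrier Z2" "h' \<in> carrier Z2" for g h h'
    using tensor_relations_gens(2)[OF free_comm, of g h h'] that
    by (simp add: carrier_resolution_kernel)
  ultimately show ?thesis
    unfolding tensor_relations_def[of R]
    by (intro generate_free_subset[OF rel_sub[OF free_comm] tensor_gens_carrier[OF resolution_kernel_comm]]) blast
qed

text \<open>The map in the definition of \<open>Tor\<close> sends r tensor 1 to r tensor 1, as the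
  relations over \<open>R\<close> are absorbed by those over the free group.\<close>

lemma relations_set_mult:
  "tensor_relations free_on_G Z2 <#>\<^bsub>free_Abelian_group (carrier free_on_G \<times> carrier Z2)\<^esub> mod_two R r
    = mod_two free_on_G r"
proof -
  let ?TR = "tensor_relations R Z2" and ?TF = "tensor_relations free_on_G Z2"
  have TF: "add_subgroup ?TF" by (rule rel_sub[OF free_comm])
  have TR: "0 \<in> ?TR" by (rule add_subgroupD(1)[OF rel_sub[OF resolution_kernel_comm]])
  show ?thesis
    unfolding set_mult_def mod_two_def add_coset_def mult_free_Abelian_group
  proof (intro subset_antisym subsetI)
    fix X assume "X \<in> (\<Union>h\<in>?TF. \<Union>k\<in>(\<lambda>t. t + frag_of (r, 1)) ` ?TR. {h + k})"
    then obtain s t where st: "s \<in> ?TF" "t \<in> ?TR" "X = s + (t + frag_of (r, 1))" by blast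
    then have "s + t \<in> ?TF" using add_subgroupD(4)[OF TF] tensor_relations_kernel_subset by blast
    then show "X \<in> (\<lambda>t. t + frag_of (r, 1)) ` ?TF"
      by (rule rev_image_eqI) (simp add: st(3) add.assoc)
  next
    fix X assume "X \<in> (\<lambda>t. t + frag_of (r, 1)) ` ?TF"
    then obtain s where s: "s \<in> ?TF" "X = s + (0 + frag_of (r, 1))" by auto
    then show "X \<in> (\<Union>h\<in>?TF. \<Union>k\<in>(\<lambda>t. t + frag_of (r, 1)) ` ?TR. {h + k})" using TR by blast
  qed
qed

text \<open>Over the free group F, r tensor 1 vanishes exactly when r is a double. With R the kernel
  of evaluation, \<open>Tor\<close> is therefore the image of R \<inter> 2 F in R / 2 R.\<close>

lemma Tor_structure:
  shows "elementary_2_group (Tor G Z2)"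
    and "carrier (Tor G Z2) = mod_two R ` {r \<in> carrier R. \<exists>j\<in>carrier free_on_G. r = j + j}"
proof -
  let ?T = "tensor_product R Z2" and ?F = "tensor_product free_on_G Z2"
  define \<iota> where "\<iota> = (\<lambda>X. tensor_relations free_on_G Z2 <#>\<^bsub>free_Abelian_group (carrier free_on_G \<times> carrier Z2)\<^esub> X)"
  have Tor: "Tor G Z2 = subgroup_generated ?T (kernel ?T ?F \<iota>)"
    by (simp only: Tor_def Let_def \<iota>_def)
  interpret T: comm_group ?T by (rule tensor_comm_group[OF resolution_kernel_comm])
  interpret F: comm_group ?F by (rule tensor_comm_group[OF free_comm])
  note T_carrier = tensor_carrier[OF resolution_kernel_comm] and F_carrier = tensor_carrier[OF free_comm]
  have \<iota>: "\<iota> (mod_two R r) = mod_two free_on_G r" for r unfolding \<iota>_def by (rule relations_set_mult)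
  have RF: "r \<in> carrier free_on_G" if "r \<in> carrier R" for r
    using that by (simp add: carrier_resolution_kernel)
  have hom: "\<iota> \<in> hom ?T ?F"
  proof (rule homI)
    fix X assume "X \<in> carrier ?T"
    then obtain r where "r \<in> carrier R" "X = mod_two R r" unfolding T_carrier by blast
    then show "\<iota> X \<in> carrier ?F" unfolding F_carrier using \<iota> RF by auto
  next
    fix X Y assume "X \<in> carrier ?T" "Y \<in> carrier ?T"
    then obtain r s where rs: "r \<in> carrier R" "X = mod_two R r" "s \<in> carrier R" "Y = mod_two R s"
      unfolding T_carrier by blast
    have "X \<otimes>\<^bsub>?T\<^esub> Y = mod_two R (r + s)"
      using mod_two_mult[OF resolution_kernel_comm rs(1,3)] rs(2,4) by (simp add: mult_resolution_kernel)
    then show "\<iota> (X \<otimes>\<^bsub>?T\<^esub> Y) = \<iota> X \<otimes>\<^bsub>?F\<^esub> \<iota> Y"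
      using mod_two_mult[OF free_comm RF[OF rs(1)] RF[OF rs(3)]] \<iota> rs(2,4) by simp
  qed
  interpret \<iota>: group_hom ?T ?F \<iota>
    by (intro group_hom.intro group_hom_axioms.intro T.is_group F.is_group hom)
  have Tor_carrier: "carrier (Tor G Z2) = kernel ?T ?F \<iota>"
    unfolding Tor by (rule subgroup.carrier_subgroup_generated_subgroup[OF \<iota>.subgroup_kernel])
  have one: "mod_two free_on_G r = \<one>\<^bsub>?F\<^esub> \<longleftrightarrow> (\<exists>j\<in>carrier free_on_G. r = j + j)" if "r \<in> carrier R" for r
    using mod_two_one_iff[OF free_comm RF[OF that]] by simp
  show "carrier (Tor G Z2) = mod_two R ` {r \<in> carrier R. \<exists>j\<in>carrier free_on_G. r = j + j}"
    unfolding Tor_carrier kernel_def T_carrier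
  proof (intro subset_antisym subsetI)
    fix X assume "X \<in> {x \<in> mod_two R ` carrier R. \<iota> x = \<one>\<^bsub>?F\<^esub>}"
    then obtain r where r: "r \<in> carrier R" "X = mod_two R r" "\<iota> X = \<one>\<^bsub>?F\<^esub>" by blast
    then have "\<exists>j\<in>carrier free_on_G. r = j + j" using \<iota> one[OF r(1)] by simp
    then show "X \<in> mod_two R ` {r \<in> carrier R. \<exists>j\<in>carrier free_on_G. r = j + j}" using r(1,2) by blast
  next
    fix X assume "X \<in> mod_two R ` {r \<in> carrier R. \<exists>j\<in>carrier free_on_G. r = j + j}"
    then obtain r where r: "r \<in> carrier R" "\<exists>j\<in>carrier free_on_G. r = j + j" "X = mod_two R r" by blast
    then show "X \<in> {x \<in> mod_two R ` carrier R. \<iota> x = \<one>\<^bsub>?F\<^esub>}" using \<iota> one[OF r(1)] by simp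
  qed
  have sub: "carrier (Tor G Z2) \<subseteq> carrier ?T" unfolding Tor_carrier kernel_def by blast
  have "x \<otimes>\<^bsub>?T\<^esub> x = \<one>\<^bsub>?T\<^esub>" if "x \<in> carrier ?T" for x
    using tensor_elementary[OF resolution_kernel_comm] that by (simp add: elementary_2_group_def)
  moreover have "comm_group (Tor G Z2)"
    unfolding Tor by (rule T.abelian_subgroup_generated[OF T.comm_group_axioms])
  moreover have "x \<otimes>\<^bsub>Tor G Z2\<^esub> y = x \<otimes>\<^bsub>?T\<^esub> y" "\<one>\<^bsub>Tor G Z2\<^esub> = \<one>\<^bsub>?T\<^esub>" for x y
    unfolding Tor by simp_all
  ultimately show "elementary_2_group (Tor G Z2)"
    unfolding elementary_2_group_def using sub by (simp add: subset_iff)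
qed

text \<open>Halving r = 2 j and evaluating j identifies (R \<inter> 2 F) / 2 R with the two-torsion
  of \<open>G\<close>: the value of j squares to one because r evaluates to one, and two halves have
  equal values exactly when they differ by an element of R.\<close>

lemma card_Tor: "card (carrier (Tor G Z2)) = card {g \<in> carrier G. g \<otimes>\<^bsub>G\<^esub> g = \<one>\<^bsub>G\<^esub>}"
proof -
  define X where "X = {r \<in> carrier R. \<exists>j\<in>carrier free_on_G. r = j + j}"
  define half where "half = (\<lambda>r :: 'g \<Rightarrow>\<^sub>0 int. SOME j. r = j + j)"
  have half: "half (j + j) = j" for j
    unfolding half_def by (rule some_equality) (simp_all add: frag_double_inject)
  have X: "r \<in> X \<longleftrightarrow> (\<exists>j. r = j + j \<and> Poly_Mapping.keys j \<subseteq> carrier G \<and>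
      resolution_eval G j \<otimes>\<^bsub>G\<^esub> resolution_eval G j = \<one>\<^bsub>G\<^esub>)" for r
  proof
    assume "r \<in> X"
    then show "\<exists>j. r = j + j \<and> Poly_Mapping.keys j \<subseteq> carrier G \<and>
      resolution_eval G j \<otimes>\<^bsub>G\<^esub> resolution_eval G j = \<one>\<^bsub>G\<^esub>"
      by (auto simp: X_def carrier_resolution_kernel resolution_eval_add)
  next
    assume "\<exists>j. r = j + j \<and> Poly_Mapping.keys j \<subseteq> carrier G \<and>
      resolution_eval G j \<otimes>\<^bsub>G\<^esub> resolution_eval G j = \<one>\<^bsub>G\<^esub>"
    then obtain j where j: "r = j + j" "Poly_Mapping.keys j \<subseteq> carrier G"
      "resolution_eval G j \<otimes>\<^bsub>G\<^esub> resolution_eval G j = \<one>\<^bsub>G\<^esub>" by blast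
    have "Poly_Mapping.keys (j + j) \<subseteq> carrier G" using keys_add[of j j] j(2) by simp
    then show "r \<in> X" using j by (auto simp: X_def carrier_resolution_kernel resolution_eval_add)
  qed
  have "card (mod_two R ` X) = card ((\<lambda>r. resolution_eval G (half r)) ` X)"
  proof (rule card_image_same_fibers)
    fix r s assume rs: "r \<in> X" "s \<in> X"
    obtain i where i: "r = i + i" "Poly_Mapping.keys i \<subseteq> carrier G" using rs(1) X by blast
    obtain j where j: "s = j + j" "Poly_Mapping.keys j \<subseteq> carrier G" using rs(2) X by blast
    have ij: "i = j + (i - j)" "Poly_Mapping.keys (i - j) \<subseteq> carrier G"
      by simp (rule order_trans[OF keys_diff], simp add: i(2) j(2))
    have cl: "resolution_eval G c \<in> carrier G" if "Poly_Mapping.keys c \<subseteq> carrier G" for c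
      using ev.hom_closed[of c] that by simp
    have "mod_two R r = mod_two R s \<longleftrightarrow> (\<exists>k\<in>carrier R. r = s + (k + k))"
      using mod_two_eq_iff[OF resolution_kernel_comm, of r s] rs by (simp add: X_def mult_resolution_kernel)
    also have "\<dots> \<longleftrightarrow> i - j \<in> carrier R"
    proof
      assume "\<exists>k\<in>carrier R. r = s + (k + k)"
      then obtain k where k: "k \<in> carrier R" "i + i = (j + k) + (j + k)"
        unfolding i(1) j(1) by (auto simp: algebra_simps)
      then have "i - j = k" unfolding frag_double_inject by simp
      then show "i - j \<in> carrier R" using k(1) by simp
    next
      assume "i - j \<in> carrier R"
      moreover have "r = s + ((i - j) + (i - j))" unfolding i(1) j(1) by (simp add: algebra_simps)
      ultimately show "\<exists>k\<in>carrier R. r = s + (k + k)" by blast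
    qed
    also have "\<dots> \<longleftrightarrow> resolution_eval G (i - j) = \<one>\<^bsub>G\<^esub>"
      using ij(2) by (simp add: carrier_resolution_kernel)
    also have "\<dots> \<longleftrightarrow> resolution_eval G i = resolution_eval G j"
      using resolution_eval_add[OF j(2) ij(2)] ij(1) cl[OF j(2)] cl[OF ij(2)] by (metis G.l_cancel_one')
    finally show "mod_two R r = mod_two R s \<longleftrightarrow> resolution_eval G (half r) = resolution_eval G (half s)"
      by (simp only: i(1) j(1) half)
  qed
  also have "(\<lambda>r. resolution_eval G (half r)) ` X = {g \<in> carrier G. g \<otimes>\<^bsub>G\<^esub> g = \<one>\<^bsub>G\<^esub>}"
  proof (intro subset_antisym subsetI)
    fix g assume "g \<in> (\<lambda>r. resolution_eval G (half r)) ` X"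
    then obtain r where "r \<in> X" "g = resolution_eval G (half r)" by blast
    then obtain j where "g = resolution_eval G j" "Poly_Mapping.keys j \<subseteq> carrier G"
      "resolution_eval G j \<otimes>\<^bsub>G\<^esub> resolution_eval G j = \<one>\<^bsub>G\<^esub>" using X half by auto
    then show "g \<in> {g \<in> carrier G. g \<otimes>\<^bsub>G\<^esub> g = \<one>\<^bsub>G\<^esub>}" using ev.hom_closed[of j] by simp
  next
    fix g assume g: "g \<in> {g \<in> carrier G. g \<otimes>\<^bsub>G\<^esub> g = \<one>\<^bsub>G\<^esub>}"
    \<comment> \<open>The double of the generator at \<open>g\<close> has a half whose value is
      \<open>g\<close>.\<close>
    then have "frag_of g + frag_of g \<in> X"
      unfolding X by (intro exI[of _ "frag_of g"]) (simp add: keys_frag_of resolution_eval_frag_of)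
    then show "g \<in> (\<lambda>r. resolution_eval G (half r)) ` X"
      by (rule rev_image_eqI) (use g in \<open>simp add: half resolution_eval_frag_of\<close>)
  qed
  finally show ?thesis unfolding Tor_structure(2) X_def .
qed

end

section \<open>Universal coefficients modulo two\<close>

definition additive_map :: "(('b \<Rightarrow>\<^sub>0 int) \<Rightarrow> ('c \<Rightarrow>\<^sub>0 int)) \<Rightarrow> bool" where
  "additive_map d \<longleftrightarrow> (\<forall>a b. d (a - b) = d a - d b)"

lemma additive_mapD:
  assumes "additive_map d"
  shows "d (a - b) = d a - d b" "d 0 = 0" "d (- a) = - d a" "d (a + b) = d a + d b"
proof -
  show diff: "d (a - b) = d a - d b" for a b using assms by (simp add: additive_map_def)
  show zero: "d 0 = 0" using diff[of 0 0] by simp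
  show neg: "d (- a) = - d a" for a using diff[of 0 a] zero by simp
  show "d (a + b) = d a + d b" using diff[of a "- b"] neg[of b] by simp
qed

abbreviation chains_on :: "'b set \<Rightarrow> ('b \<Rightarrow>\<^sub>0 int) set" where
  "chains_on A \<equiv> {c. Poly_Mapping.keys c \<subseteq> A}"

definition is_double :: "('b \<Rightarrow>\<^sub>0 int) \<Rightarrow> bool" where
  "is_double c \<longleftrightarrow> (\<exists>e. c = e + e)"

lemma even_lookups_double:
  assumes "\<And>a. even (Poly_Mapping.lookup c a)"
  shows "is_double c"
proof -
  define e where "e = Poly_Mapping.map (\<lambda>v. v div 2) c"
  have lookup_e: "Poly_Mapping.lookup e a = Poly_Mapping.lookup c a div 2" for a
    by (simp add: e_def Poly_Mapping.map.rep_eq when_def)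
  have "c = e + e"
  proof (rule poly_mapping_eqI)
    fix a
    have "Poly_Mapping.lookup c a = Poly_Mapping.lookup e a + Poly_Mapping.lookup e a"
      unfolding lookup_e using assms[of a] by presburger
    then show "Poly_Mapping.lookup c a = Poly_Mapping.lookup (e + e) a" by (simp add: lookup_add)
  qed
  then show ?thesis by (auto simp: is_double_def)
qed

lemma is_double_chains:
  assumes "is_double c" "c \<in> chains_on A"
  shows "\<exists>e\<in>chains_on A. c = e + e"
proof -
  obtain e where e: "c = e + e" using assms(1) by (auto simp: is_double_def)
  have "Poly_Mapping.keys e \<subseteq> Poly_Mapping.keys c"
  proof
    fix a assume "a \<in> Poly_Mapping.keys e"
    then show "a \<in> Poly_Mapping.keys c" by (simp add: e in_keys_iff lookup_add)
  qed
  then show ?thesis using e assms(2) by (intro bexI[of _ e]) simp_all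
qed

lemma add_subgroup_chains: "add_subgroup (chains_on A)"
  unfolding add_subgroup_def by (auto simp: order_trans[OF keys_diff])

lemma add_subgroupI: "0 \<in> T \<Longrightarrow> (\<And>a b. a \<in> T \<Longrightarrow> b \<in> T \<Longrightarrow> a - b \<in> T) \<Longrightarrow> add_subgroup T"
  by (simp add: add_subgroup_def)

lemma add_subgroup_Int: "add_subgroup S \<Longrightarrow> add_subgroup T \<Longrightarrow> add_subgroup (S \<inter> T)"
  by (simp add: add_subgroup_def)

lemma add_subgroup_image:
  assumes "additive_map d" "add_subgroup T"
  shows "add_subgroup (d ` T)"
proof (rule add_subgroupI)
  show "0 \<in> d ` T"
    using additive_mapD(2)[OF assms(1)] add_subgroupD(1)[OF assms(2)] by (metis image_eqI)
  fix a b assume "a \<in> d ` T" "b \<in> d ` T"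
  then obtain u v where "u \<in> T" "a = d u" "v \<in> T" "b = d v" by blast
  then show "a - b \<in> d ` T"
    using additive_mapD(1)[OF assms(1), of u v] add_subgroupD(2)[OF assms(2), of u v] by (metis image_eqI)
qed

lemma subgroup_freeI:
  assumes "add_subgroup T" "T \<subseteq> chains_on A"
  shows "subgroup T (free_Abelian_group A)"
proof (rule group.subgroupI[OF group_free_Abelian_group])
  show "T \<subseteq> carrier (free_Abelian_group A)" using assms(2) by auto
  show "T \<noteq> {}" using add_subgroupD(1)[OF assms(1)] by blast
  show "inv\<^bsub>free_Abelian_group A\<^esub> a \<in> T" if "a \<in> T" for a
    using add_subgroupD(3)[OF assms(1) that] assms(2) that by (simp add: subset_iff)
  show "a \<otimes>\<^bsub>free_Abelian_group A\<^esub> b \<in> T" if "a \<in> T" "b \<in> T" for a b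
    using add_subgroupD(4)[OF assms(1) that] by simp
qed

section \<open>Integral homology modulo two and its two-torsion\<close>

context
  fixes P A N :: "'b set" and d
  assumes d: "additive_map d"
    and B_sub: "d ` chains_on P \<subseteq> {c \<in> chains_on A. d c = 0}"
begin

abbreviation (input) "cycles_at \<equiv> {c \<in> chains_on A. d c = 0}"
abbreviation (input) "boundaries_at \<equiv> d ` chains_on P"
abbreviation (input) "homology \<equiv> homology_at (free_Abelian_group P) (free_Abelian_group A) (free_Abelian_group N) d"

lemma cycles_add_subgroup: "add_subgroup cycles_at"
proof (rule add_subgroupI)
  show "0 \<in> cycles_at" using additive_mapD(2)[OF d] by simp
  fix a b assume "a \<in> cycles_at" "b \<in> cycles_at"
  then show "a - b \<in> cycles_at"
    using additive_mapD(1)[OF d, of a b] add_subgroupD(2)[OF add_subgroup_chains, of a A b] by simp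
qed

lemma boundaries_add_subgroup: "add_subgroup boundaries_at"
  by (rule add_subgroup_image[OF d add_subgroup_chains])

lemma homology_structure:
  shows "comm_group homology"
    and "carrier homology = add_coset boundaries_at ` cycles_at"
    and "z \<in> cycles_at \<Longrightarrow> w \<in> cycles_at \<Longrightarrow>
      add_coset boundaries_at z \<otimes>\<^bsub>homology\<^esub> add_coset boundaries_at w = add_coset boundaries_at (z + w)"
    and "\<one>\<^bsub>homology\<^esub> = boundaries_at"
proof -
  let ?F = "free_Abelian_group A"
  define S where "S = subgroup_generated ?F cycles_at"
  have P: "carrier (free_Abelian_group P) = chains_on P" by auto
  have ker: "kernel ?F (free_Abelian_group N) d = cycles_at" by (auto simp: kernel_def)
  have H: "homology = S Mod boundaries_at"
    unfolding homology_at_def ker P S_def ..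
  have Z: "subgroup cycles_at ?F" by (rule subgroup_freeI[OF cycles_add_subgroup]) blast
  have S_carrier: "carrier S = cycles_at"
    unfolding S_def by (rule subgroup.carrier_subgroup_generated_subgroup[OF Z])
  have S_mult: "x \<otimes>\<^bsub>S\<^esub> y = x + y" for x y by (simp add: S_def)
  interpret S: comm_group S
    unfolding S_def by (rule group.abelian_subgroup_generated[OF group_free_Abelian_group abelian_free_Abelian_group])
  have B: "subgroup boundaries_at S"
    unfolding S_def
    by (rule group.subgroup_of_subgroup_generated[OF group_free_Abelian_group _ subgroup_freeI[OF boundaries_add_subgroup]])
      (use B_sub in blast)+
  have coset: "boundaries_at #>\<^bsub>S\<^esub> z = add_coset boundaries_at z" for z
    unfolding r_coset_def add_coset_def S_mult by blast
  show "comm_group homology" unfolding H by (rule S.abelian_FactGroup[OF B])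
  show "carrier homology = add_coset boundaries_at ` cycles_at"
    unfolding H carrier_FactGroup coset S_carrier ..
  show "\<one>\<^bsub>homology\<^esub> = boundaries_at" unfolding H by simp
  have n: "boundaries_at \<lhd> S" by (rule S.subgroup_imp_normal[OF B])
  show "add_coset boundaries_at z \<otimes>\<^bsub>homology\<^esub> add_coset boundaries_at w = add_coset boundaries_at (z + w)"
    if "z \<in> cycles_at" "w \<in> cycles_at"
    using normal.rcos_sum[OF n, unfolded S_carrier coset S_mult, OF that] unfolding H by simp
qed

text \<open>With cycles Z and boundaries B, H / 2 H is Z / (B + 2 Z), so the order becomes an index
  of groups of chains.\<close>

lemma card_homology_tensor:
  "card (carrier (tensor_product homology Z2))
    = card (add_coset {b + (z + z) | b z. b \<in> boundaries_at \<and> z \<in> cycles_at} ` cycles_at)"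
proof -
  let ?B = boundaries_at and ?Z = cycles_at
  define W where "W = {b + (z + z) | b z. b \<in> ?B \<and> z \<in> ?Z}"
  note addB = add_subgroupD[OF boundaries_add_subgroup] and addZ = add_subgroupD[OF cycles_add_subgroup]
  have W: "add_subgroup W"
  proof (rule add_subgroupI)
    have "0 = 0 + (0 + (0 :: 'b \<Rightarrow>\<^sub>0 int))" by simp
    then show "0 \<in> W" unfolding W_def using addB(1) addZ(1) by blast
    fix a b assume "a \<in> W" "b \<in> W"
    then obtain u z v w where "u \<in> ?B" "z \<in> ?Z" "a = u + (z + z)" "v \<in> ?B" "w \<in> ?Z" "b = v + (w + w)"
      unfolding W_def by blast
    then have "a - b = (u - v) + ((z - w) + (z - w))" "u - v \<in> ?B" "z - w \<in> ?Z"
      using addB(2)[of u v] addZ(2)[of z w] by (simp_all add: algebra_simps)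
    then show "a - b \<in> W" unfolding W_def by blast
  qed
  note hs = homology_structure
  have "card (carrier (tensor_product homology Z2)) = card ((\<lambda>z. mod_two homology (add_coset ?B z)) ` ?Z)"
    unfolding tensor_carrier[OF hs(1)] hs(2) image_image ..
  also have "\<dots> = card (add_coset W ` ?Z)"
  proof (rule card_image_same_fibers)
    fix z w assume z: "z \<in> ?Z" and w: "w \<in> ?Z"
    have mem: "add_coset ?B z \<in> carrier homology" "add_coset ?B w \<in> carrier homology"
      using z w unfolding hs(2) by blast+
    have "mod_two homology (add_coset ?B z) = mod_two homology (add_coset ?B w) \<longleftrightarrow>
        (\<exists>v\<in>?Z. add_coset ?B z = add_coset ?B w \<otimes>\<^bsub>homology\<^esub> (add_coset ?B v \<otimes>\<^bsub>homology\<^esub> add_coset ?B v))"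
      unfolding mod_two_eq_iff[OF hs(1) mem] unfolding hs(2) by blast
    also have "\<dots> \<longleftrightarrow> (\<exists>v\<in>?Z. z - (w + (v + v)) \<in> ?B)"
    proof (rule bex_cong[OF refl])
      fix v assume v: "v \<in> ?Z"
      have "add_coset ?B w \<otimes>\<^bsub>homology\<^esub> (add_coset ?B v \<otimes>\<^bsub>homology\<^esub> add_coset ?B v) = add_coset ?B (w + (v + v))"
        unfolding hs(3)[OF v v] by (rule hs(3)[OF w addZ(4)[OF v v]])
      then show "add_coset ?B z = add_coset ?B w \<otimes>\<^bsub>homology\<^esub> (add_coset ?B v \<otimes>\<^bsub>homology\<^esub> add_coset ?B v)
          \<longleftrightarrow> z - (w + (v + v)) \<in> ?B"
        by (simp only: add_coset_eq[OF boundaries_add_subgroup])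
    qed
    also have "\<dots> \<longleftrightarrow> z - w \<in> W"
    proof
      assume "\<exists>v\<in>?Z. z - (w + (v + v)) \<in> ?B"
      then obtain v where v: "v \<in> ?Z" "z - (w + (v + v)) \<in> ?B" by blast
      have "z - w = (z - (w + (v + v))) + (v + v)" by (simp add: algebra_simps)
      then show "z - w \<in> W" unfolding W_def using v by blast
    next
      assume "z - w \<in> W"
      then obtain b v where v: "v \<in> ?Z" "b \<in> ?B" "z - w = b + (v + v)" unfolding W_def by blast
      then have "z - (w + (v + v)) = b" by (simp add: algebra_simps)
      then show "\<exists>v\<in>?Z. z - (w + (v + v)) \<in> ?B" using v by blast
    qed
    also have "\<dots> \<longleftrightarrow> add_coset W z = add_coset W w" by (rule add_coset_eq[OF W, symmetric])
    finally show "mod_two homology (add_coset ?B z) = mod_two homology (add_coset ?B w) \<longleftrightarrow> add_coset W z = add_coset W w" .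
  qed
  finally show ?thesis unfolding W_def .
qed

text \<open>A homology class is two-torsion when the double of a representing cycle is a
  boundary.\<close>

lemma card_homology_Tor:
  "card (carrier (Tor homology Z2)) = card (add_coset boundaries_at ` {z \<in> cycles_at. z + z \<in> boundaries_at})"
proof -
  note hs = homology_structure
  have sq: "add_coset boundaries_at z \<otimes>\<^bsub>homology\<^esub> add_coset boundaries_at z = \<one>\<^bsub>homology\<^esub> \<longleftrightarrow> z + z \<in> boundaries_at"
    if "z \<in> cycles_at" for z
  proof -
    have "boundaries_at = add_coset boundaries_at 0" by (simp add: add_coset_def)
    then show ?thesis
      unfolding hs(3)[OF that that] hs(4) using add_coset_eq[OF boundaries_add_subgroup, of "z + z" 0] by simp
  qed
  have "{g \<in> carrier homology. g \<otimes>\<^bsub>homology\<^esub> g = \<one>\<^bsub>homology\<^esub>}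
    = add_coset boundaries_at ` {z \<in> cycles_at. z + z \<in> boundaries_at}"
    unfolding hs(2)
  proof (intro subset_antisym subsetI)
    fix g assume "g \<in> {g \<in> add_coset boundaries_at ` cycles_at. g \<otimes>\<^bsub>homology\<^esub> g = \<one>\<^bsub>homology\<^esub>}"
    then obtain z where z: "z \<in> cycles_at" "g = add_coset boundaries_at z"
      "g \<otimes>\<^bsub>homology\<^esub> g = \<one>\<^bsub>homology\<^esub>" by blast
    have "z + z \<in> boundaries_at" using sq[OF z(1)] z(2,3) by simp
    then show "g \<in> add_coset boundaries_at ` {z \<in> cycles_at. z + z \<in> boundaries_at}"
      using z(1,2) by blast
  next
    fix g assume "g \<in> add_coset boundaries_at ` {z \<in> cycles_at. z + z \<in> boundaries_at}"
    then obtain z where z: "z \<in> cycles_at" "z + z \<in> boundaries_at" "g = add_coset boundaries_at z" by blast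
    then show "g \<in> {g \<in> add_coset boundaries_at ` cycles_at. g \<otimes>\<^bsub>homology\<^esub> g = \<one>\<^bsub>homology\<^esub>}"
      using sq[OF z(1)] by simp
  qed
  then show ?thesis unfolding card_Tor[OF hs(1)] by simp
qed

end

text \<open>Multiplicativity of the index. It is obtained from an identification with a product of
  quotients, so it also holds for infinite indices, where \<open>card\<close> is 0.\<close>

lemma card_coset_tower:
  assumes W: "add_subgroup W" and V: "add_subgroup V" and X: "add_subgroup X" and "W \<subseteq> V" "V \<subseteq> X"
  shows "card (add_coset W ` X) = card (add_coset V ` X) * card (add_coset W ` V)"
proof -
  define r where "r = (\<lambda>Q. SOME x. x \<in> X \<and> add_coset V x = Q)"
  have r: "r Q \<in> X \<and> add_coset V (r Q) = Q" if "Q \<in> add_coset V ` X" for Q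
    unfolding r_def by (rule someI_ex) (use that in blast)
  \<comment> \<open>\<open>s x\<close> is the chosen representative of the coset of \<open>x\<close>
    under \<open>V\<close>; the difference \<open>x - s x\<close> carries the remaining coordinate
    modulo \<open>W\<close>.\<close>
  define s where "s = (\<lambda>x. r (add_coset V x))"
  have s: "s x \<in> X" "x - s x \<in> V" if "x \<in> X" for x
  proof -
    have rx: "s x \<in> X \<and> add_coset V (s x) = add_coset V x"
      unfolding s_def by (rule r) (use that in blast)
    then show "s x \<in> X" by blast
    have "add_coset V x = add_coset V (s x)" using rx by simp
    then show "x - s x \<in> V" unfolding add_coset_eq[OF V] .
  qed
  have "card (add_coset W ` X) = card ((\<lambda>x. (add_coset V x, add_coset W (x - s x))) ` X)"
  proof (rule card_image_same_fibers)
    fix x y assume xy: "x \<in> X" "y \<in> X"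
    show "add_coset W x = add_coset W y \<longleftrightarrow>
      (add_coset V x, add_coset W (x - s x)) = (add_coset V y, add_coset W (y - s y))"
    proof
      assume eq: "add_coset W x = add_coset W y"
      then have "x - y \<in> W" unfolding add_coset_eq[OF W] .
      then have "add_coset V x = add_coset V y" unfolding add_coset_eq[OF V] using assms(4) by blast
      moreover from this have "s x = s y" by (simp add: s_def)
      moreover from this have "add_coset W (x - s x) = add_coset W (y - s y)"
        unfolding add_coset_eq[OF W] using \<open>x - y \<in> W\<close> by simp
      ultimately show "(add_coset V x, add_coset W (x - s x)) = (add_coset V y, add_coset W (y - s y))" by simp
    next
      assume "(add_coset V x, add_coset W (x - s x)) = (add_coset V y, add_coset W (y - s y))"
      then have eq: "add_coset V x = add_coset V y" "(x - s x) - (y - s y) \<in> W"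
        using add_coset_eq[OF W] by simp_all
      have "s x = s y" using eq(1) by (simp add: s_def)
      with eq(2) show "add_coset W x = add_coset W y" unfolding add_coset_eq[OF W] by simp
    qed
  qed
  also have "(\<lambda>x. (add_coset V x, add_coset W (x - s x))) ` X = (add_coset V ` X) \<times> (add_coset W ` V)"
  proof (intro subset_antisym subsetI)
    fix p assume "p \<in> (\<lambda>x. (add_coset V x, add_coset W (x - s x))) ` X"
    then show "p \<in> (add_coset V ` X) \<times> (add_coset W ` V)" using s(2) by blast
  next
    fix p assume "p \<in> (add_coset V ` X) \<times> (add_coset W ` V)"
    then obtain x v where p: "x \<in> X" "v \<in> V" "p = (add_coset V x, add_coset W v)" by blast
    let ?y = "s x + v"
    have y: "?y \<in> X" using add_subgroupD(4)[OF X s(1)[OF p(1)]] p(2) assms(5) by blast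
    have yx: "?y - x = v - (x - s x)" by simp
    have "?y - x \<in> V" unfolding yx by (rule add_subgroupD(2)[OF V p(2) s(2)[OF p(1)]])
    then have eq: "add_coset V ?y = add_coset V x" unfolding add_coset_eq[OF V] .
    then have "s ?y = s x" by (simp add: s_def)
    then have "p = (add_coset V ?y, add_coset W (?y - s ?y))" using p(3) eq by simp
    then show "p \<in> (\<lambda>x. (add_coset V x, add_coset W (x - s x))) ` X" using y by blast
  qed
  finally show ?thesis by (simp add: card_cartesian_product)
qed

text \<open>Four consecutive terms appear because the Tor summand in the degree of \<open>A1\<close>
  uses the homology at \<open>A2\<close>, whose definition mentions \<open>A3\<close>.\<close>

locale finite_complex =
  fixes A0 A1 A2 A3 :: "'b set" and d :: "('b \<Rightarrow>\<^sub>0 int) \<Rightarrow> ('b \<Rightarrow>\<^sub>0 int)"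
  assumes d: "additive_map d" and fin: "finite A1"
    and maps: "c \<in> chains_on A0 \<Longrightarrow> d c \<in> chains_on A1" "c \<in> chains_on A1 \<Longrightarrow> d c \<in> chains_on A2"
      "c \<in> chains_on A2 \<Longrightarrow> d c \<in> chains_on A3"
    and square: "c \<in> chains_on A0 \<Longrightarrow> d (d c) = 0" "c \<in> chains_on A1 \<Longrightarrow> d (d c) = 0"
begin

text \<open>Cycles and boundaries of the reduction modulo two, lifted to integral chains.\<close>

definition mod2_cycles :: "('b \<Rightarrow>\<^sub>0 int) set" where
  "mod2_cycles = {c \<in> chains_on A1. \<exists>n\<in>chains_on A2. d c = n + n}"

definition mod2_boundaries :: "('b \<Rightarrow>\<^sub>0 int) set" where
  "mod2_boundaries = {d b + (c + c) | b c. b \<in> chains_on A0 \<and> c \<in> chains_on A1}"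

text \<open>The cycles modulo two that are congruent to integral cycles. They form the middle term
  that separates the tensor summand from the Tor summand.\<close>

definition lifted_cycles :: "('b \<Rightarrow>\<^sub>0 int) set" where
  "lifted_cycles = {z + (c + c) | z c. z \<in> chains_on A1 \<and> d z = 0 \<and> c \<in> chains_on A1}"

abbreviation (input) "H1 \<equiv> homology_at (free_Abelian_group A0) (free_Abelian_group A1) (free_Abelian_group A2) d"
abbreviation (input) "H2 \<equiv> homology_at (free_Abelian_group A1) (free_Abelian_group A2) (free_Abelian_group A3) d"

lemma boundaries_subset:
  "d ` chains_on A0 \<subseteq> {c \<in> chains_on A1. d c = 0}" "d ` chains_on A1 \<subseteq> {c \<in> chains_on A2. d c = 0}"
proof -
  show "d ` chains_on A0 \<subseteq> {c \<in> chains_on A1. d c = 0}"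
  proof (rule image_subsetI)
    fix c assume c: "c \<in> chains_on A0"
    show "d c \<in> {c \<in> chains_on A1. d c = 0}" using maps(1)[OF c] square(1)[OF c] by simp
  qed
  show "d ` chains_on A1 \<subseteq> {c \<in> chains_on A2. d c = 0}"
  proof (rule image_subsetI)
    fix c assume c: "c \<in> chains_on A1"
    show "d c \<in> {c \<in> chains_on A2. d c = 0}" using maps(2)[OF c] square(2)[OF c] by simp
  qed
qed

lemma mod2_cyclesI: "c \<in> chains_on A1 \<Longrightarrow> n \<in> chains_on A2 \<Longrightarrow> d c = n + n \<Longrightarrow> c \<in> mod2_cycles"
  unfolding mod2_cycles_def by blast

lemma mod2_boundariesI:
  "b \<in> chains_on A0 \<Longrightarrow> c \<in> chains_on A1 \<Longrightarrow> x = d b + (c + c) \<Longrightarrow> x \<in> mod2_boundaries"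
  unfolding mod2_boundaries_def by blast

lemma lifted_cyclesI:
  "z \<in> chains_on A1 \<Longrightarrow> c \<in> chains_on A1 \<Longrightarrow> x = z + (c + c) \<Longrightarrow> d z = 0 \<Longrightarrow> x \<in> lifted_cycles"
  unfolding lifted_cycles_def by blast

lemmas d_simps = additive_mapD[OF d]
lemmas chainsD = add_subgroupD[OF add_subgroup_chains]

lemma mod2_add_subgroups:
  "add_subgroup mod2_cycles" "add_subgroup mod2_boundaries" "add_subgroup lifted_cycles"
proof -
  show "add_subgroup mod2_cycles"
  proof (rule add_subgroupI)
    have "d 0 = 0 + 0" by (simp add: d_simps)
    then show "0 \<in> mod2_cycles" by (rule mod2_cyclesI[OF chainsD(1) chainsD(1)])
    fix a b assume "a \<in> mod2_cycles" "b \<in> mod2_cycles"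
    then obtain m n where mn: "a \<in> chains_on A1" "m \<in> chains_on A2" "d a = m + m" "b \<in> chains_on A1" "n \<in> chains_on A2" "d b = n + n"
      unfolding mod2_cycles_def by blast
    have "d (a - b) = (m - n) + (m - n)" using mn by (simp add: d_simps)
    then show "a - b \<in> mod2_cycles"
      by (rule mod2_cyclesI[OF chainsD(2)[OF mn(1,4)] chainsD(2)[OF mn(2,5)]])
  qed
  show "add_subgroup mod2_boundaries"
  proof (rule add_subgroupI)
    have "0 = d 0 + (0 + 0)" by (simp add: d_simps)
    then show "0 \<in> mod2_boundaries" by (rule mod2_boundariesI[OF chainsD(1) chainsD(1)])
    fix x y assume "x \<in> mod2_boundaries" "y \<in> mod2_boundaries"
    then obtain a b u v where ab: "a \<in> chains_on A0" "u \<in> chains_on A1" "x = d a + (u + u)"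
        "b \<in> chains_on A0" "v \<in> chains_on A1" "y = d b + (v + v)"
      unfolding mod2_boundaries_def by blast
    have "x - y = d (a - b) + ((u - v) + (u - v))" using ab by (simp add: d_simps algebra_simps)
    then show "x - y \<in> mod2_boundaries"
      by (rule mod2_boundariesI[OF chainsD(2)[OF ab(1,4)] chainsD(2)[OF ab(2,5)]])
  qed
  show "add_subgroup lifted_cycles"
  proof (rule add_subgroupI)
    have "0 = 0 + (0 + (0 :: 'b \<Rightarrow>\<^sub>0 int))" by simp
    then show "0 \<in> lifted_cycles" by (rule lifted_cyclesI[OF chainsD(1) chainsD(1) _ d_simps(2)])
    fix x y assume "x \<in> lifted_cycles" "y \<in> lifted_cycles"
    then obtain a b u v where ab: "a \<in> chains_on A1" "d a = 0" "u \<in> chains_on A1" "x = a + (u + u)"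
        "b \<in> chains_on A1" "d b = 0" "v \<in> chains_on A1" "y = b + (v + v)"
      unfolding lifted_cycles_def by blast
    have "x - y = (a - b) + ((u - v) + (u - v))" "d (a - b) = 0"
      using ab by (simp_all add: d_simps algebra_simps)
    then show "x - y \<in> lifted_cycles"
      by (rule lifted_cyclesI[OF chainsD(2)[OF ab(1,5)] chainsD(2)[OF ab(3,7)]])
  qed
qed

lemma mod2_subsets: "mod2_boundaries \<subseteq> lifted_cycles" "lifted_cycles \<subseteq> mod2_cycles"
proof
  fix x assume "x \<in> mod2_boundaries"
  then obtain b c where b: "b \<in> chains_on A0" "c \<in> chains_on A1" "x = d b + (c + c)"
    unfolding mod2_boundaries_def by blast
  show "x \<in> lifted_cycles" by (rule lifted_cyclesI[OF maps(1)[OF b(1)] b(2,3) square(1)[OF b(1)]])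
next
  show "lifted_cycles \<subseteq> mod2_cycles"
  proof
    fix x assume "x \<in> lifted_cycles"
    then obtain z c where zc: "z \<in> chains_on A1" "d z = 0" "c \<in> chains_on A1" "x = z + (c + c)"
      unfolding lifted_cycles_def by blast
    have dx: "d x = d c + d c" using zc by (simp add: d_simps)
    have "x \<in> chains_on A1" unfolding zc(4) by (rule chainsD(4)[OF zc(1) chainsD(4)[OF zc(3,3)]])
    then show "x \<in> mod2_cycles" by (rule mod2_cyclesI[OF _ maps(2)[OF zc(3)] dx])
  qed
qed

text \<open>By the second isomorphism theorem the index is that of Z \<inter> (B + 2 C) in Z. If b +
  2 c is a cycle then so is c, hence this intersection is B + 2 Z.\<close>

lemma card_tensor_H1: "card (carrier (tensor_product H1 Z2)) = card (add_coset mod2_boundaries ` lifted_cycles)"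
proof -
  let ?Z = "{c \<in> chains_on A1. d c = 0}"
  define W where "W = {b + (z + z) | b z. b \<in> d ` chains_on A0 \<and> z \<in> ?Z}"
  have W: "W = ?Z \<inter> mod2_boundaries"
  proof (intro subset_antisym subsetI)
    fix x assume "x \<in> W"
    then obtain b z where b: "b \<in> chains_on A0" "z \<in> ?Z" "x = d b + (z + z)" unfolding W_def by blast
    have "z + z \<in> chains_on A1" using b(2) chainsD(4)[of z A1 z] by simp
    then have "x \<in> chains_on A1" unfolding b(3) by (rule chainsD(4)[OF maps(1)[OF b(1)]])
    moreover have "d x = 0" using b square(1) by (simp add: d_simps)
    ultimately show "x \<in> ?Z \<inter> mod2_boundaries" using mod2_boundariesI[OF b(1) _ b(3)] b(2) by simp
  next
    fix x assume x: "x \<in> ?Z \<inter> mod2_boundaries"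
    then obtain b c where bc: "b \<in> chains_on A0" "c \<in> chains_on A1" "x = d b + (c + c)"
      unfolding mod2_boundaries_def by blast
    have "d c + d c = 0 + 0" using x bc(3) square(1)[OF bc(1)] by (simp add: d_simps)
    then have "d c = 0" unfolding frag_double_inject .
    then show "x \<in> W" unfolding W_def using bc by blast
  qed
  note B = mod2_add_subgroups(2)
  have "card (carrier (tensor_product H1 Z2)) = card (add_coset W ` ?Z)"
    using card_homology_tensor[OF d boundaries_subset(1)] unfolding W_def .
  also have "\<dots> = card (add_coset mod2_boundaries ` ?Z)"
  proof (rule card_image_same_fibers)
    fix z w assume zw: "z \<in> ?Z" "w \<in> ?Z"
    have Z: "add_subgroup ?Z" by (rule cycles_add_subgroup[OF d boundaries_subset(1)])
    have W': "add_subgroup W"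
      unfolding W by (rule add_subgroup_Int[OF Z B])
    have mem: "z - w \<in> W \<longleftrightarrow> z - w \<in> mod2_boundaries"
      unfolding W using add_subgroupD(2)[OF Z zw] by blast
    show "add_coset W z = add_coset W w \<longleftrightarrow> add_coset mod2_boundaries z = add_coset mod2_boundaries w"
      using add_coset_eq[OF W', of z w] add_coset_eq[OF B, of z w] mem by simp
  qed
  also have "add_coset mod2_boundaries ` ?Z = add_coset mod2_boundaries ` lifted_cycles"
  proof (intro subset_antisym subsetI)
    fix Q assume "Q \<in> add_coset mod2_boundaries ` ?Z"
    then obtain z where z: "z \<in> ?Z" "Q = add_coset mod2_boundaries z" by blast
    have "z \<in> lifted_cycles" using lifted_cyclesI[OF _ chainsD(1), of z z] z(1) by simp
    then show "Q \<in> add_coset mod2_boundaries ` lifted_cycles" using z(2) by blast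
  next
    fix Q assume "Q \<in> add_coset mod2_boundaries ` lifted_cycles"
    then obtain z c where z: "z \<in> ?Z" "c \<in> chains_on A1" "Q = add_coset mod2_boundaries (z + (c + c))"
      unfolding lifted_cycles_def by blast
    have "(z + (c + c)) - z = d 0 + (c + c)" by (simp add: d_simps)
    then have "(z + (c + c)) - z \<in> mod2_boundaries"
      by (rule mod2_boundariesI[OF chainsD(1) z(2)])
    then have "Q = add_coset mod2_boundaries z" unfolding z(3) add_coset_eq[OF B] .
    then show "Q \<in> add_coset mod2_boundaries ` ?Z" using z(1) by blast
  qed
  finally show ?thesis .
qed

text \<open>This is the Bockstein map: a chain c with d c = 2 n goes to the class of n, which is
  two-torsion since 2 n is a boundary, and every two-torsion class arises so. The kernel consists of
  the chains that differ from an integral cycle by a double.\<close>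

lemma card_Tor_H2: "card (carrier (Tor H2 Z2)) = card (add_coset lifted_cycles ` mod2_cycles)"
proof -
  let ?B = "d ` chains_on A1" and ?Z = "{c \<in> chains_on A2. d c = 0}"
  define half where "half = (\<lambda>x :: 'b \<Rightarrow>\<^sub>0 int. SOME n. x = n + n)"
  have half: "half (n + n) = n" for n
    unfolding half_def by (rule some_equality) (simp_all add: frag_double_inject)
  have B: "add_subgroup ?B" by (rule boundaries_add_subgroup[OF d boundaries_subset(2)])
  have "card (add_coset lifted_cycles ` mod2_cycles) = card ((\<lambda>c. add_coset ?B (half (d c))) ` mod2_cycles)"
  proof (rule card_image_same_fibers)
    fix a b assume ab: "a \<in> mod2_cycles" "b \<in> mod2_cycles"
    then obtain m n where mn: "a \<in> chains_on A1" "d a = m + m" "b \<in> chains_on A1" "d b = n + n"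
      unfolding mod2_cycles_def by blast
    have "a - b \<in> lifted_cycles \<longleftrightarrow> m - n \<in> ?B"
    proof
      assume "a - b \<in> lifted_cycles"
      then obtain z c where zc: "d z = 0" "c \<in> chains_on A1" "a - b = z + (c + c)"
        unfolding lifted_cycles_def by blast
      have "(m - n) + (m - n) = d (a - b)" using mn by (simp add: d_simps)
      also have "\<dots> = d c + d c" using zc by (simp add: d_simps)
      finally have "m - n = d c" unfolding frag_double_inject .
      then show "m - n \<in> ?B" using zc(2) by blast
    next
      assume "m - n \<in> ?B"
      then obtain c where c: "c \<in> chains_on A1" "m - n = d c" by blast
      let ?z = "(a - b) - (c + c)"
      have "d ?z = ((m - n) + (m - n)) - (d c + d c)" using mn by (simp add: d_simps)
      then have dz: "d ?z = 0" unfolding c(2) by simp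
      have "?z \<in> chains_on A1"
        by (rule chainsD(2)[OF chainsD(2)[OF mn(1,3)] chainsD(4)[OF c(1) c(1)]])
      then show "a - b \<in> lifted_cycles" by (rule lifted_cyclesI[OF _ c(1) _ dz]) simp
    qed
    then show "add_coset lifted_cycles a = add_coset lifted_cycles b \<longleftrightarrow>
        add_coset ?B (half (d a)) = add_coset ?B (half (d b))"
      unfolding add_coset_eq[OF mod2_add_subgroups(3)] add_coset_eq[OF B] mn half .
  qed
  also have "(\<lambda>c. add_coset ?B (half (d c))) ` mod2_cycles = add_coset ?B ` {z \<in> ?Z. z + z \<in> ?B}"
  proof (intro subset_antisym subsetI)
    fix Q assume "Q \<in> (\<lambda>c. add_coset ?B (half (d c))) ` mod2_cycles"
    then obtain c n where c: "c \<in> chains_on A1" "n \<in> chains_on A2" "d c = n + n" "Q = add_coset ?B n"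
      unfolding mod2_cycles_def using half by auto
    have "d n + d n = 0 + 0" using square(2)[OF c(1)] c(3) by (simp add: d_simps)
    then have "d n = 0" unfolding frag_double_inject .
    moreover have "n + n \<in> ?B" using c(1) c(3)[symmetric] by (rule rev_image_eqI)
    ultimately show "Q \<in> add_coset ?B ` {z \<in> ?Z. z + z \<in> ?B}" using c(2,4) by blast
  next
    fix Q assume "Q \<in> add_coset ?B ` {z \<in> ?Z. z + z \<in> ?B}"
    then obtain n c where n: "n \<in> chains_on A2" "Q = add_coset ?B n" "c \<in> chains_on A1" "n + n = d c" by blast
    then have "c \<in> mod2_cycles" unfolding mod2_cycles_def by (simp, metis)
    moreover have "Q = add_coset ?B (half (d c))" using n(2) unfolding n(4)[symmetric] half .
    ultimately show "Q \<in> (\<lambda>c. add_coset ?B (half (d c))) ` mod2_cycles" by blast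
  qed
  finally show ?thesis using card_homology_Tor[OF d boundaries_subset(2)] by simp
qed

text \<open>Modulo two a chain is the set of basis elements with odd coefficient, a subset of the
  finite set \<open>A1\<close>.\<close>

lemma finite_mod2: "finite (add_coset mod2_boundaries ` mod2_cycles)"
proof (rule finite_image_coarser)
  let ?p = "\<lambda>c. {a \<in> A1. odd (Poly_Mapping.lookup c a)}"
  show "finite (?p ` mod2_cycles)" using fin by (rule finite_subset[rotated, OF finite_Pow_iff[THEN iffD2]]) blast
  fix x y assume xy: "x \<in> mod2_cycles" "y \<in> mod2_cycles" "?p x = ?p y"
  have ch: "x - y \<in> chains_on A1" using xy(1,2) chainsD(2)[of x A1 y] by (simp add: mod2_cycles_def)
  have "is_double (x - y)"
  proof (rule even_lookups_double)
    fix a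
    show "even (Poly_Mapping.lookup (x - y) a)"
    proof (cases "a \<in> A1")
      case True
      then have "odd (Poly_Mapping.lookup x a) \<longleftrightarrow> odd (Poly_Mapping.lookup y a)" using xy(3) by blast
      then show ?thesis by (simp add: lookup_minus)
    next
      case False
      then have "a \<notin> Poly_Mapping.keys (x - y)" using ch by blast
      then show ?thesis by (simp add: in_keys_iff)
    qed
  qed
  then obtain e where "x - y = e + e" "e \<in> chains_on A1" using is_double_chains[OF _ ch] by blast
  then have "x - y \<in> mod2_boundaries"
    by (intro mod2_boundariesI[OF chainsD(1)]) (simp_all add: d_simps)
  then show "add_coset mod2_boundaries x = add_coset mod2_boundaries y"
    unfolding add_coset_eq[OF mod2_add_subgroups(2)] .
qed

proposition universal_coefficients:
  shows "elementary_2_group (Tor H2 Z2 \<times>\<times> tensor_product H1 Z2)"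
    and "card (carrier (Tor H2 Z2 \<times>\<times> tensor_product H1 Z2)) = card (add_coset mod2_boundaries ` mod2_cycles)"
    and "finite (carrier (Tor H2 Z2 \<times>\<times> tensor_product H1 Z2))"
proof -
  note h = homology_structure(1)[OF d]
  show "elementary_2_group (Tor H2 Z2 \<times>\<times> tensor_product H1 Z2)"
    by (intro elementary_2_group_DirProd Tor_structure(1) tensor_elementary h boundaries_subset)
  show card: "card (carrier (Tor H2 Z2 \<times>\<times> tensor_product H1 Z2)) = card (add_coset mod2_boundaries ` mod2_cycles)"
    using card_coset_tower[OF mod2_add_subgroups(2,3,1) mod2_subsets] card_tensor_H1 card_Tor_H2
    by (simp add: DirProd_def card_cartesian_product)
  \<comment> \<open>\<open>card\<close> is 0 on infinite sets, so the nonzero order of the quotient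
    shows through the equality just proved that the group is finite.\<close>
  have "mod2_cycles \<noteq> {}" using add_subgroupD(1)[OF mod2_add_subgroups(1)] by blast
  then have "card (add_coset mod2_boundaries ` mod2_cycles) \<noteq> 0" using finite_mod2 by simp
  then show "finite (carrier (Tor H2 Z2 \<times>\<times> tensor_product H1 Z2))" using card
    by (intro card_ge_0_finite) simp
qed

end

section \<open>Complexes that become isomorphic after reduction modulo two\<close>

lemma mod2_transport:
  assumes C: "finite_complex A0 A1 A2 A3 d" and C': "finite_complex A0' A1' A2' A3' d'"
    and \<Phi>: "additive_map \<Phi>"
    and maps: "\<And>c. c \<in> chains_on A0 \<Longrightarrow> \<Phi> c \<in> chains_on A0'" "\<And>c. c \<in> chains_on A1 \<Longrightarrow> \<Phi> c \<in> chains_on A1'"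
      "\<And>c. c \<in> chains_on A2 \<Longrightarrow> \<Phi> c \<in> chains_on A2'"
    and comm: "\<And>c. c \<in> chains_on A0 \<Longrightarrow> \<exists>e\<in>chains_on A1'. d' (\<Phi> c) - \<Phi> (d c) = e + e"
      "\<And>c. c \<in> chains_on A1 \<Longrightarrow> \<exists>e\<in>chains_on A2'. d' (\<Phi> c) - \<Phi> (d c) = e + e"
  shows "c \<in> finite_complex.mod2_cycles A1 A2 d \<Longrightarrow> \<Phi> c \<in> finite_complex.mod2_cycles A1' A2' d'"
    and "c \<in> finite_complex.mod2_boundaries A0 A1 d \<Longrightarrow> \<Phi> c \<in> finite_complex.mod2_boundaries A0' A1' d'"
proof -
  interpret C: finite_complex A0 A1 A2 A3 d by (rule C)
  interpret C': finite_complex A0' A1' A2' A3' d' by (rule C')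
  note \<Phi>_simps = additive_mapD[OF \<Phi>]
  show "\<Phi> c \<in> C'.mod2_cycles" if c: "c \<in> C.mod2_cycles"
  proof -
    obtain n where n: "c \<in> chains_on A1" "n \<in> chains_on A2" "d c = n + n"
      using c unfolding C.mod2_cycles_def by blast
    obtain e where e: "e \<in> chains_on A2'" "d' (\<Phi> c) - \<Phi> (d c) = e + e" using comm(2)[OF n(1)] by blast
    \<comment> \<open>The defect of commutation is a double, and it is absorbed into the double that
      a cycle modulo two may have as its differential.\<close>
    have "d' (\<Phi> c) = (e + \<Phi> n) + (e + \<Phi> n)"
      using e(2) n(3) by (simp add: \<Phi>_simps algebra_simps)
    then show ?thesis
      by (rule C'.mod2_cyclesI[OF maps(2)[OF n(1)] C'.chainsD(4)[OF e(1) maps(3)[OF n(2)]]])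
  qed
  show "\<Phi> c \<in> C'.mod2_boundaries" if c: "c \<in> C.mod2_boundaries"
  proof -
    obtain b u where b: "b \<in> chains_on A0" "u \<in> chains_on A1" "c = d b + (u + u)"
      using c unfolding C.mod2_boundaries_def by blast
    obtain e where e: "e \<in> chains_on A1'" "d' (\<Phi> b) - \<Phi> (d b) = e + e" using comm(1)[OF b(1)] by blast
    have "\<Phi> (d b) = d' (\<Phi> b) - (e + e)" using e(2) by (simp add: algebra_simps)
    then have "\<Phi> c = d' (\<Phi> b) + ((\<Phi> u - e) + (\<Phi> u - e))"
      unfolding b(3) by (simp add: \<Phi>_simps algebra_simps)
    then show ?thesis
      by (rule C'.mod2_boundariesI[OF maps(1)[OF b(1)] C'.chainsD(2)[OF maps(2)[OF b(2)] e(1)]])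
  qed
qed

proposition mod2_isomorphic_complexes:
  assumes C: "finite_complex A0 A1 A2 A3 d" and C': "finite_complex A0' A1' A2' A3' d'"
    and \<Phi>: "additive_map \<Phi>" and \<Psi>: "additive_map \<Psi>"
    and maps: "\<And>c. c \<in> chains_on A0 \<Longrightarrow> \<Phi> c \<in> chains_on A0'" "\<And>c. c \<in> chains_on A1 \<Longrightarrow> \<Phi> c \<in> chains_on A1'"
      "\<And>c. c \<in> chains_on A2 \<Longrightarrow> \<Phi> c \<in> chains_on A2'"
    and maps': "\<And>c. c \<in> chains_on A0' \<Longrightarrow> \<Psi> c \<in> chains_on A0" "\<And>c. c \<in> chains_on A1' \<Longrightarrow> \<Psi> c \<in> chains_on A1"
      "\<And>c. c \<in> chains_on A2' \<Longrightarrow> \<Psi> c \<in> chains_on A2"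
    and inv: "\<And>c. c \<in> chains_on A1 \<Longrightarrow> \<Psi> (\<Phi> c) = c" "\<And>c. c \<in> chains_on A2 \<Longrightarrow> \<Psi> (\<Phi> c) = c"
    and inv': "\<And>c. c \<in> chains_on A0' \<Longrightarrow> \<Phi> (\<Psi> c) = c" "\<And>c. c \<in> chains_on A1' \<Longrightarrow> \<Phi> (\<Psi> c) = c"
    and comm: "\<And>c. c \<in> chains_on A0 \<Longrightarrow> \<exists>e\<in>chains_on A1'. d' (\<Phi> c) - \<Phi> (d c) = e + e"
      "\<And>c. c \<in> chains_on A1 \<Longrightarrow> \<exists>e\<in>chains_on A2'. d' (\<Phi> c) - \<Phi> (d c) = e + e"
  shows "Tor (homology_at (free_Abelian_group A1') (free_Abelian_group A2') (free_Abelian_group A3') d') Z2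
      \<times>\<times> tensor_product (homology_at (free_Abelian_group A0') (free_Abelian_group A1') (free_Abelian_group A2') d') Z2
    \<cong> Tor (homology_at (free_Abelian_group A1) (free_Abelian_group A2) (free_Abelian_group A3) d) Z2
      \<times>\<times> tensor_product (homology_at (free_Abelian_group A0) (free_Abelian_group A1) (free_Abelian_group A2) d) Z2"
proof -
  interpret C: finite_complex A0 A1 A2 A3 d by (rule C)
  interpret C': finite_complex A0' A1' A2' A3' d' by (rule C')
  note \<Phi>_simps = additive_mapD[OF \<Phi>] and \<Psi>_simps = additive_mapD[OF \<Psi>]
  \<comment> \<open>Applying \<open>\<Psi>\<close> to the commutation relation of
    \<open>\<Phi>\<close> at \<open>\<Psi> c\<close> shows that the inverse also commutes with the
    differentials up to doubles.\<close>
  have comm0: "\<exists>e\<in>chains_on A1. d (\<Psi> c) - \<Psi> (d' c) = e + e" if c: "c \<in> chains_on A0'" for c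
  proof -
    obtain e where e: "e \<in> chains_on A1'" "d' (\<Phi> (\<Psi> c)) - \<Phi> (d (\<Psi> c)) = e + e"
      using comm(1)[OF maps'(1)[OF c]] by blast
    have "\<Psi> (d' c) - d (\<Psi> c) = \<Psi> e + \<Psi> e"
      using arg_cong[OF e(2), of \<Psi>] inv'(1)[OF c] inv(1)[OF C.maps(1)[OF maps'(1)[OF c]]]
      by (simp add: \<Psi>_simps)
    then have "d (\<Psi> c) - \<Psi> (d' c) = - \<Psi> e + - \<Psi> e" by (simp add: algebra_simps)
    then show ?thesis by (rule bexI) (rule C.chainsD(3)[OF maps'(2)[OF e(1)]])
  qed
  have comm1: "\<exists>e\<in>chains_on A2. d (\<Psi> c) - \<Psi> (d' c) = e + e" if c: "c \<in> chains_on A1'" for c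
  proof -
    obtain e where e: "e \<in> chains_on A2'" "d' (\<Phi> (\<Psi> c)) - \<Phi> (d (\<Psi> c)) = e + e"
      using comm(2)[OF maps'(2)[OF c]] by blast
    have "\<Psi> (d' c) - d (\<Psi> c) = \<Psi> e + \<Psi> e"
      using arg_cong[OF e(2), of \<Psi>] inv'(2)[OF c] inv(2)[OF C.maps(2)[OF maps'(2)[OF c]]]
      by (simp add: \<Psi>_simps)
    then have "d (\<Psi> c) - \<Psi> (d' c) = - \<Psi> e + - \<Psi> e" by (simp add: algebra_simps)
    then show ?thesis by (rule bexI) (rule C.chainsD(3)[OF maps'(3)[OF e(1)]])
  qed
  have fwd: "c \<in> C.mod2_cycles \<Longrightarrow> \<Phi> c \<in> C'.mod2_cycles"
      "c \<in> C.mod2_boundaries \<Longrightarrow> \<Phi> c \<in> C'.mod2_boundaries" for c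
    by (rule mod2_transport[OF C C' \<Phi> maps comm]; assumption)+
  have bwd: "c \<in> C'.mod2_cycles \<Longrightarrow> \<Psi> c \<in> C.mod2_cycles"
      "c \<in> C'.mod2_boundaries \<Longrightarrow> \<Psi> c \<in> C.mod2_boundaries" for c
    by (rule mod2_transport[OF C' C \<Psi> maps' comm0 comm1]; assumption)+
  have cyc: "c \<in> chains_on A1" if "c \<in> C.mod2_cycles" for c using that by (simp add: C.mod2_cycles_def)
  have cyc': "c \<in> chains_on A1'" if "c \<in> C'.mod2_cycles" for c using that by (simp add: C'.mod2_cycles_def)
  have "card (add_coset C.mod2_boundaries ` C.mod2_cycles) = card ((\<lambda>c. add_coset C'.mod2_boundaries (\<Phi> c)) ` C.mod2_cycles)"
  proof (rule card_image_same_fibers)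
    fix a b assume ab: "a \<in> C.mod2_cycles" "b \<in> C.mod2_cycles"
    have ch: "a - b \<in> chains_on A1" by (rule C.chainsD(2)[OF cyc[OF ab(1)] cyc[OF ab(2)]])
    have "a - b \<in> C.mod2_boundaries \<longleftrightarrow> \<Phi> (a - b) \<in> C'.mod2_boundaries"
      using fwd(2)[of "a - b"] bwd(2)[of "\<Phi> (a - b)"] inv(1)[OF ch] by metis
    then show "add_coset C.mod2_boundaries a = add_coset C.mod2_boundaries b \<longleftrightarrow>
        add_coset C'.mod2_boundaries (\<Phi> a) = add_coset C'.mod2_boundaries (\<Phi> b)"
      unfolding add_coset_eq[OF C.mod2_add_subgroups(2)] add_coset_eq[OF C'.mod2_add_subgroups(2)] \<Phi>_simps .
  qed
  also have "(\<lambda>c. add_coset C'.mod2_boundaries (\<Phi> c)) ` C.mod2_cycles = add_coset C'.mod2_boundaries ` C'.mod2_cycles"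
  proof (intro subset_antisym subsetI)
    fix Q assume "Q \<in> add_coset C'.mod2_boundaries ` C'.mod2_cycles"
    then obtain c where c: "c \<in> C'.mod2_cycles" "Q = add_coset C'.mod2_boundaries c" by blast
    have "Q = add_coset C'.mod2_boundaries (\<Phi> (\<Psi> c))" using c inv'(2)[OF cyc'[OF c(1)]] by simp
    then show "Q \<in> (\<lambda>c. add_coset C'.mod2_boundaries (\<Phi> c)) ` C.mod2_cycles" using bwd(1)[OF c(1)] by blast
  qed (use fwd(1) in blast)
  finally show ?thesis
    using C.universal_coefficients C'.universal_coefficients by (intro elementary_2_group_iso) simp_all
qed

section \<open>The differential of a cube\<close>

lemma additive_map_frag_extend: "additive_map (frag_extend f)"
  by (simp add: additive_map_def frag_extend_diff)

lemma additive_map_comp: "additive_map f \<Longrightarrow> additive_map g \<Longrightarrow> additive_map (\<lambda>c. g (f c))"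
  by (simp add: additive_map_def)

lemma frag_extend_chains:
  assumes "\<And>b. b \<in> A \<Longrightarrow> f b \<in> chains_on A'" "c \<in> chains_on A"
  shows "frag_extend f c \<in> chains_on A'"
proof -
  have "(\<Union>x\<in>Poly_Mapping.keys c. Poly_Mapping.keys (f x)) \<subseteq> A'"
  proof (rule UN_least)
    fix x assume "x \<in> Poly_Mapping.keys c"
    then have "x \<in> A" using assms(2) by (simp add: subset_iff)
    then show "Poly_Mapping.keys (f x) \<subseteq> A'" using assms(1) by simp
  qed
  then show ?thesis using order_trans[OF keys_frag_extend] by simp
qed

lemma chains_on_diff_closed: "a \<in> chains_on A \<Longrightarrow> b \<in> chains_on A \<Longrightarrow> a - b \<in> chains_on A"
  by (rule add_subgroupD(2)[OF add_subgroup_chains])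

lemma chains_on_sum: "(\<And>i. i \<in> I \<Longrightarrow> f i \<in> chains_on A) \<Longrightarrow> sum f I \<in> chains_on A"
  using sum_closed_free_Abelian_group[of I f A] by simp

lemma chains_on_cmul: "c \<in> chains_on A \<Longrightarrow> frag_cmul k c \<in> chains_on A"
  using order_trans[OF keys_cmul] by simp

lemma additive_map_eq_on_chains:
  assumes f: "additive_map f" and g: "additive_map g"
    and basis: "\<And>b. b \<in> A \<Longrightarrow> f (frag_of b) = g (frag_of b)" and c: "c \<in> chains_on A"
  shows "f c = g c"
proof -
  have "Poly_Mapping.keys c \<subseteq> A" using c by simp
  then show ?thesis
  proof (induction rule: frag_induction)
    case zero
    show ?case by (simp only: additive_mapD(2)[OF f] additive_mapD(2)[OF g])
  next
    case (one x)
    then show ?case by (rule basis)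
  next
    case (diff a b)
    then show ?case by (simp only: additive_mapD(1)[OF f] additive_mapD(1)[OF g])
  qed
qed

lemma cube_differential_additive: "additive_map (cube_differential D \<epsilon> F)"
  unfolding cube_differential_def by (rule additive_map_frag_extend)

lemma cube_differential_basis:
  "cube_differential D \<epsilon> F (frag_of (I, b))
    = (\<Sum>x\<in>crossings D - I. frag_cmul (\<epsilon> (I, x)) (at_vertex (insert x I) (F I x (frag_of b))))"
  by (simp add: cube_differential_def)

lemma at_vertex_simps:
  "at_vertex I (a - b) = at_vertex I a - at_vertex I b" "at_vertex I 0 = 0"
  "at_vertex I (- a) = - at_vertex I a"
  "at_vertex I (frag_cmul k a) = frag_cmul k (at_vertex I a)"
  by (simp_all add: at_vertex_def frag_extend_diff frag_extend_cmul frag_extend_minus)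

text \<open>\<open>odd_edge_map\<close> involves a choice and is shown to be additive on the
  exterior algebra of its circles. The differential is built from its values on basis elements, so
  the square is computed with this extension, which agrees with the edge map there.\<close>

definition linear_extension :: "(('b \<Rightarrow>\<^sub>0 int) \<Rightarrow> ('b \<Rightarrow>\<^sub>0 int)) \<Rightarrow> ('b \<Rightarrow>\<^sub>0 int) \<Rightarrow> ('b \<Rightarrow>\<^sub>0 int)" where
  "linear_extension f = frag_extend (\<lambda>b. f (frag_of b))"

lemma frag_cmul_diff2: "frag_cmul k (a - b) = frag_cmul k a - frag_cmul k b"
  by (rule poly_mapping_eqI) (simp add: lookup_minus algebra_simps)

lemma frag_cmul_minus_right: "frag_cmul k (- a) = - frag_cmul k a"
  by (rule poly_mapping_eqI) simp

lemma cube_differential_at_vertex: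
  "cube_differential D \<epsilon> F (at_vertex J w)
    = (\<Sum>y\<in>crossings D - J. frag_cmul (\<epsilon> (J, y)) (at_vertex (insert y J) (linear_extension (F J y) w)))"
    (is "?L w = ?R w")
proof (rule additive_map_eq_on_chains[of ?L ?R UNIV])
  show "additive_map ?L"
    by (rule additive_map_comp[OF _ cube_differential_additive]) (simp add: additive_map_def at_vertex_simps)
  show "additive_map ?R"
    by (simp add: additive_map_def linear_extension_def frag_extend_diff at_vertex_simps frag_cmul_diff2 sum_subtractf)
  show "?L (frag_of b) = ?R (frag_of b)" for b
    by (simp add: at_vertex_def linear_extension_def cube_differential_basis)
qed simp

text \<open>Exchanging the order of summation gives T = - T, and there is no 2-torsion.\<close>

lemma antisymmetric_sum_zero:
  fixes G :: "'i \<Rightarrow> 'i \<Rightarrow> ('b \<Rightarrow>\<^sub>0 int)"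
  assumes "\<And>x y. x \<in> S \<Longrightarrow> y \<in> S \<Longrightarrow> G x y = - G y x"
  shows "(\<Sum>x\<in>S. \<Sum>y\<in>S. G x y) = 0"
proof -
  let ?T = "\<Sum>x\<in>S. \<Sum>y\<in>S. G x y"
  have "?T = (\<Sum>x\<in>S. \<Sum>y\<in>S. - G y x)"
    by (intro sum.cong refl assms)
  also have "\<dots> = - (\<Sum>x\<in>S. \<Sum>y\<in>S. G y x)" by (simp only: sum_negf)
  also have "(\<Sum>x\<in>S. \<Sum>y\<in>S. G y x) = ?T" by (rule sum.swap)
  finally have "?T + ?T = 0 + 0" by (simp add: eq_neg_iff_add_eq_0)
  then show ?thesis unfolding frag_double_inject .
qed

lemma cube_differential_square:
  assumes fin: "finite (crossings D)"
    and anti: "\<And>x y. x \<in> crossings D - I \<Longrightarrow> y \<in> crossings D - I \<Longrightarrow> x \<noteq> y \<Longrightarrow>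
      frag_cmul (\<epsilon> (I, x) * \<epsilon> (insert x I, y)) (linear_extension (F (insert x I) y) (F I x (frag_of b)))
      = - frag_cmul (\<epsilon> (I, y) * \<epsilon> (insert y I, x)) (linear_extension (F (insert y I) x) (F I y (frag_of b)))"
  shows "cube_differential D \<epsilon> F (cube_differential D \<epsilon> F (frag_of (I, b))) = 0"
proof -
  let ?S = "crossings D - I"
  \<comment> \<open>Putting 0 on the diagonal lets both summations run over the same set, as the
    exchange of \<open>x\<close> and \<open>y\<close> requires.\<close>
  define G where "G = (\<lambda>x y. if x = y then 0 else at_vertex (insert y (insert x I))
    (frag_cmul (\<epsilon> (I, x) * \<epsilon> (insert x I, y)) (linear_extension (F (insert x I) y) (F I x (frag_of b)))))"
  have d_cmul: "cube_differential D \<epsilon> F (frag_cmul k c) = frag_cmul k (cube_differential D \<epsilon> F c)" for k c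
    unfolding cube_differential_def by (rule frag_extend_cmul)
  have d_sum: "cube_differential D \<epsilon> F (sum g T) = (\<Sum>x\<in>T. cube_differential D \<epsilon> F (g x))" if "finite T" for g T
    unfolding cube_differential_def by (simp add: frag_extend_sum[OF that] o_def)
  have inner: "cube_differential D \<epsilon> F (frag_cmul (\<epsilon> (I, x)) (at_vertex (insert x I) (F I x (frag_of b))))
      = (\<Sum>y\<in>?S. G x y)" if x: "x \<in> ?S" for x
  proof -
    have "cube_differential D \<epsilon> F (frag_cmul (\<epsilon> (I, x)) (at_vertex (insert x I) (F I x (frag_of b))))
      = (\<Sum>y\<in>crossings D - insert x I. frag_cmul (\<epsilon> (I, x)) (frag_cmul (\<epsilon> (insert x I, y))
          (at_vertex (insert y (insert x I)) (linear_extension (F (insert x I) y) (F I x (frag_of b))))))"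
      unfolding d_cmul cube_differential_at_vertex by (rule frag_cmul_sum)
    also have "\<dots> = (\<Sum>y\<in>crossings D - insert x I. G x y)"
      by (rule sum.cong[OF refl]) (auto simp: G_def at_vertex_simps)
    also have "\<dots> = (\<Sum>y\<in>?S. G x y)"
      by (rule sum.mono_neutral_left) (use fin in \<open>auto simp: G_def\<close>)
    finally show ?thesis .
  qed
  have "cube_differential D \<epsilon> F (cube_differential D \<epsilon> F (frag_of (I, b))) = (\<Sum>x\<in>?S. \<Sum>y\<in>?S. G x y)"
    unfolding cube_differential_basis using fin by (subst d_sum) (auto intro!: sum.cong inner)
  also have "\<dots> = 0"
  proof (rule antisymmetric_sum_zero)
    fix x y assume xy: "x \<in> ?S" "y \<in> ?S"
    show "G x y = - G y x"
    proof (cases "x = y")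
      case False
      have "insert y (insert x I) = insert x (insert y I)" by (rule insert_commute)
      then show ?thesis
        using anti[OF xy False] False unfolding G_def by (simp only: if_False at_vertex_simps not_sym[OF False] refl)
    qed (simp add: G_def)
  qed
  finally show ?thesis .
qed

section \<open>The odd complex\<close>

lemma sign_prod_parity:
  assumes "finite E" "\<And>e. e \<in> E \<Longrightarrow> \<epsilon> e = 1 \<or> \<epsilon> e = (-1 :: int)"
  shows "(\<Prod>e\<in>E. \<epsilon> e) = (-1) ^ card {e \<in> E. \<epsilon> e = -1}"
  using assms
proof (induction E rule: finite_induct)
  case (insert e E)
  have IH: "prod \<epsilon> E = (-1) ^ card {e \<in> E. \<epsilon> e = -1}" using insert by simp
  consider "\<epsilon> e = 1" | "\<epsilon> e = -1" using insert.prems by blast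
  then show ?case
  proof cases
    case 1
    then have "{f \<in> insert e E. \<epsilon> f = -1} = {f \<in> E. \<epsilon> f = -1}" by auto
    then show ?thesis using 1 insert.hyps IH by simp
  next
    case 2
    then have "{f \<in> insert e E. \<epsilon> f = -1} = insert e {f \<in> E. \<epsilon> f = -1}" by auto
    then show ?thesis using 2 insert.hyps IH by simp
  qed
qed simp

lemma square_sign:
  assumes sgn: "\<And>e. e \<in> square_edges I x y \<Longrightarrow> \<epsilon> e = 1 \<or> \<epsilon> e = -1" and "x \<noteq> y" "x \<notin> I" "y \<notin> I"
  shows "\<epsilon> (I, x) * \<epsilon> (insert x I, y) * (\<epsilon> (I, y) * \<epsilon> (insert y I, x))
    = (if even_square \<epsilon> I x y then 1 else -1)"
proof -
  \<comment> \<open>The four edges of the square are distinct, so the product over the set has four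
    factors.\<close>
  have ne: "I \<noteq> insert x I" "I \<noteq> insert y I" "insert x I \<noteq> insert y I" using assms(2-4) by auto
  have "(\<Prod>e\<in>square_edges I x y. \<epsilon> e) = \<epsilon> (I, x) * (\<epsilon> (I, y) * (\<epsilon> (insert x I, y) * \<epsilon> (insert y I, x)))"
    unfolding square_edges_def using ne assms(2) by (subst prod.insert, simp, force)+ simp
  moreover have "finite (square_edges I x y)" by (simp add: square_edges_def)
  from sign_prod_parity[OF this sgn] have "(\<Prod>e\<in>square_edges I x y. \<epsilon> e) = (if even_square \<epsilon> I x y then 1 else -1)"
    by (simp add: even_square_def)
  ultimately show ?thesis by (simp add: mult.assoc mult.left_commute)
qed

context arrow_diagram
begin

lemma linear_extension_odd:
  assumes x: "x \<in> crossings D" "x \<notin> I" and w: "w \<in> ext (circles D I)"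
  shows "linear_extension (odd_edge_map D up I x) w = odd_edge_map D up I x w"
proof -
  have zero: "odd_edge_map D up I x 0 = 0" using odd_edge_map_diff[OF x ext_0 ext_0] by simp
  have "w \<in> ext (circles D I) \<and> linear_extension (odd_edge_map D up I x) w = odd_edge_map D up I x w"
    using w
  proof (induction rule: ext_basis_induct)
    case zero
    then show ?case using \<open>odd_edge_map D up I x 0 = 0\<close> by (simp add: linear_extension_def ext_0)
  next
    case (one S)
    then show ?case by (simp add: linear_extension_def ext_frag_of)
  next
    case (diff a b)
    then show ?case
      using odd_edge_map_diff[OF x, of a b] ext_diff[of a _ b]
      by (simp add: linear_extension_def frag_extend_diff)
  qed
  then show ?thesis by blast
qed

text \<open>If the composites vanish, both sides are zero. Otherwise the square is of type C or A by
  \<open>odd_square_commutes\<close>, and on these types the X and Y assignments impose the same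
  parity, which supplies the sign.\<close>

lemma odd_anticommute:
  assumes \<epsilon>: "odd_assignment_X D up \<epsilon> \<or> odd_assignment_Y D up \<epsilon>" and I: "I \<subseteq> crossings D"
    and xy: "x \<in> crossings D - I" "y \<in> crossings D - I" "x \<noteq> y" and v: "v \<in> ext (circles D I)"
  shows "frag_cmul (\<epsilon> (I, x) * \<epsilon> (insert x I, y)) (odd_edge_map D up (insert x I) y (odd_edge_map D up I x v))
    = - frag_cmul (\<epsilon> (I, y) * \<epsilon> (insert y I, x)) (odd_edge_map D up (insert y I) x (odd_edge_map D up I y v))"
proof -
  let ?f = "\<lambda>v. odd_edge_map D up (insert x I) y (odd_edge_map D up I x v)"
  let ?g = "\<lambda>v. odd_edge_map D up (insert y I) x (odd_edge_map D up I y v)"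
  let ?p = "\<epsilon> (I, x) * \<epsilon> (insert x I, y)" and ?q = "\<epsilon> (I, y) * \<epsilon> (insert y I, x)"
  have xy': "x \<in> crossings D" "x \<notin> I" "y \<in> crossings D" "y \<notin> I" using xy by simp_all
  have sq: "(I, x, y) \<in> squares D" using xy' xy(3) I by (simp add: squares_def vertices_def)
  have "square_edges I x y \<subseteq> edges D"
    using xy' xy(3) I by (auto simp: square_edges_def edges_def vertices_def)
  moreover have "\<epsilon> ` edges D \<subseteq> {1, -1}" using \<epsilon> by (auto simp: odd_assignment_X_def odd_assignment_Y_def)
  ultimately have sgn: "\<epsilon> e = 1 \<or> \<epsilon> e = -1" if "e \<in> square_edges I x y" for e
    using that by blast
  have pq: "?p * ?q = (if even_square \<epsilon> I x y then 1 else -1)"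
    by (rule square_sign[OF sgn xy(3) xy'(2,4)])
  have pm: "?p = 1 \<or> ?p = -1" "?q = 1 \<or> ?q = -1"
    using sgn[of "(I, x)"] sgn[of "(insert x I, y)"] sgn[of "(I, y)"] sgn[of "(insert y I, x)"]
    by (auto simp: square_edges_def)
  have C: "type_C D up I x y \<Longrightarrow> \<not> even_square \<epsilon> I x y" and A: "type_A D up I x y \<Longrightarrow> even_square \<epsilon> I x y"
    using \<epsilon> sq unfolding odd_assignment_X_def odd_assignment_Y_def by fast+
  consider (eq) "\<forall>v\<in>ext (circles D I). ?f v = ?g v" | (neg) "\<forall>v\<in>ext (circles D I). ?f v = - ?g v"
    using odd_square_commutes[OF xy' xy(3)] by blast
  then show ?thesis
  proof cases
    case eq
    show ?thesis
    proof (cases "\<forall>v\<in>ext (circles D I). ?f v = 0")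
      case True
      then have "?f v = 0" "?g v = 0" using eq v by simp_all
      then show ?thesis by simp
    next
      case False
      then have "type_C D up I x y"
        using eq unfolding type_C_def Let_def carrier_exterior_algebra by metis
      then have "?p = - ?q" using C pq pm by auto
      moreover have "?f v = ?g v" using eq v by blast
      ultimately show ?thesis by simp
    qed
  next
    case neg
    show ?thesis
    proof (cases "\<forall>v\<in>ext (circles D I). ?f v = 0")
      case True
      then have "?f v = 0" "?g v = 0" using neg v by force+
      then show ?thesis by simp
    next
      case False
      then obtain u where "u \<in> ext (circles D I)" "?f u \<noteq> 0" by blast
      moreover from this have "?g u \<noteq> 0" using neg by force
      ultimately have "type_A D up I x y"
        using neg unfolding type_A_def Let_def carrier_exterior_algebra by blast
      then have "?p = ?q" using A pq pm by auto
      moreover have "?f v = - ?g v" using neg v by blast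
      ultimately show ?thesis by (simp only: frag_cmul_minus_right)
    qed
  qed
qed

definition odd_differential :: "('x set \<times> 'x \<Rightarrow> int) \<Rightarrow> ('x set \<times> 'a set set \<Rightarrow>\<^sub>0 int) \<Rightarrow> ('x set \<times> 'a set set \<Rightarrow>\<^sub>0 int)" where
  "odd_differential \<epsilon> = cube_differential D \<epsilon> (odd_edge_map D up)"

lemma odd_differential_square:
  assumes \<epsilon>: "odd_assignment_X D up \<epsilon> \<or> odd_assignment_Y D up \<epsilon>"
    and c: "c \<in> chains_on {(I, S). I \<subseteq> crossings D \<and> S \<subseteq> circles D I}"
  shows "odd_differential \<epsilon> (odd_differential \<epsilon> c) = 0"
proof -
  have "(odd_differential \<epsilon> \<circ> odd_differential \<epsilon>) c = (\<lambda>_. 0) c"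
  proof (rule additive_map_eq_on_chains[OF _ _ _ c])
    show "additive_map (odd_differential \<epsilon> \<circ> odd_differential \<epsilon>)"
      unfolding comp_def odd_differential_def
      by (rule additive_map_comp[OF cube_differential_additive cube_differential_additive])
    show "additive_map (\<lambda>_. 0)" by (simp add: additive_map_def)
    fix b assume "b \<in> {(I, S). I \<subseteq> crossings D \<and> S \<subseteq> circles D I}"
    then obtain I S where b: "b = (I, S)" "I \<subseteq> crossings D" "S \<subseteq> circles D I" by blast
    have S: "frag_of S \<in> ext (circles D I)" using b(3) by (simp add: ext_frag_of)
    have "cube_differential D \<epsilon> (odd_edge_map D up) (cube_differential D \<epsilon> (odd_edge_map D up) (frag_of (I, S))) = 0"
    proof (rule cube_differential_square[OF finite_crossings])
      fix x y assume xy: "x \<in> crossings D - I" "y \<in> crossings D - I" "x \<noteq> y"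
      have "linear_extension (odd_edge_map D up (insert p I) q) (odd_edge_map D up I p (frag_of S))
          = odd_edge_map D up (insert p I) q (odd_edge_map D up I p (frag_of S))"
        if "p \<in> crossings D - I" "q \<in> crossings D - I" "p \<noteq> q" for p q
        by (rule linear_extension_odd) (use that odd_edge_map_ext[OF _ _ S, of p] in auto)
      then show "frag_cmul (\<epsilon> (I, x) * \<epsilon> (insert x I, y))
          (linear_extension (odd_edge_map D up (insert x I) y) (odd_edge_map D up I x (frag_of S)))
        = - frag_cmul (\<epsilon> (I, y) * \<epsilon> (insert y I, x))
          (linear_extension (odd_edge_map D up (insert y I) x) (odd_edge_map D up I y (frag_of S)))"
        using odd_anticommute[OF \<epsilon> b(2) xy S] xy by simp
    qed
    then show "(odd_differential \<epsilon> \<circ> odd_differential \<epsilon>) (frag_of b) = 0"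
      by (simp add: odd_differential_def b(1))
  qed
  then show ?thesis by simp
qed

end

section \<open>Comparison of the two cubes modulo two\<close>

lemma is_double_additive: "additive_map f \<Longrightarrow> is_double c \<Longrightarrow> is_double (f c)"
  unfolding is_double_def using additive_mapD(4) by blast

lemma is_double_diff: "is_double a \<Longrightarrow> is_double b \<Longrightarrow> is_double (a - b)"
proof -
  assume "is_double a" "is_double b"
  then obtain e f where "a = e + e" "b = f + f" by (auto simp: is_double_def)
  then have "a - b = (e - f) + (e - f)" by (simp add: algebra_simps)
  then show ?thesis by (auto simp: is_double_def)
qed

lemma is_double_0: "is_double 0"
  unfolding is_double_def by (rule exI[of _ 0]) simp

lemma is_double_sum: "(\<And>i. i \<in> I \<Longrightarrow> is_double (f i)) \<Longrightarrow> is_double (sum f I)"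
proof (induction I rule: infinite_finite_induct)
  case (insert i I)
  then have "is_double (f i)" "is_double (sum f I)" by simp_all
  then obtain a b where "f i = a + a" "sum f I = b + b" by (auto simp: is_double_def)
  then have "sum f (insert i I) = (a + b) + (a + b)" using insert.hyps by (simp add: algebra_simps)
  then show ?case by (auto simp: is_double_def)
qed (simp_all add: is_double_0)

text \<open>Changing the sign of a chain changes it by a double.\<close>

lemma is_double_signs:
  assumes "is_double (a - b)" "k = 1 \<or> k = -1" "l = 1 \<or> l = -1"
  shows "is_double (frag_cmul k a - frag_cmul l b)"
proof -
  obtain e where e: "a = b + (e + e)" using assms(1) by (auto simp: is_double_def algebra_simps)
  have "frag_cmul k a - frag_cmul l b \<in> {e + e, (b + e) + (b + e), - (b + e) + - (b + e), (- e) + (- e)}"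
    using assms(2,3) by (elim disjE) (simp_all add: e)
  then show ?thesis
    unfolding is_double_def by (elim insertE emptyE) (rule exI, assumption)+
qed

definition label :: "'a set set \<Rightarrow> 'a set set \<Rightarrow> 'a set \<Rightarrow> gen" where
  "label Z S = restrict (\<lambda>c. if c \<in> S then Gx else G1) Z"

lemma label_in_labellings: "label Z S \<in> labellings Z"
  by (simp add: label_def labellings_def)

lemma label_Gx: "S \<subseteq> Z \<Longrightarrow> {c \<in> Z. label Z S c = Gx} = S"
  by (auto simp: label_def)

lemma label_G1: "S \<subseteq> Z \<Longrightarrow> {c \<in> Z. label Z S c = G1} = Z - S"
  by (auto simp: label_def)

lemma label_of_labelling: "\<sigma> \<in> labellings Z \<Longrightarrow> label Z {c \<in> Z. \<sigma> c = Gx} = \<sigma>"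
proof (rule HOL.ext)
  fix c assume \<sigma>: "\<sigma> \<in> labellings Z"
  show "label Z {c \<in> Z. \<sigma> c = Gx} c = \<sigma> c"
  proof (cases "c \<in> Z")
    case True
    then show ?thesis by (cases "\<sigma> c") (simp_all add: label_def)
  next
    case False
    then show ?thesis
      using PiE_arb[OF \<sigma>[unfolded labellings_def]] by (simp add: label_def)
  qed
qed

lemma label_merge:
  assumes Z: "disjoint_family Z" and m: "merges Z a b Z'" and S: "S \<subseteq> Z"
  shows "restrict ((label Z S)(a \<union> b := g)) Z' = label Z' (S - {a, b} \<union> (if g = Gx then {a \<union> b} else {}))"
proof (rule HOL.ext)
  fix c
  show "restrict ((label Z S)(a \<union> b := g)) Z' c = label Z' (S - {a, b} \<union> (if g = Gx then {a \<union> b} else {})) c"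
  proof (cases "c \<in> Z'")
    case True
    have new: "a \<union> b \<notin> S" using merges_new(1)[OF Z m] S by (simp add: subset_iff) blast
    show ?thesis
    proof (cases "c = a \<union> b")
      case True
      then show ?thesis using \<open>c \<in> Z'\<close> new by (cases g) (simp_all add: label_def)
    next
      case False
      then have "c \<in> Z" "c \<noteq> a" "c \<noteq> b" using True m by (simp_all add: merges_def)
      then show ?thesis using True False by (simp add: label_def)
    qed
  qed (simp add: label_def)
qed

lemma label_split:
  assumes Z': "disjoint_family Z'" and m: "merges Z' l r Z" and S: "S \<subseteq> Z"
  shows "restrict ((label Z S)(l := g, r := h)) Z'
    = label Z' (S - {l \<union> r} \<union> ((if g = Gx then {l} else {}) \<union> (if h = Gx then {r} else {})))"
proof (rule HOL.ext)
  fix c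
  have lr: "l \<notin> S" "r \<notin> S" using merges_new(2,3)[OF Z' m] S by (simp_all add: subset_iff) blast+
  have ne: "l \<noteq> r" "l \<union> r \<notin> Z'" using merges_mem(3)[OF Z' m] merges_new(1)[OF Z' m] by simp_all
  show "restrict ((label Z S)(l := g, r := h)) Z' c
    = label Z' (S - {l \<union> r} \<union> ((if g = Gx then {l} else {}) \<union> (if h = Gx then {r} else {}))) c"
  proof (cases "c \<in> Z'")
    case True
    consider "c = l" | "c = r" | "c \<noteq> l" "c \<noteq> r" by blast
    then show ?thesis
    proof cases
      case 1
      then show ?thesis using True lr ne by (cases g) (simp_all add: label_def)
    next
      case 2
      then show ?thesis using True lr ne(1)[symmetric] by (cases h) (simp_all add: label_def)
    next
      case 3
      then have "c \<in> Z" using True m by (simp add: merges_def)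
      moreover have "c \<noteq> l \<union> r" using True ne(2) by metis
      ultimately show ?thesis using 3 True by (simp add: label_def)
    qed
  qed (simp add: label_def)
qed

lemma super_image_merge:
  assumes Z: "disjoint_family Z" and m: "merges Z a b Z'" and S: "S \<subseteq> Z"
  shows "super Z' ` S = S - {a, b} \<union> (if a \<in> S \<or> b \<in> S then {a \<union> b} else {})"
    and "inj_on (super Z') S \<longleftrightarrow> \<not> (a \<in> S \<and> b \<in> S)"
proof -
  have s: "super Z' c = (if c = a \<or> c = b then a \<union> b else c)" if "c \<in> S" for c
    by (rule merges_super[OF Z m]) (use that S in blast)
  have "super Z' ` S = (\<lambda>c. if c = a \<or> c = b then a \<union> b else c) ` S" by (rule image_cong[OF refl s])
  also have "\<dots> = S - {a, b} \<union> (if a \<in> S \<or> b \<in> S then {a \<union> b} else {})" by auto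
  finally show "super Z' ` S = S - {a, b} \<union> (if a \<in> S \<or> b \<in> S then {a \<union> b} else {})" .
  show "inj_on (super Z') S \<longleftrightarrow> \<not> (a \<in> S \<and> b \<in> S)"
  proof
    assume inj: "inj_on (super Z') S"
    show "\<not> (a \<in> S \<and> b \<in> S)"
    proof
      assume ab: "a \<in> S \<and> b \<in> S"
      then have "super Z' a = super Z' b" using s by simp
      then show False using inj_onD[OF inj, of a b] ab merges_mem(3)[OF Z m] by simp
    qed
  next
    assume n: "\<not> (a \<in> S \<and> b \<in> S)"
    show "inj_on (super Z') S"
    proof (rule inj_onI, rule ccontr)
      fix c d assume cd: "c \<in> S" "d \<in> S" "super Z' c = super Z' d" "c \<noteq> d"
      have "{c, d} = {a, b}" by (rule merges_super_eq[OF Z m _ _ cd(3,4)]) (use cd S in blast)+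
      then have "a \<in> {c, d}" "b \<in> {c, d}" by simp_all
      then show False using cd(1,2) n by blast
    qed
  qed
qed

lemma circle_wedge_notin: "c \<notin> S \<Longrightarrow> \<exists>k. \<bar>k\<bar> = 1 \<and> circle_wedge c S = frag_cmul k (frag_of (insert c S))"
  by (intro exI[of _ "(-1) ^ card {d \<in> S. Min d < Min c}"]) (simp add: circle_wedge_def power_abs)

lemma replace_image: "(\<lambda>c. if c = p then t else c) ` S = (if p \<in> S then insert t (S - {p}) else S)"
  by auto

lemma replace_inj_on: "t \<notin> S \<Longrightarrow> inj_on (\<lambda>c. if c = p then t else c) S"
  by (auto simp: inj_on_def)

lemma odd_abs_one: "\<bar>k\<bar> = 1 \<Longrightarrow> odd (k :: int)"
  by (cases "k \<ge> 0") auto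

section \<open>The common support of the two edge maps\<close>

context arrow_diagram
begin

text \<open>The basis elements with odd coefficient, for either edge map. A merge kills
  \<open>S\<close> when it contains both circles, as a \<and> a = 0 and x x = 0. A split of a circle
  in \<open>S\<close> puts both pieces into the set, as in \<Delta>(x); a split of any other circle
  puts in either piece, as in \<Delta>(1).\<close>

definition target :: "'x set \<Rightarrow> 'x \<Rightarrow> 'a set set \<Rightarrow> 'a set set set" where
  "target I x S =
     (if is_merge D I x then
        (if inj_on (super (circles D (insert x I))) S then {super (circles D (insert x I)) ` S} else {})
      else
        (let b = circle_of D I (arc_at D x UL);
             l = circle_of D (insert x I) (arc_at D x UL); r = circle_of D (insert x I) (arc_at D x UR)
         in if b \<in> S then {insert l (insert r (S - {b}))} else {insert l S, insert r S}))"

lemma finite_circles: "finite (circles D I)"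
  using disjoint_family_circles by (simp add: disjoint_family_def)

text \<open>A merge loses a circle and keeps the exterior degree; a split gains a circle and a
  degree. Either way the first summand of the q-grading drops by one, which offsets the additional
  1-resolution.\<close>

lemma target_grading:
  assumes x: "x \<in> crossings D" "x \<notin> I" and S: "S \<subseteq> circles D I" and S': "S' \<in> target I x S"
  shows "S' \<subseteq> circles D (insert x I)"
    and "int (card (circles D (insert x I))) - 2 * int (card S') + 1 = int (card (circles D I)) - 2 * int (card S)"
proof -
  have finS: "finite S" using S finite_circles finite_subset by blast
  have "S' \<subseteq> circles D (insert x I) \<and>
    int (card (circles D (insert x I))) - 2 * int (card S') + 1 = int (card (circles D I)) - 2 * int (card S)"
  proof (cases "is_merge D I x")
    case True
    let ?s = "super (circles D (insert x I))"
    have inj: "inj_on ?s S" "S' = ?s ` S"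
      using S' True by (simp_all add: target_def split: if_splits)
    have "?s ` S \<subseteq> circles D (insert x I)"
      using super_image[OF disjoint_family_circles disjoint_family_circles merge_finer(1)[OF x True]] S by blast
    then show ?thesis using inj card_image[OF inj(1)] merge_finer(3)[OF x True] by simp
  next
    case False
    let ?b = "circle_of D I (arc_at D x UL)"
    let ?l = "circle_of D (insert x I) (arc_at D x UL)" and ?r = "circle_of D (insert x I) (arc_at D x UR)"
    note m = split_circles(1)[OF x False]
    have b: "?b = ?l \<union> ?r" by (rule split_circles(2)[OF x False])
    have lr: "?l \<in> circles D (insert x I)" "?r \<in> circles D (insert x I)" "?l \<noteq> ?r"
      using merges_mem(1-3)[OF disjoint_family_circles m] by simp_all
    have new: "?l \<notin> S" "?r \<notin> S" using merges_new(2,3)[OF disjoint_family_circles m] S by blast+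
    have old: "S - {?b} \<subseteq> circles D (insert x I)" using m S unfolding b merges_def by blast
    have card: "card (circles D (insert x I)) = Suc (card (circles D I))" by (rule merge_finer(4)[OF x False])
    show ?thesis
    proof (cases "?b \<in> S")
      case True
      then have S'_eq: "S' = insert ?l (insert ?r (S - {?b}))" using S' False by (simp add: target_def Let_def)
      have "card S' = Suc (card S)"
        unfolding S'_eq using new lr(3) finS card_Suc_Diff1[OF finS True] by simp
      then show ?thesis using S'_eq lr old card by simp
    next
      case b_notin: False
      then have S'_eq: "S' = insert ?l S \<or> S' = insert ?r S" using S' False by (simp add: target_def Let_def)
      then have "card S' = Suc (card S)" using new finS by auto
      then show ?thesis using S'_eq lr old b_notin card by auto
    qed
  qed
  then show "S' \<subseteq> circles D (insert x I)"
    "int (card (circles D (insert x I))) - 2 * int (card S') + 1 = int (card (circles D I)) - 2 * int (card S)"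
    by blast+
qed

text \<open>For a split the element is lifted by the section that replaces the split circle by the
  tail circle \<open>?t\<close>. If the split circle is in \<open>S\<close>, the wedge with
  \<open>?t\<close> vanishes and one monomial remains; otherwise both wedges contribute.\<close>

lemma odd_edge_map_target:
  assumes x: "x \<in> crossings D" "x \<notin> I" and S: "S \<subseteq> circles D I"
  shows "Poly_Mapping.keys (odd_edge_map D up I x (frag_of S)) \<subseteq> target I x S \<and>
    (\<forall>S'\<in>target I x S. odd (Poly_Mapping.lookup (odd_edge_map D up I x (frag_of S)) S'))"
proof (cases "is_merge D I x")
  case True
  let ?s = "super (circles D (insert x I))"
  have S_ext: "frag_of S \<in> ext (circles D I)" using S by (simp add: ext_frag_of)
  note wb = disjoint_family_wedge_base[OF disjoint_family_circles]
  obtain k where k: "exterior_map ?s (frag_of S) = frag_cmul k (frag_of (?s ` S))"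
    "if inj_on ?s S then \<bar>k\<bar> = 1 else k = 0"
    using exterior_map_frag_of_image[OF wb wb super_image[OF disjoint_family_circles disjoint_family_circles
          merge_finer(1)[OF x True]] S] by blast
  have F: "odd_edge_map D up I x (frag_of S) = frag_cmul k (frag_of (?s ` S))"
    using odd_edge_map_merge[OF x True S_ext] k(1) by simp
  show ?thesis
  proof (cases "inj_on ?s S")
    case inj: True
    have "odd k" using k(2) inj odd_abs_one by simp
    then show ?thesis
      using inj True keys_cmul[of k "frag_of (?s ` S)"] by (simp add: F target_def keys_frag_of)
  next
    case False
    then show ?thesis using k(2) True by (simp add: F target_def)
  qed
next
  case False
  let ?Z' = "circles D (insert x I)" and ?Z = "circles D I"
  let ?b = "circle_of D I (arc_at D x UL)"
  let ?t = "circle_of D (insert x I) (arrow_tail x)" and ?h = "circle_of D (insert x I) (arrow_head x)"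
  note m = split_merges(1)[OF x False]
  note wb = disjoint_family_wedge_base[OF disjoint_family_circles]
  have b: "?b = ?t \<union> ?h" by (rule split_merges(2)[OF x False])
  have th: "?t \<noteq> ?h" by (rule merges_mem(3)[OF disjoint_family_circles m])
  have new: "?t \<notin> S" "?h \<notin> S" using merges_new(2,3)[OF disjoint_family_circles m] S by blast+
  define j where "j = (\<lambda>c. if c = ?t \<union> ?h then ?t else c)"
  note sec = split_section[OF disjoint_family_circles m, folded j_def]
  have S_ext: "frag_of S \<in> ext ?Z" using S by (simp add: ext_frag_of)
  have "inj_on j S"
    unfolding j_def by (rule replace_inj_on[OF new(1)])
  then obtain k where k: "exterior_map j (frag_of S) = frag_cmul k (frag_of (j ` S))" "\<bar>k\<bar> = 1"
    using exterior_map_frag_of_image[OF wb wb sec(1) S] by auto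
  have "odd_edge_map D up I x (frag_of S) = odd_edge_map D up I x (coarsen I (exterior_map j (frag_of S)))"
    by (simp only: sec(5)[OF S_ext])
  also have "\<dots> = diff_wedge ?t ?h (exterior_map j (frag_of S))"
    by (rule odd_edge_map_split[OF x False sec(4)[OF S_ext]])
  also have "\<dots> = frag_cmul k (circle_wedge ?t (j ` S) - circle_wedge ?h (j ` S))"
    by (simp add: diff_wedge_def k(1) cwedge_cmul cwedge_frag_of frag_cmul_diff2)
  finally have F: "odd_edge_map D up I x (frag_of S) = \<dots>" .
  \<comment> \<open>\<open>target\<close> names the pieces left and right, the edge map names them
    tail and head; this is the same pair in one order or the other.\<close>
  have T: "target I x S = (if ?b \<in> S then {insert ?h (insert ?t (S - {?b}))} else {insert ?t S, insert ?h S})"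
    using False by (cases "up x") (auto simp: target_def Let_def arrow_tail_def arrow_head_def insert_commute)
  have odd_k: "odd k" using k(2) by (rule odd_abs_one)
  show ?thesis
  proof (cases "?b \<in> S")
    case True
    have jS: "j ` S = insert ?t (S - {?b})" using True unfolding j_def b[symmetric] replace_image by simp
    have h_new: "?h \<notin> insert ?t (S - {?b})" using new(2) th by simp
    obtain e where e: "\<bar>e\<bar> = 1" "circle_wedge ?h (insert ?t (S - {?b}))
        = frag_cmul e (frag_of (insert ?h (insert ?t (S - {?b}))))"
      using circle_wedge_notin[OF h_new] by blast
    have "circle_wedge ?t (insert ?t (S - {?b})) = 0" by (simp add: circle_wedge_def)
    then have "odd_edge_map D up I x (frag_of S) = frag_cmul (- (k * e)) (frag_of (insert ?h (insert ?t (S - {?b}))))"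
      unfolding F jS e(2) by simp
    moreover have "odd (- (k * e))" using odd_k odd_abs_one[OF e(1)] by simp
    ultimately show ?thesis
      unfolding T using True keys_cmul[of "- (k * e)" "frag_of (insert ?h (insert ?t (S - {?b})))"]
      by (simp add: keys_frag_of)
  next
    case b_notin: False
    have jS: "j ` S = S" using b_notin unfolding j_def b[symmetric] replace_image by simp
    obtain e f where e: "\<bar>e\<bar> = 1" "circle_wedge ?t S = frag_cmul e (frag_of (insert ?t S))"
      and f: "\<bar>f\<bar> = 1" "circle_wedge ?h S = frag_cmul f (frag_of (insert ?h S))"
      using circle_wedge_notin[OF new(1)] circle_wedge_notin[OF new(2)] by blast
    let ?T = "insert ?t S" and ?H = "insert ?h S"
    have ne: "?T \<noteq> ?H" using new th by blast
    have F': "odd_edge_map D up I x (frag_of S) = frag_cmul (k * e) (frag_of ?T) - frag_cmul (k * f) (frag_of ?H)"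
      unfolding F jS e(2) f(2) by (simp add: frag_cmul_diff2)
    have "odd (k * e)" "odd (k * f)" using odd_k odd_abs_one[OF e(1)] odd_abs_one[OF f(1)] by simp_all
    moreover have "Poly_Mapping.lookup (odd_edge_map D up I x (frag_of S)) ?T = k * e"
      "Poly_Mapping.lookup (odd_edge_map D up I x (frag_of S)) ?H = - (k * f)"
      unfolding F' using ne ne[symmetric] by (simp_all add: lookup_minus)
    moreover have "Poly_Mapping.keys (odd_edge_map D up I x (frag_of S)) \<subseteq> {?T, ?H}"
      unfolding F' by (intro order_trans[OF keys_diff] Un_least order_trans[OF keys_cmul]) (simp_all add: keys_frag_of)
    ultimately show ?thesis unfolding T using b_notin by simp
  qed
qed

lemma even_edge_map_target:
  assumes x: "x \<in> crossings D" "x \<notin> I" and S: "S \<subseteq> circles D I"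
  shows "even_edge_map D I x (frag_of (label (circles D I) S))
    = (\<Sum>S'\<in>target I x S. frag_of (label (circles D (insert x I)) S'))"
proof (cases "is_merge D I x")
  case True
  let ?Z' = "circles D (insert x I)" and ?Z = "circles D I"
  let ?a = "circle_of D I (arc_at D x UL)" and ?b = "circle_of D I (arc_at D x LL)"
  note m = merge_circles(1)[OF x True]
  have ab: "?a \<in> ?Z" "?b \<in> ?Z" using merges_mem(1,2)[OF disjoint_family_circles m] by simp_all
  have lab: "label ?Z S ?a = (if ?a \<in> S then Gx else G1)" "label ?Z S ?b = (if ?b \<in> S then Gx else G1)"
    using ab by (simp_all add: label_def)
  note im = super_image_merge[OF disjoint_family_circles m S]
  have "even_edge_map D I x (frag_of (label ?Z S))
    = frag_extend (\<lambda>g. frag_of (label ?Z' (S - {?a, ?b} \<union> (if g = Gx then {?a \<union> ?b} else {}))))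
        (A_mult (label ?Z S ?a) (label ?Z S ?b))"
    using True label_merge[OF disjoint_family_circles m S] merge_circles(2)[OF x True]
    by (simp add: even_edge_map_def Let_def)
  then show ?thesis
    unfolding target_def lab im using True
    by (cases "?a \<in> S"; cases "?b \<in> S") simp_all
next
  case False
  let ?Z' = "circles D (insert x I)" and ?Z = "circles D I"
  let ?b = "circle_of D I (arc_at D x UL)"
  let ?l = "circle_of D (insert x I) (arc_at D x UL)" and ?r = "circle_of D (insert x I) (arc_at D x UR)"
  note m = split_circles(1)[OF x False]
  have b: "?b = ?l \<union> ?r" by (rule split_circles(2)[OF x False])
  have b_in: "?b \<in> ?Z" by (rule circle_of_in_circles[OF arc_at_in_arcs[OF x(1)]])
  have new: "?l \<notin> S" "?r \<notin> S" "?l \<noteq> ?r"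
    using merges_new(2,3)[OF disjoint_family_circles m] merges_mem(3)[OF disjoint_family_circles m] S by blast+
  \<comment> \<open>The sum in the goal runs over a set, so the two terms of the coproduct of 1 must
    be seen to be distinct.\<close>
  have ne: "insert ?l S \<noteq> insert ?r S" using new by blast
  have "even_edge_map D I x (frag_of (label ?Z S))
    = frag_extend (\<lambda>(g, h). frag_of (label ?Z' (S - {?b} \<union> ((if g = Gx then {?l} else {}) \<union> (if h = Gx then {?r} else {})))))
        (A_comult (label ?Z S ?b))"
    using False label_split[OF disjoint_family_circles m S] b by (simp add: even_edge_map_def Let_def)
  moreover have "label ?Z S ?b = (if ?b \<in> S then Gx else G1)" using b_in by (simp add: label_def)
  ultimately show ?thesis
    using False ne by (cases "?b \<in> S") (simp_all add: target_def Let_def frag_extend_add insert_commute add.commute)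
qed

end

section \<open>Bigraded bases and the comparison map\<close>

context arrow_diagram
begin

definition odd_basis :: "int \<Rightarrow> int \<Rightarrow> ('x set \<times> 'a set set) set" where
  "odd_basis m s = {(I, S). I \<in> vertices D \<and> S \<subseteq> circles D I \<and> homological_grading D I = m \<and>
     q_grading D I (int (card (circles D I)) - 2 * int (card S)) = s}"

definition even_basis :: "int \<Rightarrow> int \<Rightarrow> ('x set \<times> ('a set \<Rightarrow> gen)) set" where
  "even_basis m s = {(I, \<sigma>). I \<in> vertices D \<and> \<sigma> \<in> labellings (circles D I) \<and> homological_grading D I = m \<and>
     q_grading D I (int (card {c \<in> circles D I. \<sigma> c = G1}) - int (card {c \<in> circles D I. \<sigma> c = Gx})) = s}"

definition to_even :: "'x set \<times> 'a set set \<Rightarrow> 'x set \<times> ('a set \<Rightarrow> gen)" where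
  "to_even = (\<lambda>(I, S). (I, label (circles D I) S))"

definition to_odd :: "'x set \<times> ('a set \<Rightarrow> gen) \<Rightarrow> 'x set \<times> 'a set set" where
  "to_odd = (\<lambda>(I, \<sigma>). (I, {c \<in> circles D I. \<sigma> c = Gx}))"

lemma odd_chain_group_eq: "odd_chain_group D m s = free_Abelian_group (odd_basis m s)"
  by (simp add: odd_chain_group_def odd_basis_def)

lemma even_chain_group_eq: "even_chain_group D m s = free_Abelian_group (even_basis m s)"
  by (simp add: even_chain_group_def even_basis_def)

lemma label_gradings:
  assumes "S \<subseteq> circles D I"
  shows "int (card {c \<in> circles D I. label (circles D I) S c = G1})
      - int (card {c \<in> circles D I. label (circles D I) S c = Gx})
    = int (card (circles D I)) - 2 * int (card S)"
  unfolding label_Gx[OF assms] label_G1[OF assms]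
  using card_Diff_subset[OF finite_subset[OF assms finite_circles] assms] card_mono[OF finite_circles assms]
  by simp

lemma to_even_basis: "p \<in> odd_basis m s \<Longrightarrow> to_even p \<in> even_basis m s"
  by (cases p) (simp add: odd_basis_def even_basis_def to_even_def label_in_labellings label_gradings)

lemma to_odd_to_even: "p \<in> odd_basis m s \<Longrightarrow> to_odd (to_even p) = p"
  by (cases p) (simp add: odd_basis_def to_even_def to_odd_def label_Gx)

lemma to_even_to_odd: "p \<in> even_basis m s \<Longrightarrow> to_even (to_odd p) = p"
  by (cases p) (simp add: even_basis_def to_even_def to_odd_def label_of_labelling)

lemma to_odd_basis:
  assumes "p \<in> even_basis m s"
  shows "to_odd p \<in> odd_basis m s"
proof -
  obtain I \<sigma> where p: "p = (I, \<sigma>)" by (cases p)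
  let ?S = "{c \<in> circles D I. \<sigma> c = Gx}"
  have \<sigma>: "label (circles D I) ?S = \<sigma>"
    using assms by (simp add: p even_basis_def label_of_labelling)
  have S: "?S \<subseteq> circles D I" by blast
  have "q_grading D I (int (card {c \<in> circles D I. \<sigma> c = G1}) - int (card ?S)) = s"
    using assms by (simp add: p even_basis_def)
  then have "q_grading D I (int (card (circles D I)) - 2 * int (card ?S)) = s"
    unfolding label_gradings[OF S, unfolded \<sigma>] .
  then show ?thesis
    using assms S by (simp add: p even_basis_def odd_basis_def to_odd_def)
qed

lemma finite_odd_basis: "finite (odd_basis m s)"
proof -
  have "odd_basis m s \<subseteq> Sigma (Pow (crossings D)) (\<lambda>I. Pow (circles D I))"
    by (auto simp: odd_basis_def vertices_def)
  moreover have "finite (Sigma (Pow (crossings D)) (\<lambda>I. Pow (circles D I)))"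
    using finite_crossings finite_circles by (intro finite_SigmaI) simp_all
  ultimately show ?thesis by (rule finite_subset)
qed

lemma finite_even_basis: "finite (even_basis m s)"
proof -
  have "even_basis m s \<subseteq> to_even ` odd_basis m s"
  proof
    fix p assume p: "p \<in> even_basis m s"
    show "p \<in> to_even ` odd_basis m s"
      using to_even_to_odd[OF p, symmetric] to_odd_basis[OF p] by (rule image_eqI)
  qed
  then show ?thesis using finite_odd_basis finite_subset by blast
qed

lemma odd_basis_step:
  assumes IS: "(I, S) \<in> odd_basis m s" and x: "x \<in> crossings D - I" and S': "S' \<in> target I x S"
  shows "(insert x I, S') \<in> odd_basis (m + 1) s"
proof -
  have I: "I \<subseteq> crossings D" "S \<subseteq> circles D I" using IS by (simp_all add: odd_basis_def vertices_def)
  have xc: "x \<in> crossings D" "x \<notin> I" using x by simp_all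
  have "card (insert x I) = Suc (card I)"
    using finite_subset[OF I(1) finite_crossings] xc(2) by simp
  then show ?thesis
    using IS I xc target_grading[OF xc I(2) S']
    by (simp add: odd_basis_def vertices_def homological_grading_def q_grading_def)
qed

lemma at_vertex_chains:
  "(\<And>b. b \<in> Poly_Mapping.keys w \<Longrightarrow> (J, b) \<in> A) \<Longrightarrow> at_vertex J w \<in> chains_on A"
  unfolding at_vertex_def
  by (rule frag_extend_chains[of "Poly_Mapping.keys w"]) (simp_all add: keys_frag_of)

lemma odd_differential_chains:
  assumes "c \<in> chains_on (odd_basis m s)"
  shows "odd_differential \<epsilon> c \<in> chains_on (odd_basis (m + 1) s)"
  unfolding odd_differential_def cube_differential_def
proof (rule frag_extend_chains[OF _ assms])
  fix p assume p: "p \<in> odd_basis m s"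
  obtain I S where IS: "p = (I, S)" by (cases p)
  have S: "S \<subseteq> circles D I" using p by (simp add: IS odd_basis_def)
  have "frag_cmul (\<epsilon> (I, x)) (at_vertex (insert x I) (odd_edge_map D up I x (frag_of S))) \<in> chains_on (odd_basis (m + 1) s)"
    if x: "x \<in> crossings D - I" for x
  proof (intro chains_on_cmul at_vertex_chains)
    fix S' assume "S' \<in> Poly_Mapping.keys (odd_edge_map D up I x (frag_of S))"
    then have "S' \<in> target I x S" using odd_edge_map_target[of x I S] x S by blast
    then show "(insert x I, S') \<in> odd_basis (m + 1) s" by (rule odd_basis_step[OF p[unfolded IS] x])
  qed
  then show "(case p of (I, b) \<Rightarrow> \<Sum>x\<in>crossings D - I. frag_cmul (\<epsilon> (I, x))
      (at_vertex (insert x I) (odd_edge_map D up I x (frag_of b)))) \<in> chains_on (odd_basis (m + 1) s)"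
    unfolding IS prod.case by (rule chains_on_sum)
qed

definition even_differential ::
    "('x set \<times> 'x \<Rightarrow> int) \<Rightarrow> ('x set \<times> ('a set \<Rightarrow> gen) \<Rightarrow>\<^sub>0 int) \<Rightarrow> ('x set \<times> ('a set \<Rightarrow> gen) \<Rightarrow>\<^sub>0 int)" where
  "even_differential \<delta> = cube_differential D \<delta> (even_edge_map D)"

text \<open>Every labelling comes from a set of circles through \<open>to_odd\<close>, so the
  grading count made for \<open>target\<close> serves the even complex too.\<close>

lemma even_differential_chains:
  assumes "c \<in> chains_on (even_basis m s)"
  shows "even_differential \<delta> c \<in> chains_on (even_basis (m + 1) s)"
  unfolding even_differential_def cube_differential_def
proof (rule frag_extend_chains[OF _ assms])
  fix p assume p: "p \<in> even_basis m s"
  obtain I S where IS: "to_odd p = (I, S)" by (cases "to_odd p")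
  have IS_basis: "(I, S) \<in> odd_basis m s" using to_odd_basis[OF p] IS by simp
  have S: "S \<subseteq> circles D I" using IS_basis by (simp add: odd_basis_def)
  have p_eq: "p = (I, label (circles D I) S)"
    using to_even_to_odd[OF p] by (simp add: IS to_even_def)
  have "frag_cmul (\<delta> (I, x)) (at_vertex (insert x I) (even_edge_map D I x (frag_of (label (circles D I) S))))
      \<in> chains_on (even_basis (m + 1) s)"
    if x: "x \<in> crossings D - I" for x
  proof (intro chains_on_cmul at_vertex_chains)
    have xc: "x \<in> crossings D" "x \<notin> I" using x by simp_all
    fix \<tau> assume "\<tau> \<in> Poly_Mapping.keys (even_edge_map D I x (frag_of (label (circles D I) S)))"
    then have "\<tau> \<in> (\<Union>S'\<in>target I x S. Poly_Mapping.keys (frag_of (label (circles D (insert x I)) S')))"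
      unfolding even_edge_map_target[OF xc S] by (rule subsetD[OF keys_sum])
    then obtain S' where S': "S' \<in> target I x S" "\<tau> = label (circles D (insert x I)) S'"
      by (auto simp: keys_frag_of)
    show "(insert x I, \<tau>) \<in> even_basis (m + 1) s"
      using to_even_basis[OF odd_basis_step[OF IS_basis x S'(1)]] by (simp add: to_even_def S'(2))
  qed
  then show "(case p of (I, b) \<Rightarrow> \<Sum>x\<in>crossings D - I. frag_cmul (\<delta> (I, x))
      (at_vertex (insert x I) (even_edge_map D I x (frag_of b)))) \<in> chains_on (even_basis (m + 1) s)"
    unfolding p_eq prod.case by (rule chains_on_sum)
qed

lemma linear_extension_even: "linear_extension (even_edge_map D I x) = even_edge_map D I x"
  by (simp add: linear_extension_def even_edge_map_def Let_def)

lemma even_differential_square: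
  assumes \<delta>: "even_assignment D \<delta>" and c: "c \<in> chains_on (even_basis m s)"
  shows "even_differential \<delta> (even_differential \<delta> c) = 0"
proof (rule additive_map_eq_on_chains[of "\<lambda>c. even_differential \<delta> (even_differential \<delta> c)" "\<lambda>_. 0", OF _ _ _ c])
  show "additive_map (\<lambda>c. even_differential \<delta> (even_differential \<delta> c))"
    unfolding even_differential_def by (rule additive_map_comp[OF cube_differential_additive cube_differential_additive])
  show "additive_map (\<lambda>_. 0)" by (simp add: additive_map_def)
  fix p assume p: "p \<in> even_basis m s"
  obtain I \<sigma> where I\<sigma>: "p = (I, \<sigma>)" by (cases p)
  have I: "I \<in> vertices D" and v: "frag_of \<sigma> \<in> carrier (tensor_power_A (circles D I))"
    using p by (simp_all add: I\<sigma> even_basis_def tensor_power_A_def)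
  show "even_differential \<delta> (even_differential \<delta> (frag_of p)) = 0"
    unfolding even_differential_def I\<sigma>
  proof (rule cube_differential_square[OF finite_crossings])
    fix x y assume xy: "x \<in> crossings D - I" "y \<in> crossings D - I" "x \<noteq> y"
    have "(I, x, y) \<in> squares D" using xy I by (simp add: squares_def)
    then have "frag_cmul (\<delta> (insert x I, y) * \<delta> (I, x)) (even_edge_map D (insert x I) y (even_edge_map D I x (frag_of \<sigma>)))
      = - frag_cmul (\<delta> (insert y I, x) * \<delta> (I, y)) (even_edge_map D (insert y I) x (even_edge_map D I y (frag_of \<sigma>)))"
      using \<delta> v unfolding even_assignment_def by fast
    then show "frag_cmul (\<delta> (I, x) * \<delta> (insert x I, y))
        (linear_extension (even_edge_map D (insert x I) y) (even_edge_map D I x (frag_of \<sigma>)))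
      = - frag_cmul (\<delta> (I, y) * \<delta> (insert y I, x))
        (linear_extension (even_edge_map D (insert y I) x) (even_edge_map D I y (frag_of \<sigma>)))"
      by (simp only: linear_extension_even mult.commute)
  qed
qed

definition compare :: "('x set \<times> 'a set set \<Rightarrow>\<^sub>0 int) \<Rightarrow> ('x set \<times> ('a set \<Rightarrow> gen) \<Rightarrow>\<^sub>0 int)" where
  "compare = frag_extend (\<lambda>p. frag_of (to_even p))"

definition compare_inverse :: "('x set \<times> ('a set \<Rightarrow> gen) \<Rightarrow>\<^sub>0 int) \<Rightarrow> ('x set \<times> 'a set set \<Rightarrow>\<^sub>0 int)" where
  "compare_inverse = frag_extend (\<lambda>p. frag_of (to_odd p))"

lemma compare_additive: "additive_map compare" "additive_map compare_inverse"
  unfolding compare_def compare_inverse_def by (rule additive_map_frag_extend)+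

lemma compare_chains:
  "c \<in> chains_on (odd_basis m s) \<Longrightarrow> compare c \<in> chains_on (even_basis m s)"
  unfolding compare_def by (rule frag_extend_chains) (simp_all add: keys_frag_of to_even_basis)

lemma compare_inverse_chains:
  "c \<in> chains_on (even_basis m s) \<Longrightarrow> compare_inverse c \<in> chains_on (odd_basis m s)"
  unfolding compare_inverse_def by (rule frag_extend_chains) (simp_all add: keys_frag_of to_odd_basis)

lemma additive_map_id: "additive_map (\<lambda>c. c)"
  by (simp add: additive_map_def)

lemma compare_inverse_compare:
  assumes "c \<in> chains_on (odd_basis m s)"
  shows "compare_inverse (compare c) = c"
  by (rule additive_map_eq_on_chains[OF additive_map_comp[OF compare_additive] additive_map_id _ assms])
    (simp add: compare_def compare_inverse_def to_odd_to_even)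

lemma compare_compare_inverse:
  assumes "c \<in> chains_on (even_basis m s)"
  shows "compare (compare_inverse c) = c"
  by (rule additive_map_eq_on_chains[OF additive_map_comp[OF compare_additive(2,1)] additive_map_id _ assms])
    (simp add: compare_def compare_inverse_def to_even_to_odd)

lemma compare_differentials_basis:
  assumes \<epsilon>: "\<epsilon> ` edges D \<subseteq> {1, -1}" and \<delta>: "\<delta> ` edges D \<subseteq> {1, -1}" and p: "p \<in> odd_basis m s"
  shows "is_double (even_differential \<delta> (compare (frag_of p)) - compare (odd_differential \<epsilon> (frag_of p)))"
proof -
  obtain I S where IS: "p = (I, S)" by (cases p)
  have I: "I \<in> vertices D" "S \<subseteq> circles D I" using p by (simp_all add: IS odd_basis_def)
  let ?X = "crossings D - I"
  let ?E = "\<lambda>x. at_vertex (insert x I) (even_edge_map D I x (frag_of (label (circles D I) S)))"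
  let ?O = "\<lambda>x. at_vertex (insert x I) (odd_edge_map D up I x (frag_of S))"
  have "even_differential \<delta> (compare (frag_of p)) = (\<Sum>x\<in>?X. frag_cmul (\<delta> (I, x)) (?E x))"
    by (simp add: even_differential_def compare_def IS to_even_def cube_differential_basis)
  moreover have "compare (odd_differential \<epsilon> (frag_of p)) = (\<Sum>x\<in>?X. frag_cmul (\<epsilon> (I, x)) (compare (?O x)))"
    unfolding odd_differential_def IS cube_differential_basis compare_def
      frag_extend_sum[OF finite_Diff[OF finite_crossings]] comp_def frag_extend_cmul ..
  ultimately have eq: "even_differential \<delta> (compare (frag_of p)) - compare (odd_differential \<epsilon> (frag_of p))
      = (\<Sum>x\<in>?X. frag_cmul (\<delta> (I, x)) (?E x) - frag_cmul (\<epsilon> (I, x)) (compare (?O x)))"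
    by (simp only: sum_subtractf)
  show ?thesis
    unfolding eq
  proof (rule is_double_sum, rule is_double_signs)
    fix x assume x: "x \<in> ?X"
    have xc: "x \<in> crossings D" "x \<notin> I" using x by simp_all
    have e: "(I, x) \<in> edges D" using xc I(1) by (simp add: edges_def)
    show "\<delta> (I, x) = 1 \<or> \<delta> (I, x) = -1" using subsetD[OF \<delta> imageI[OF e]] by simp
    show "\<epsilon> (I, x) = 1 \<or> \<epsilon> (I, x) = -1" using subsetD[OF \<epsilon> imageI[OF e]] by simp
    let ?T = "target I x S" and ?F = "odd_edge_map D up I x (frag_of S)"
    note t = odd_edge_map_target[OF xc I(2)]
    have finT: "finite ?T" by (simp add: target_def Let_def)
    \<comment> \<open>The even edge map is the plain sum over the common support. The odd one has
      odd coefficients there and none elsewhere, so every coefficient of \<open>U\<close> is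
      even.\<close>
    define U where "U = (\<Sum>S'\<in>?T. frag_of S') - ?F"
    have lookup_T: "Poly_Mapping.lookup (\<Sum>S'\<in>?T. frag_of S') B = (if B \<in> ?T then 1 else 0)" for B
      unfolding lookup_sum lookup_frag_of by (rule sum.delta'[OF finT])
    have "is_double U"
    proof (rule even_lookups_double)
      fix B
      show "even (Poly_Mapping.lookup U B)"
      proof (cases "B \<in> ?T")
        case True
        then have "odd (Poly_Mapping.lookup ?F B)" by (rule bspec[OF conjunct2[OF t]])
        then show ?thesis using True by (simp add: U_def lookup_minus lookup_T)
      next
        case False
        then have "B \<notin> Poly_Mapping.keys ?F" using subsetD[OF conjunct1[OF t], of B] by (rule contrapos_nn)
        then show ?thesis using False by (simp add: U_def lookup_minus lookup_T in_keys_iff)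
      qed
    qed
    moreover have "additive_map (\<lambda>w. compare (at_vertex (insert x I) w))"
      by (rule additive_map_comp[OF _ compare_additive(1)]) (simp add: additive_map_def at_vertex_simps)
    ultimately have "is_double (compare (at_vertex (insert x I) U))"
      by (rule is_double_additive[rotated])
    moreover have "?E x = compare (at_vertex (insert x I) (\<Sum>S'\<in>?T. frag_of S'))"
      unfolding even_edge_map_target[OF xc I(2)] compare_def at_vertex_def
        frag_extend_sum[OF finT] comp_def frag_extend_of
      by (simp add: frag_extend_sum[OF finT] comp_def to_even_def)
    moreover have "compare (at_vertex (insert x I) U)
        = compare (at_vertex (insert x I) (\<Sum>S'\<in>?T. frag_of S')) - compare (?O x)"
      by (simp only: U_def at_vertex_simps additive_mapD(1)[OF compare_additive(1)])
    ultimately show "is_double (?E x - compare (?O x))" by simp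
  qed
qed

lemma compare_differentials:
  assumes "\<epsilon> ` edges D \<subseteq> {1, -1}" "\<delta> ` edges D \<subseteq> {1, -1}" and c: "c \<in> chains_on (odd_basis m s)"
  shows "\<exists>e\<in>chains_on (even_basis (m + 1) s).
    even_differential \<delta> (compare c) - compare (odd_differential \<epsilon> c) = e + e"
proof (rule is_double_chains)
  show "even_differential \<delta> (compare c) - compare (odd_differential \<epsilon> c) \<in> chains_on (even_basis (m + 1) s)"
    by (intro chains_on_diff_closed even_differential_chains compare_chains odd_differential_chains c)
  have add: "additive_map (\<lambda>c. even_differential \<delta> (compare c))" "additive_map (\<lambda>c. compare (odd_differential \<epsilon> c))"
    unfolding even_differential_def odd_differential_def
    by (rule additive_map_comp[OF compare_additive(1) cube_differential_additive]
        additive_map_comp[OF cube_differential_additive compare_additive(1)])+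
  have "Poly_Mapping.keys c \<subseteq> odd_basis m s" using c by simp
  then show "is_double (even_differential \<delta> (compare c) - compare (odd_differential \<epsilon> c))"
  proof (induction rule: frag_induction)
    case zero
    show ?case using additive_mapD(2)[OF add(1)] additive_mapD(2)[OF add(2)] is_double_0 by simp
  next
    case (one p)
    then show ?case by (rule compare_differentials_basis[OF assms(1,2)])
  next
    case (diff a b)
    let ?f = "\<lambda>c. even_differential \<delta> (compare c)" and ?g = "\<lambda>c. compare (odd_differential \<epsilon> c)"
    have eq: "?f (a - b) - ?g (a - b) = (?f a - ?g a) - (?f b - ?g b)"
      using additive_mapD(1)[OF add(1), of a b] additive_mapD(1)[OF add(2), of a b] by simp
    show ?case unfolding eq by (rule is_double_diff[OF diff])
  qed
qed

lemma odd_basis_subset: "odd_basis m s \<subseteq> {(I, S). I \<subseteq> crossings D \<and> S \<subseteq> circles D I}"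
  by (auto simp: odd_basis_def vertices_def)

lemma odd_complex:
  assumes "odd_assignment_X D up \<epsilon> \<or> odd_assignment_Y D up \<epsilon>"
  shows "finite_complex (odd_basis (m - 1) s) (odd_basis m s) (odd_basis (m + 1) s) (odd_basis (m + 2) s)
    (odd_differential \<epsilon>)"
proof
  show "additive_map (odd_differential \<epsilon>)"
    unfolding odd_differential_def by (rule cube_differential_additive)
  show "finite (odd_basis m s)" by (rule finite_odd_basis)
  show "odd_differential \<epsilon> c \<in> chains_on (odd_basis m s)" if "c \<in> chains_on (odd_basis (m - 1) s)" for c
    using odd_differential_chains[OF that] by simp
  show "odd_differential \<epsilon> c \<in> chains_on (odd_basis (m + 1) s)" if "c \<in> chains_on (odd_basis m s)" for c
    by (rule odd_differential_chains[OF that])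
  show "odd_differential \<epsilon> c \<in> chains_on (odd_basis (m + 2) s)" if "c \<in> chains_on (odd_basis (m + 1) s)" for c
    using odd_differential_chains[OF that] by (simp add: add.assoc)
  have "odd_differential \<epsilon> (odd_differential \<epsilon> c) = 0" if "c \<in> chains_on (odd_basis n s)" for c n
  proof (rule odd_differential_square[OF assms], rule CollectI)
    show "Poly_Mapping.keys c \<subseteq> {(I, S). I \<subseteq> crossings D \<and> S \<subseteq> circles D I}"
      by (rule order_trans[OF CollectD[OF that] odd_basis_subset])
  qed
  note square = this
  show "odd_differential \<epsilon> (odd_differential \<epsilon> c) = 0" if "c \<in> chains_on (odd_basis (m - 1) s)" for c
    by (rule square[OF that])
  show "odd_differential \<epsilon> (odd_differential \<epsilon> c) = 0" if "c \<in> chains_on (odd_basis m s)" for c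
    by (rule square[OF that])
qed

lemma even_complex:
  assumes "even_assignment D \<delta>"
  shows "finite_complex (even_basis (m - 1) s) (even_basis m s) (even_basis (m + 1) s) (even_basis (m + 2) s)
    (even_differential \<delta>)"
proof
  show "additive_map (even_differential \<delta>)"
    unfolding even_differential_def by (rule cube_differential_additive)
  show "finite (even_basis m s)" by (rule finite_even_basis)
  show "even_differential \<delta> c \<in> chains_on (even_basis m s)" if "c \<in> chains_on (even_basis (m - 1) s)" for c
    using even_differential_chains[OF that] by simp
  show "even_differential \<delta> c \<in> chains_on (even_basis (m + 1) s)" if "c \<in> chains_on (even_basis m s)" for c
    by (rule even_differential_chains[OF that])
  show "even_differential \<delta> c \<in> chains_on (even_basis (m + 2) s)" if "c \<in> chains_on (even_basis (m + 1) s)" for c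
    using even_differential_chains[OF that] by (simp add: add.assoc)
  show "even_differential \<delta> (even_differential \<delta> c) = 0" if "c \<in> chains_on (even_basis (m - 1) s)" for c
    by (rule even_differential_square[OF assms that])
  show "even_differential \<delta> (even_differential \<delta> c) = 0" if "c \<in> chains_on (even_basis m s)" for c
    by (rule even_differential_square[OF assms that])
qed

proposition Kh_mod_two:
  assumes \<epsilon>: "odd_assignment_X D up \<epsilon> \<or> odd_assignment_Y D up \<epsilon>" and \<delta>: "even_assignment D \<delta>"
  shows "Tor (even_Kh D \<delta> (m + 1) s) Z2 \<times>\<times> tensor_product (even_Kh D \<delta> m s) Z2
    \<cong> Tor (odd_Kh D up \<epsilon> (m + 1) s) Z2 \<times>\<times> tensor_product (odd_Kh D up \<epsilon> m s) Z2"
proof -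
  have "\<epsilon> ` edges D \<subseteq> {1, -1}"
    using \<epsilon> unfolding odd_assignment_X_def odd_assignment_Y_def by (elim disjE conjE)
  moreover have "\<delta> ` edges D \<subseteq> {1, -1}" using \<delta> unfolding even_assignment_def by (elim conjE)
  ultimately have signs: "\<epsilon> ` edges D \<subseteq> {1, -1}" "\<delta> ` edges D \<subseteq> {1, -1}" by this+
  have comm0: "\<exists>e\<in>chains_on (even_basis m s). even_differential \<delta> (compare c) - compare (odd_differential \<epsilon> c) = e + e"
    if "c \<in> chains_on (odd_basis (m - 1) s)" for c
    using compare_differentials[OF signs that] by simp
  \<comment> \<open>This aligns the degrees, so that the two homology groups on each side are read
    off from one window of four terms.\<close>
  have m: "m + 1 - 1 = m" "m + 1 + 1 = m + 2" by simp_all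
  show ?thesis
    unfolding even_Kh_def odd_Kh_def odd_chain_group_eq even_chain_group_eq m
      odd_differential_def[symmetric] even_differential_def[symmetric]
    by (rule mod2_isomorphic_complexes[OF odd_complex[OF \<epsilon>] even_complex[OF \<delta>] compare_additive];
        (rule compare_chains compare_inverse_chains compare_inverse_compare compare_compare_inverse
          comm0 compare_differentials[OF signs]; assumption))
qed

end

theorem proposition1p6:
  fixes D :: "('x, 'a::linorder) diagram"
    and up :: "'x \<Rightarrow> bool"
    and \<epsilon> \<delta> :: "'x set \<times> 'x \<Rightarrow> int"
    and m s :: int
  assumes "link_diagram D"
    and "odd_assignment_X D up \<epsilon> \<or> odd_assignment_Y D up \<epsilon>"
    and "even_assignment D \<delta>"
  shows "Tor (even_Kh D \<delta> (m + 1) s) (integer_mod_group 2)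
           \<times>\<times> tensor_product (even_Kh D \<delta> m s) (integer_mod_group 2)
         \<cong> Tor (odd_Kh D up \<epsilon> (m + 1) s) (integer_mod_group 2)
           \<times>\<times> tensor_product (odd_Kh D up \<epsilon> m s) (integer_mod_group 2)"
proof -
  interpret arrow_diagram D up
    by unfold_locales (rule assms(1))
  show ?thesis by (rule Kh_mod_two[OF assms(2,3)])
qed

end
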